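(* Let $K$ be an algebraic number field, and let $\mu$ be an algebraic integer in the ring of integers $O_K$ of $K$ that is not totally real. Then there exists an algebraic integer $\alpha \in O_K$ such that $$K = \mathbb{Q}(\alpha)\quad\text{and}\quad H(\alpha) \le H(\mu)\, c_K.$$
   Context: Let $d=[K:\mathbb{Q}]$, let $\Delta_K$ be the discriminant of $K$, and let $s$ be the number of complex (non-real) archimedean places of $K$. Define $c_K = (2/\pi)^{s/d}\,|\Delta_K|^{1/(2d)}$. For each place $v$ of $K$, let $\|\cdot\|_v$ be the absolute value from $v$ extending the usual absolute value on $\mathbb{Q}$ (archimedean case) or the standard $p$-adic absolute value on $\mathbb{Q}_p$, let $d_v=[K_v:\mathbb{Q}_v]$ be the local degree, and set $|\cdot|_v=\|\cdot\|_v^{d_v/d}$. The absolute multiplicative Weil height of $\alpha\in K^\times$ is $H(\alpha)=\prod_v \max\{1,|\alpha|_v\}$. An algebraic number is totally real if all of its conjugates over $\mathbb{Q}$ are real. *)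

theory Defs
  imports
    Complex_Main
    "HOL-Algebra.Embedded_Algebras"
    "HOL-Algebra.QuotRing"
    "HOL-Algebra.Generated_Fields"
    "HOL-Algebra.Algebraic_Closure_Type"
    "Jordan_Normal_Form.Determinant"
begin

text \<open>
  The number field $K$ is a type of class \<open>field_char_0\<close>, of finite dimension over its
  prime field \<open>\<rat>\<close>. Its ring of integers is the set of all \<open>x\<close> with \<open>algebraic_int x\<close>.
\<close>

definition number_field :: "'a::field_char_0 itself \<Rightarrow> bool" where
  "number_field _ \<longleftrightarrow> ring.finite_dimension (ring_of_type_algebra :: 'a ring) \<rat> UNIV"

definition field_degree :: "'a::field_char_0 itself \<Rightarrow> nat" where
  "field_degree _ = ring.dim (ring_of_type_algebra :: 'a ring) \<rat> UNIV"

definition conjugate_over_rat :: "'a::field_char_0 \<Rightarrow> complex \<Rightarrow> bool" where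
  "conjugate_over_rat x z \<longleftrightarrow>
     (\<exists>p :: rat poly. irreducible p \<and> poly (map_poly of_rat p) x = 0 \<and> poly (map_poly of_rat p) z = 0)"

definition totally_real :: "'a::field_char_0 \<Rightarrow> bool" where
  "totally_real x \<longleftrightarrow> (\<forall>z. conjugate_over_rat x z \<longrightarrow> z \<in> \<real>)"

definition absolute_value :: "('a::Fields.field \<Rightarrow> real) \<Rightarrow> bool" where
  "absolute_value v \<longleftrightarrow>
     (\<forall>x. v x \<ge> 0) \<and> (\<forall>x. v x = 0 \<longleftrightarrow> x = 0) \<and>
     (\<forall>x y. v (x * y) = v x * v y) \<and> (\<forall>x y. v (x + y) \<le> v x + v y)"

definition padic_abs :: "nat \<Rightarrow> rat \<Rightarrow> real" where
  "padic_abs p q = (if q = 0 then 0 else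
     real p powi (int (multiplicity (int p) (snd (quotient_of q)))
                - int (multiplicity (int p) (fst (quotient_of q)))))"

text \<open>
  A place, i.e. an equivalence class of nontrivial absolute values, is represented by its
  unique member whose restriction to \<open>\<rat>\<close> is the usual absolute value or a standard
  $p$-adic one; so an element \<open>v\<close> of \<open>places\<close> is itself the function $\|\cdot\|_v$.
\<close>

definition arch_places :: "('a::field_char_0 \<Rightarrow> real) set" where
  "arch_places = {v. absolute_value v \<and> (\<forall>q. v (of_rat q) = \<bar>real_of_rat q\<bar>)}"

definition nonarch_places :: "('a::field_char_0 \<Rightarrow> real) set" where
  "nonarch_places =
     {v. absolute_value v \<and> (\<exists>p. prime p \<and> (\<forall>q. v (of_rat q) = padic_abs p q))}"

definition places :: "('a::field_char_0 \<Rightarrow> real) set" where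
  "places = arch_places \<union> nonarch_places"

definition real_place :: "('a::field_char_0 \<Rightarrow> real) \<Rightarrow> bool" where
  "real_place v \<longleftrightarrow>
     (\<exists>\<sigma> \<in> Ring.ring_hom (ring_of_type_algebra :: 'a ring) (ring_of_type_algebra :: real ring).
        v = (\<lambda>x. \<bar>\<sigma> x\<bar>))"

definition num_complex_places :: "'a::field_char_0 itself \<Rightarrow> nat" where
  "num_complex_places _ = card {v :: 'a \<Rightarrow> real. v \<in> arch_places \<and> \<not> real_place v}"

definition cauchy_ring :: "('a::field_char_0 \<Rightarrow> real) \<Rightarrow> (nat \<Rightarrow> 'a) ring" where
  "cauchy_ring v =
     \<lparr> carrier = {f. \<forall>e>0. \<exists>N. \<forall>m\<ge>N. \<forall>n\<ge>N. v (f m - f n) < e},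
       monoid.mult = (\<lambda>f g n. f n * g n),
       one = (\<lambda>_. 1),
       ring.zero = (\<lambda>_. 0),
       add = (\<lambda>f g n. f n + g n) \<rparr>"

definition null_seqs :: "('a::field_char_0 \<Rightarrow> real) \<Rightarrow> (nat \<Rightarrow> 'a) set" where
  "null_seqs v = {f. (\<lambda>n. v (f n)) \<longlonglongrightarrow> 0}"

definition completion :: "('a::field_char_0 \<Rightarrow> real) \<Rightarrow> (nat \<Rightarrow> 'a) set ring" where
  "completion v = cauchy_ring v Quot null_seqs v"

text \<open>
  The completion of \<open>\<rat>\<close> at the restriction of \<open>v\<close>, embedded in the completion of $K$ as the
  set of classes of Cauchy sequences of rationals.
\<close>

definition rat_completion :: "('a::field_char_0 \<Rightarrow> real) \<Rightarrow> (nat \<Rightarrow> 'a) set set" where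
  "rat_completion v =
     {null_seqs v +>\<^bsub>cauchy_ring v\<^esub> f | f. f \<in> carrier (cauchy_ring v) \<and> range f \<subseteq> \<rat>}"

definition local_degree :: "('a::field_char_0 \<Rightarrow> real) \<Rightarrow> nat" where
  "local_degree v = ring.dim (completion v) (rat_completion v) (carrier (completion v))"

definition normalized_abs :: "('a::field_char_0 \<Rightarrow> real) \<Rightarrow> 'a \<Rightarrow> real" where
  "normalized_abs v x = v x powr (real (local_degree v) / real (field_degree TYPE('a)))"

text \<open>
  There are infinitely many places, but all except finitely many factors equal 1; only the
  others enter the product, since \<open>prod\<close> over an infinite set is 1 by convention.
\<close>

definition weil_height :: "'a::field_char_0 \<Rightarrow> real" where
  "weil_height x =
     (\<Prod>v \<in> {v \<in> places. max 1 (normalized_abs v x) \<noteq> 1}. max 1 (normalized_abs v x))"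

definition integral_basis :: "(nat \<Rightarrow> 'a::field_char_0) \<Rightarrow> bool" where
  "integral_basis \<omega> \<longleftrightarrow>
     (\<forall>i < field_degree TYPE('a). algebraic_int (\<omega> i)) \<and>
     (\<forall>x. algebraic_int x \<longrightarrow>
        (\<exists>!c :: nat \<Rightarrow> int. c \<in> {..<field_degree TYPE('a)} \<rightarrow>\<^sub>E UNIV \<and>
           x = (\<Sum>i < field_degree TYPE('a). of_int (c i) * \<omega> i)))"

definition enumerates_embeddings :: "(nat \<Rightarrow> 'a::field_char_0 \<Rightarrow> complex) \<Rightarrow> bool" where
  "enumerates_embeddings \<sigma> \<longleftrightarrow> bij_betw \<sigma> {..<field_degree TYPE('a)}
     (Ring.ring_hom (ring_of_type_algebra :: 'a ring) (ring_of_type_algebra :: complex ring))"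

text \<open>
  $\Delta_K = \det(\sigma_i(\omega_j))^2$; it depends neither on the integral basis
  nor on the order of the embeddings, and is an integer, here regarded as a complex number.
\<close>

definition discriminant :: "'a::field_char_0 itself \<Rightarrow> complex" where
  "discriminant _ = (SOME D. \<exists>(\<omega> :: nat \<Rightarrow> 'a) \<sigma>.
     integral_basis \<omega> \<and> enumerates_embeddings \<sigma> \<and>
     D = (det (mat (field_degree TYPE('a)) (field_degree TYPE('a)) (\<lambda>(i, j). \<sigma> i (\<omega> j))))\<^sup>2)"

definition c_const :: "'a::field_char_0 itself \<Rightarrow> real" where
  "c_const _ =
     (2 / pi) powr (real (num_complex_places TYPE('a)) / real (field_degree TYPE('a)))
     * cmod (discriminant TYPE('a)) powr (1 / (2 * real (field_degree TYPE('a))))"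

end

theory Submission
  imports Defs "Jordan_Normal_Form.Char_Poly" "HOL-Analysis.Ball_Volume"
begin

text \<open>
  Fix an archimedean place \<open>w\<close> of \<open>K\<close> at which \<open>\<mu>\<close> is not real. Minkowski's convex body theorem yields a
  nonzero algebraic integer \<open>\<alpha>\<close> with \<open>|\<sigma>\<^sub>i \<alpha>| < 1 / max 1 |\<sigma>\<^sub>i \<mu>|\<close> at every embedding outside \<open>w\<close>, and
  only as large at \<open>w\<close> as the discriminant and the volume of discs force. Whichever of \<open>\<alpha>\<close> and \<open>\<alpha> \<mu>\<close> is
  not real at \<open>w\<close> has all its other conjugates of modulus below one. Being an algebraic integer, it is
  of modulus at least one at \<open>w\<close>, so no other embedding agrees with \<open>\<sigma>\<^sub>w\<close> on it and it generates
  \<open>K\<close>; its height is \<open>|\<sigma>\<^sub>w|\<^sup>2\<close> to the power \<open>1 / d\<close>.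

  An archimedean absolute value is seen to be some \<open>|\<sigma>\<^sub>i|\<close> without Ostrowski's theorem: otherwise there
  are elements on which it exceeds each \<open>|\<sigma>\<^sub>i|\<close>, and density of the embeddings of \<open>K\<close> in their real
  span supplies approximate idempotents that lead to a contradiction. An integral basis is obtained by
  minimising the discriminant.
\<close>

text \<open>The bounds \<open>1 / max 1 |\<sigma> i \<mu>|\<close> keep both \<alpha> and \<alpha>
  \<mu> below one away from \<open>w\<close>, so the choice between the two can wait until the
  lattice point is known. They cost nothing in the end. At \<open>w\<close> the convex body has to
  grow by the product of \<open>max 1 |\<sigma> i \<mu>|\<close> over the other embeddings,
  multiplication by \<mu> adds at most \<open>(max 1 |\<sigma> w \<mu>|)^2\<close>, and together
  these factors are exactly \<open>H(\<mu>)^d\<close>. What remains, \<open>c_K^d\<close>, is the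
  covolume of the ring of integers divided by the volume of the half-size unit polydisc. Non-reality
  at \<open>w\<close> matters because \<open>\<sigma> w\<close> and its complex conjugate have the
  same modulus on every element; size alone can never separate these two embeddings. Places, local
  degrees and the discriminant are defined without reference to a fixed list of embeddings. Much of
  the work is therefore a translation: products over places become products over \<open>d\<close>
  embeddings, on which complex conjugation acts as a permutation of indices, and the basis and the
  enumeration in use are those that realise the value of \<open>discriminant\<close>.\<close>

hide_const (open) Finite_Cartesian_Product.mat Finite_Cartesian_Product.vec
  Finite_Cartesian_Product.row Finite_Cartesian_Product.transpose Complete_Measure.completion
unbundle no vec_syntax

section \<open>Volumes and Blichfeldt's theorem\<close>

abbreviation coord_measure :: "nat set \<Rightarrow> (nat \<Rightarrow> real) measure" where
  "coord_measure I \<equiv> PiM I (\<lambda>_. lborel)"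

interpretation lborel_product: product_sigma_finite "\<lambda>_ :: nat. lborel :: real measure"
  by standard

text \<open>The result is restricted to \<open>{..<n}\<close> because the points of a product
  measure space are extensional functions.\<close>

definition mat_apply :: "nat \<Rightarrow> real mat \<Rightarrow> (nat \<Rightarrow> real) \<Rightarrow> nat \<Rightarrow> real" where
  "mat_apply n A x = (\<lambda>i\<in>{..<n}. \<Sum>j<n. A $$ (i, j) * x j)"

lemma measurable_mat_apply [measurable]:
  "mat_apply n A \<in> coord_measure {..<n} \<rightarrow>\<^sub>M coord_measure {..<n}"
  unfolding mat_apply_def by measurable

lemma mat_apply_mult:
  assumes "A \<in> carrier_mat n n" "B \<in> carrier_mat n n"
  shows "mat_apply n (A * B) x = mat_apply n A (mat_apply n B x)"
proof
  fix i
  show "mat_apply n (A * B) x i = mat_apply n A (mat_apply n B x) i"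
  proof (cases "i < n")
    case True
    have "mat_apply n (A * B) x i = (\<Sum>j<n. (\<Sum>k<n. A $$ (i, k) * B $$ (k, j)) * x j)"
      using assms True by (auto simp: mat_apply_def scalar_prod_def lessThan_atLeast0 intro!: sum.cong)
    also have "\<dots> = (\<Sum>k<n. A $$ (i, k) * (\<Sum>j<n. B $$ (k, j) * x j))"
      by (subst sum_distrib_left, subst sum.swap) (simp add: sum_distrib_right mult.assoc)
    finally show ?thesis using True by (simp add: mat_apply_def)
  qed (simp add: mat_apply_def)
qed

text \<open>Formulated with preimages, so that measurability is automatic and a product of matrices
  is handled by pulling back twice. The determinant stands on the left, which avoids dividing in
  \<open>ennreal\<close>.\<close>

definition scales_by_det :: "nat \<Rightarrow> real mat \<Rightarrow> bool" where
  "scales_by_det n A \<longleftrightarrow> (\<forall>U \<in> sets (coord_measure {..<n}).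
     ennreal \<bar>det A\<bar> * emeasure (coord_measure {..<n})
       (mat_apply n A -` U \<inter> space (coord_measure {..<n})) = emeasure (coord_measure {..<n}) U)"

lemma scales_by_det_mult:
  assumes "A \<in> carrier_mat n n" "B \<in> carrier_mat n n" "scales_by_det n A" "scales_by_det n B"
  shows "scales_by_det n (A * B)"
  unfolding scales_by_det_def
proof
  fix U assume U: "U \<in> sets (coord_measure {..<n})"
  let ?M = "coord_measure {..<n}"
  let ?Y = "mat_apply n A -` U \<inter> space ?M"
  have Y: "?Y \<in> sets ?M" using U by (rule measurable_sets[OF measurable_mat_apply])
  have "mat_apply n B x \<in> space ?M" if "x \<in> space ?M" for x
    using measurable_space[OF measurable_mat_apply that] .
  then have *: "mat_apply n (A * B) -` U \<inter> space ?M = mat_apply n B -` ?Y \<inter> space ?M"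
    using assms by (auto simp: mat_apply_mult)
  have "ennreal \<bar>det (A * B)\<bar> * emeasure ?M (mat_apply n (A * B) -` U \<inter> space ?M)
     = ennreal \<bar>det A\<bar> * (ennreal \<bar>det B\<bar> * emeasure ?M (mat_apply n B -` ?Y \<inter> space ?M))"
    unfolding * using assms(1,2) by (simp add: det_mult abs_mult ennreal_mult mult.assoc)
  also have "\<dots> = emeasure ?M U"
    using assms(3,4)[unfolded scales_by_det_def, rule_format, OF U] assms(4)[unfolded scales_by_det_def, rule_format, OF Y]
    by presburger
  finally show "ennreal \<bar>det (A * B)\<bar> * emeasure ?M (mat_apply n (A * B) -` U \<inter> space ?M) = emeasure ?M U" .
qed

text \<open>In the Leibniz formula every permutation other than the identity moves an index
  different from \<open>i\<close>, and the entry there is 0. Over the reals this serves the change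
  of variables, over the complex numbers the effect of exchanging one basis element.\<close>

lemma det_one_row_matrix:
  fixes R :: "'a :: comm_ring_1 mat"
  assumes R: "R \<in> carrier_mat n n" and i: "i < n"
    and rows: "\<And>k j. k < n \<Longrightarrow> j < n \<Longrightarrow> k \<noteq> i \<Longrightarrow> R $$ (k, j) = (if j = k then 1 else 0)"
  shows "det R = R $$ (i, i)"
proof -
  have zero: "(\<Prod>k = 0..<n. R $$ (k, p k)) = 0" if p: "p permutes {0..<n}" "p \<noteq> id" for p
  proof -
    have "\<exists>k<n. k \<noteq> i \<and> p k \<noteq> k"
    proof (rule ccontr)
      assume "\<not> ?thesis"
      then have fixed: "p k = k" if "k \<noteq> i" for k
        using that p(1) by (cases "k < n") (auto simp: permutes_def)
      have "p i = i" using fixed permutes_inj[OF p(1)] by (metis injD)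
      with fixed have "p = id" by (metis eq_id_iff)
      with p(2) show False by simp
    qed
    then obtain k where k: "k < n" "k \<noteq> i" "p k \<noteq> k" by auto
    have "p k < n" using permutes_in_image[OF p(1), of k] k by simp
    then have "R $$ (k, p k) = 0" using k rows by auto
    then show ?thesis using k by (intro prod_zero) auto
  qed
  have "det R = (\<Sum>p | p permutes {0..<n}. signof p * (\<Prod>k = 0..<n. R $$ (k, p k)))"
    by (rule det_def'[OF R])
  also have "\<dots> = (\<Sum>p\<in>{id}. signof p * (\<Prod>k = 0..<n. R $$ (k, p k)))"
    by (rule sum.mono_neutral_right) (auto simp: finite_permutations permutes_id zero)
  also have "\<dots> = (\<Prod>k = 0..<n. R $$ (k, k))" by simp
  also have "\<dots> = (\<Prod>k = 0..<n. if k = i then R $$ (i, i) else 1)"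
    by (rule prod.cong) (auto simp: rows)
  finally show ?thesis using i by simp
qed

text \<open>By Fubini only coordinate \<open>i\<close> has to be integrated: with the others fixed
  the map is affine in it, with slope \<open>R $$ (i, i) = det R\<close>.\<close>

lemma scales_by_det_one_row:
  assumes R: "R \<in> carrier_mat n n" and i: "i < n"
    and rows: "\<And>k j. k < n \<Longrightarrow> j < n \<Longrightarrow> k \<noteq> i \<Longrightarrow> R $$ (k, j) = (if j = k then 1 else 0)"
    and nz: "R $$ (i, i) \<noteq> 0"
  shows "scales_by_det n R"
  unfolding scales_by_det_def
proof
  define J where "J = {..<n} - {i}"
  let ?M = "coord_measure {..<n}"
  have ins: "insert i J = {..<n}" and J: "finite J" "i \<notin> J" using i by (auto simp: J_def)
  fix U assume U [measurable]: "U \<in> sets ?M"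
  let ?a = "R $$ (i, i)"
  let ?c = "\<lambda>x. \<Sum>j\<in>J. R $$ (i, j) * x j"
  have app: "mat_apply n R (x(i := y)) = x(i := ?c x + ?a * y)" if x: "x \<in> space (coord_measure J)" for x y
  proof
    fix k
    have un: "x k = undefined" if "k \<notin> J" for k
      using x that by (auto simp: space_PiM PiE_def extensional_def)
    have "(\<Sum>j<n. R $$ (i, j) * (x(i := y)) j) = ?a * y + ?c x"
      unfolding ins[symmetric] using J by (simp add: sum.insert) (intro sum.cong; auto)
    moreover have "(\<Sum>j<n. R $$ (k, j) * (x(i := y)) j) = x k" if "k < n" "k \<noteq> i"
    proof -
      have "(\<Sum>j<n. R $$ (k, j) * (x(i := y)) j) = (\<Sum>j<n. if j = k then x k else 0)"
        using that rows by (intro sum.cong) auto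
      then show ?thesis using that by simp
    qed
    ultimately show "mat_apply n R (x(i := y)) k = (x(i := ?c x + ?a * y)) k"
      using i un[of k] by (auto simp: mat_apply_def J_def)
  qed
  have mX [measurable]: "indicator U \<in> borel_measurable (coord_measure (insert i J))"
    unfolding ins by simp
  let ?Y = "mat_apply n R -` U \<inter> space ?M"
  have Y [measurable]: "?Y \<in> sets ?M" using U by (rule measurable_sets[OF measurable_mat_apply])
  have "emeasure ?M U = (\<integral>\<^sup>+x. indicator U x \<partial>coord_measure (insert i J))"
    unfolding ins by (simp add: nn_integral_indicator)
  also have "\<dots> = (\<integral>\<^sup>+x. (\<integral>\<^sup>+y. indicator U (x(i := y)) \<partial>lborel) \<partial>coord_measure J)"
    by (rule lborel_product.product_nn_integral_insert[OF J mX])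
  also have "\<dots> = (\<integral>\<^sup>+x. ennreal \<bar>?a\<bar> * (\<integral>\<^sup>+y. indicator ?Y (x(i := y)) \<partial>lborel) \<partial>coord_measure J)"
  proof (rule nn_integral_cong)
    fix x assume x: "x \<in> space (coord_measure J)"
    have "(\<lambda>y. x(i := y)) \<in> lborel \<rightarrow>\<^sub>M coord_measure (insert i J)"
      by (rule measurable_component_update[OF x J(2)])
    from measurable_comp[OF this mX]
    have m: "(\<lambda>y. indicator U (x(i := y)) :: ennreal) \<in> borel_measurable borel"
      by (simp add: comp_def)
    have "x(i := y) \<in> space ?M" for y
      using x J unfolding ins[symmetric] by (auto simp: space_PiM PiE_def extensional_def)
    then have "indicator ?Y (x(i := y)) = (indicator U (x(i := ?c x + ?a * y)) :: ennreal)" for y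
      by (simp add: app[OF x] indicator_def)
    then show "(\<integral>\<^sup>+y. indicator U (x(i := y)) \<partial>lborel) = ennreal \<bar>?a\<bar> * (\<integral>\<^sup>+y. indicator ?Y (x(i := y)) \<partial>lborel)"
      using nn_integral_real_affine[OF m nz, of "?c x"] by simp
  qed
  also have "\<dots> = ennreal \<bar>?a\<bar> * (\<integral>\<^sup>+x. (\<integral>\<^sup>+y. indicator ?Y (x(i := y)) \<partial>lborel) \<partial>coord_measure J)"
  proof (rule nn_integral_cmult)
    have [measurable]: "?Y \<in> sets (coord_measure (insert i J))" unfolding ins by (rule Y)
    show "(\<lambda>x. \<integral>\<^sup>+y. indicator ?Y (x(i := y)) \<partial>lborel) \<in> borel_measurable (coord_measure J)"
      by measurable
  qed
  also have "(\<integral>\<^sup>+x. (\<integral>\<^sup>+y. indicator ?Y (x(i := y)) \<partial>lborel) \<partial>coord_measure J)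
     = (\<integral>\<^sup>+x. indicator ?Y x \<partial>coord_measure (insert i J))"
    by (rule lborel_product.product_nn_integral_insert[OF J, symmetric]) (simp add: ins Y del: vimage_Int)
  also have "\<dots> = emeasure ?M ?Y"
    unfolding ins by (rule nn_integral_indicator[OF Y])
  finally show "ennreal \<bar>det R\<bar> * emeasure ?M ?Y = emeasure ?M U"
    by (simp add: det_one_row_matrix[OF R i rows])
qed

text \<open>The preimage of a box is the box with its sides permuted, and a product measure is
  determined by its values on boxes. The determinant is a sign.\<close>

lemma scales_by_det_permutation:
  assumes A: "A \<in> carrier_mat n n" and p: "p permutes {0..<n}"
    and rows: "\<And>k j. k < n \<Longrightarrow> j < n \<Longrightarrow> A $$ (k, j) = (if j = p k then 1 else 0)"
  shows "scales_by_det n A"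
  unfolding scales_by_det_def
proof
  let ?M = "coord_measure {..<n}"
  have pn: "p k < n" if "k < n" for k using permutes_in_image[OF p, of k] that by simp
  have "A = mat n n (\<lambda>(i, j). 1\<^sub>m n $$ (p i, j))"
    using A by (intro eq_matI) (auto simp: rows pn)
  then have "det A = signof p"
    using det_permute_rows[OF one_carrier_mat p] by (metis det_one mult.right_neutral)
  then have d: "\<bar>det A\<bar> = 1" by (simp add: sign_def)
  have app: "mat_apply n A x = (\<lambda>k\<in>{..<n}. x (p k))" for x
  proof -
    have "(\<Sum>j<n. A $$ (k, j) * x j) = x (p k)" if "k < n" for k
    proof -
      have "(\<Sum>j<n. A $$ (k, j) * x j) = (\<Sum>j<n. if j = p k then x j else 0)"
        using that by (intro sum.cong) (auto simp: rows)
      then show ?thesis using pn[OF that] by simp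
    qed
    then show ?thesis by (auto simp: mat_apply_def fun_eq_iff)
  qed
  let ?q = "Hilbert_Choice.inv p"
  have "distr ?M ?M (mat_apply n A) = ?M"
  proof (rule lborel_product.PiM_eqI)
    fix B :: "nat \<Rightarrow> real set" assume B: "\<And>i. i \<in> {..<n} \<Longrightarrow> B i \<in> sets lborel"
    have qn: "?q k < n" if "k < n" for k using permutes_in_image[OF permutes_inv[OF p], of k] that by simp
    have "mat_apply n A -` (Pi\<^sub>E {..<n} B) \<inter> space ?M = Pi\<^sub>E {..<n} (\<lambda>k. B (?q k))"
    proof (intro Set.set_eqI iffI)
      fix x assume x: "x \<in> mat_apply n A -` (Pi\<^sub>E {..<n} B) \<inter> space ?M"
      then have "x (p k) \<in> B k" if "k < n" for k
        using that unfolding app by (auto simp: PiE_iff)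
      from this[OF qn] have "x k \<in> B (?q k)" if "k < n" for k
        using that by (simp add: permutes_inverses[OF p])
      then show "x \<in> Pi\<^sub>E {..<n} (\<lambda>k. B (?q k))" using x by (auto simp: space_PiM PiE_iff)
    next
      fix x assume x: "x \<in> Pi\<^sub>E {..<n} (\<lambda>k. B (?q k))"
      then have "x (p k) \<in> B k" if "k < n" for k
        using that pn[OF that] by (force simp: PiE_iff permutes_inverses[OF p])
      then show "x \<in> mat_apply n A -` (Pi\<^sub>E {..<n} B) \<inter> space ?M"
        using x unfolding app by (auto simp: space_PiM PiE_iff)
    qed
    then have "emeasure (distr ?M ?M (mat_apply n A)) (Pi\<^sub>E {..<n} B)
       = (\<Prod>k<n. emeasure lborel (B (?q k)))"
      using B qn by (subst emeasure_distr) (auto intro!: sets_PiM_I_finite lborel_product.emeasure_PiM)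
    also have "\<dots> = (\<Prod>k<n. emeasure lborel (B k))"
      using prod.permute[OF permutes_inv[OF p], of "\<lambda>k. emeasure lborel (B k)"]
      by (simp add: comp_def lessThan_atLeast0)
    finally show "emeasure (distr ?M ?M (mat_apply n A)) (Pi\<^sub>E {..<n} B) = (\<Prod>k<n. emeasure lborel (B k))" .
  qed auto
  then show "ennreal \<bar>det A\<bar> * emeasure ?M (mat_apply n A -` U \<inter> space ?M) = emeasure ?M U"
    if "U \<in> sets ?M" for U
    using emeasure_distr[OF measurable_mat_apply[of n A] that] by (simp add: d)
qed

text \<open>
  The induction is on the number of rows of \<open>A\<close> that are not unit vectors: such a row is split off as a
  factor differing from the identity in that row only, and a nonsingular matrix without such rows
  permutes the coordinates.
\<close>
lemma scales_by_det_nonsingular: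
  assumes "A \<in> carrier_mat n n" "det A \<noteq> 0"
  shows "scales_by_det n A"
  using assms
proof (induction "card {i. i < n \<and> \<not> (\<exists>j<n. \<forall>k<n. A $$ (i, k) = (if k = j then 1 else 0))}"
    arbitrary: A rule: less_induct)
  case less
  let ?bad = "\<lambda>A. {i. i < n \<and> \<not> (\<exists>j<n. \<forall>k<n. A $$ (i, k) = (if k = j then 1 else 0))} :: nat set"
  note A = less.prems(1)
  show ?case
  proof (cases "?bad A = {}")
    case True
    then have "\<forall>i. \<exists>j. i < n \<longrightarrow> j < n \<and> (\<forall>k<n. A $$ (i, k) = (if k = j then 1 else 0))"
      by auto
    then obtain q where q: "\<And>i. i < n \<Longrightarrow> q i < n"
      "\<And>i k. i < n \<Longrightarrow> k < n \<Longrightarrow> A $$ (i, k) = (if k = q i then 1 else 0)"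
      by metis
    define p where "p = (\<lambda>i. if i < n then q i else i)"
    have "inj_on q {0..<n}"
    proof (rule inj_onI, rule ccontr)
      fix i j assume ij: "i \<in> {0..<n}" "j \<in> {0..<n}" "q i = q j" "i \<noteq> j"
      then have "Matrix.row A i = Matrix.row A j" using A by (intro eq_vecI) (auto simp: q)
      then have "det A = 0" using ij by (intro det_identical_rows[OF A ij(4)]) auto
      with less.prems show False by simp
    qed
    then have "bij_betw q {0..<n} {0..<n}"
      using q(1) by (intro bij_betw_imageI endo_inj_surj) auto
    then have "bij_betw p {0..<n} {0..<n}"
      by (rule bij_betw_cong[THEN iffD1, rotated]) (simp add: p_def)
    then have "p permutes {0..<n}"
      by (rule bij_imp_permutes) (simp add: p_def)
    then show ?thesis
      by (rule scales_by_det_permutation[OF A]) (auto simp: q p_def)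
  next
    case False
    then obtain i where i: "i < n" "i \<in> ?bad A" by auto
    \<comment> \<open>Laplace expansion along row \<open>i\<close> has a nonzero term. Replacing
      that row by the unit vector at such a column \<open>j\<close> gives a matrix with determinant
      \<open>cofactor A i j\<close>, hence still nonsingular, and repairs a bad row.\<close>
    have "(\<Sum>j<n. A $$ (i, j) * cofactor A i j) \<noteq> 0"
      using laplace_expansion_row[OF A i(1)] less.prems by simp
    then obtain j where j: "j < n" "cofactor A i j \<noteq> 0"
      by (metis (no_types, lifting) lessThan_iff mult_zero_right sum.not_neutral_contains_not_neutral)
    define A' where "A' = Matrix.mat n n (\<lambda>(k, l). if k = i then if l = j then 1 else 0 else A $$ (k, l))"
    have A': "A' \<in> carrier_mat n n" by (simp add: A'_def)
    have "cofactor A' i l = cofactor A i l" if "l < n" for l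
    proof -
      have "mat_delete A' i l = mat_delete A i l"
        unfolding mat_delete_def using A A' i(1) that
        by (intro eq_matI) (auto simp: A'_def)
      then show ?thesis by (simp add: cofactor_def)
    qed
    then have "det A' = (\<Sum>l<n. (if l = j then 1 else 0) * cofactor A i l)"
      using laplace_expansion_row[OF A' i(1)] i(1) by (simp add: A'_def)
    also have "\<dots> = (\<Sum>l<n. if l = j then cofactor A i l else 0)"
      by (intro sum.cong) auto
    also have "\<dots> = cofactor A i j" using j(1) by simp
    finally have dA': "det A' \<noteq> 0" using j(2) by simp
    obtain B where B: "B \<in> carrier_mat n n" "B * A' = 1\<^sub>m n" "A' * B = 1\<^sub>m n"
      using det_non_zero_imp_unit[OF A' dA', of undefined] by (auto simp: Units_def ring_mat_def)
    \<comment> \<open>\<open>R\<close> is \<open>A\<close> times the inverse of \<open>A'\<close>.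
      The two matrices agree outside row \<open>i\<close>, so \<open>R\<close> agrees with the
      identity there.\<close>
    define R where "R = A * B"
    have R: "R \<in> carrier_mat n n" using A B by (simp add: R_def)
    have RA: "R * A' = A"
      unfolding R_def using A B A' by (simp add: assoc_mult_mat[of _ n n _ n _ n])
    have rows: "R $$ (k, l) = (if l = k then 1 else 0)" if k: "k < n" "l < n" "k \<noteq> i" for k l
    proof -
      have "Matrix.row A k = Matrix.row A' k" using A A' k by (intro eq_vecI) (auto simp: A'_def)
      then have "R $$ (k, l) = (A' * B) $$ (k, l)" using A A' B(1) k by (simp add: R_def)
      also have "\<dots> = (if l = k then 1 else 0)" unfolding B(3) using k by simp
      finally show ?thesis .
    qed
    have detR: "det R = R $$ (i, i)" by (rule det_one_row_matrix[OF R i(1) rows])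
    have "det A = det R * det A'" using det_mult[OF R A'] RA by simp
    with less.prems detR have nz: "R $$ (i, i) \<noteq> 0" by auto
    have "?bad A' \<subseteq> ?bad A - {i}"
    proof
      fix k assume k: "k \<in> ?bad A'"
      have "\<forall>l<n. A' $$ (i, l) = (if l = j then 1 else 0)" using i(1) by (simp add: A'_def)
      then have "k \<noteq> i" using k j(1) by blast
      moreover have "A' $$ (k, l) = A $$ (k, l)" if "l < n" for l
        using k that \<open>k \<noteq> i\<close> by (simp add: A'_def)
      ultimately have "(\<forall>l<n. A' $$ (k, l) = (if l = m then 1 else 0))
          = (\<forall>l<n. A $$ (k, l) = (if l = m then 1 else 0))" for m by simp
      with k \<open>k \<noteq> i\<close> show "k \<in> ?bad A - {i}"
        by (simp only: mem_Collect_eq Diff_iff singleton_iff simp_thms)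
    qed
    moreover have fin: "finite (?bad A)" by (rule finite_Collect_conjI) simp
    ultimately have "card (?bad A') \<le> card (?bad A - {i})" by (rule card_mono[OF finite_Diff, rotated])
    also have "\<dots> < card (?bad A)" by (rule card_Diff1_less[OF fin i(2)])
    finally have "card (?bad A') < card (?bad A)" .
    from less.hyps[OF this A' dA'] have "scales_by_det n A'" .
    from scales_by_det_mult[OF R A' scales_by_det_one_row[OF R i(1) rows nz] this] RA
    show ?thesis by simp
  qed
qed

section \<open>Translation invariance and Blichfeldt's theorem\<close>

lemma emeasure_translate_coord_measure:
  assumes U: "U \<in> sets (coord_measure {..<n})"
  shows "emeasure (coord_measure {..<n}) ((\<lambda>x. \<lambda>i\<in>{..<n}. x i + t i) -` U \<inter> space (coord_measure {..<n}))
       = emeasure (coord_measure {..<n}) U"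
proof -
  let ?M = "coord_measure {..<n}" and ?T = "\<lambda>x. \<lambda>i\<in>{..<n}. x i + t i"
  have T [measurable]: "?T \<in> ?M \<rightarrow>\<^sub>M ?M" by measurable
  have "distr ?M ?M ?T = ?M"
  proof (rule lborel_product.PiM_eqI)
    fix B :: "nat \<Rightarrow> real set" assume B: "\<And>i. i \<in> {..<n} \<Longrightarrow> B i \<in> sets lborel"
    have *: "?T -` (Pi\<^sub>E {..<n} B) \<inter> space ?M = Pi\<^sub>E {..<n} (\<lambda>k. (\<lambda>x. t k + x) -` B k)"
      by (auto simp: space_PiM PiE_iff add.commute)
    have B2: "(\<lambda>x. t k + x) -` B k \<in> sets lborel" if "k < n" for k
      using B that measurable_sets[of "\<lambda>x. t k + x" borel borel "B k"] by simp
    have "emeasure lborel ((\<lambda>x. t k + x) -` B k) = emeasure lborel (B k)" if "k < n" for k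
    proof -
      have "emeasure lborel (B k) = emeasure (distr lborel borel (\<lambda>x. t k + x)) (B k)"
        by (subst lborel_distr_plus) simp
      also have "\<dots> = emeasure lborel ((\<lambda>x. t k + x) -` B k)"
        using B that by (subst emeasure_distr) auto
      finally show ?thesis ..
    qed
    moreover have "emeasure ?M (Pi\<^sub>E {..<n} (\<lambda>k. (\<lambda>x. t k + x) -` B k))
        = (\<Prod>k<n. emeasure lborel ((\<lambda>x. t k + x) -` B k))"
      using B2 by (intro lborel_product.emeasure_PiM) auto
    ultimately show "emeasure (distr ?M ?M ?T) (Pi\<^sub>E {..<n} B) = (\<Prod>k<n. emeasure lborel (B k))"
      using B by (subst emeasure_distr) (auto simp: * intro!: sets_PiM_I_finite)
  qed auto
  then show ?thesis using emeasure_distr[OF T U] by simp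
qed

text \<open>Cut \<open>S\<close> along the integer cubes \<open>Q k\<close> and translate every
  piece back into the unit cube, giving \<open>T k\<close>. Pieces of total volume above 1 cannot be
  disjoint there, and a common point of two of them comes from two points of \<open>S\<close> that
  differ by an integer vector.\<close>

lemma blichfeldt:
  assumes S: "S \<in> sets (coord_measure {..<n})" and vol: "emeasure (coord_measure {..<n}) S > 1"
  obtains x y where "x \<in> S" "y \<in> S" "x \<noteq> y" "\<And>i. i < n \<Longrightarrow> x i - y i \<in> \<int>"
proof -
  let ?M = "coord_measure {..<n}"
  define Q where "Q k = {x \<in> space ?M. \<forall>i<n. \<lfloor>x i\<rfloor> = k i}" for k :: "nat \<Rightarrow> int"
  define T where "T k = (\<lambda>x. \<lambda>i\<in>{..<n}. x i + real_of_int (k i)) -` (S \<inter> Q k) \<inter> space ?M" for k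
  \<comment> \<open>Only the values of \<open>k\<close> below \<open>n\<close> matter for
    \<open>Q k\<close>. Taking extensional \<open>k\<close> makes distinct indices give disjoint
    cubes.\<close>
  define K where "K = Pi\<^sub>E {..<n} (\<lambda>_. UNIV :: int set)"
  have [measurable]: "Q k \<in> sets ?M" for k
  proof -
    have "(\<lambda>x. x i) \<in> ?M \<rightarrow>\<^sub>M borel" if "i < n" for i
      using measurable_component_singleton[of i "{..<n}" "\<lambda>_. lborel :: real measure"] that by simp
    then have "(\<lambda>x. \<lfloor>x i\<rfloor>) \<in> ?M \<rightarrow>\<^sub>M count_space UNIV" if "i < n" for i
      using that by (intro measurable_compose[OF _ measurable_real_floor]) auto
    then have "{x \<in> space ?M. \<lfloor>x i\<rfloor> = k i} \<in> sets ?M" if "i < n" for i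
      using that by measurable
    then have "{x \<in> space ?M. \<forall>i\<in>{..<n}. \<lfloor>x i\<rfloor> = k i} \<in> sets ?M"
      by (intro sets.sets_Collect_finite_All) auto
    then show ?thesis by (simp add: Q_def Ball_def)
  qed
  have [measurable]: "T k \<in> sets ?M" for k
    unfolding T_def using S by measurable
  have cK: "countable K" unfolding K_def by (rule countable_PiE) auto
  have "S = (\<Union>k\<in>K. S \<inter> Q k)"
  proof (intro equalityI subsetI)
    fix x assume x: "x \<in> S"
    then have "x \<in> Q (\<lambda>i\<in>{..<n}. \<lfloor>x i\<rfloor>)" using sets.sets_into_space[OF S] by (auto simp: Q_def)
    then show "x \<in> (\<Union>k\<in>K. S \<inter> Q k)" using x by (intro UN_I[of "\<lambda>i\<in>{..<n}. \<lfloor>x i\<rfloor>"]) (simp_all add: K_def)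
  qed auto
  moreover have "disjoint_family_on (\<lambda>k. S \<inter> Q k) K"
    unfolding disjoint_family_on_def
  proof (intro ballI impI)
    fix k l assume kl: "k \<in> K" "l \<in> K" "k \<noteq> l"
    then obtain i where "i < n" "k i \<noteq> l i" unfolding K_def by (metis PiE_ext lessThan_iff)
    then show "S \<inter> Q k \<inter> (S \<inter> Q l) = {}" by (auto simp: Q_def)
  qed
  then have "emeasure ?M (\<Union>k\<in>K. S \<inter> Q k) = (\<integral>\<^sup>+k. emeasure ?M (S \<inter> Q k) \<partial>count_space K)"
    using S by (intro emeasure_UN_countable[OF _ cK]) auto
  ultimately have "emeasure ?M S = (\<integral>\<^sup>+k. emeasure ?M (S \<inter> Q k) \<partial>count_space K)"
    by (simp only:)
  also have "\<dots> = (\<integral>\<^sup>+k. emeasure ?M (T k) \<partial>count_space K)"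
    unfolding T_def using S by (intro nn_integral_cong emeasure_translate_coord_measure[symmetric]) auto
  finally have eq: "emeasure ?M S = (\<integral>\<^sup>+k. emeasure ?M (T k) \<partial>count_space K)" .
  have "\<not> disjoint_family_on T K"
  proof
    assume "disjoint_family_on T K"
    then have "emeasure ?M S = emeasure ?M (\<Union>(T ` K))"
      unfolding eq using cK by (intro emeasure_UN_countable[symmetric]) auto
    also have "\<dots> \<le> emeasure ?M (Pi\<^sub>E {..<n} (\<lambda>_. {0..<1}))"
    proof (rule emeasure_mono)
      show "\<Union>(T ` K) \<subseteq> Pi\<^sub>E {..<n} (\<lambda>_. {0..<1})"
      proof
        fix x assume "x \<in> \<Union>(T ` K)"
        then obtain k where x: "x \<in> space ?M" "\<forall>i<n. \<lfloor>x i + real_of_int (k i)\<rfloor> = k i"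
          by (auto simp: T_def Q_def)
        have "0 \<le> x i \<and> x i < 1" if "i < n" for i
          using x(2)[rule_format, OF that] by linarith
        then show "x \<in> Pi\<^sub>E {..<n} (\<lambda>_. {0..<1})" using x(1) by (auto simp: space_PiM PiE_iff)
      qed
    qed (auto intro!: sets_PiM_I_finite)
    also have "\<dots> = 1" by (subst lborel_product.emeasure_PiM) auto
    finally show False using vol by simp
  qed
  then obtain k l z where kl: "k \<in> K" "l \<in> K" "k \<noteq> l" "z \<in> T k" "z \<in> T l"
    unfolding disjoint_family_on_def by blast
  define x y where "x = (\<lambda>i\<in>{..<n}. z i + real_of_int (k i))" "y = (\<lambda>i\<in>{..<n}. z i + real_of_int (l i))"
  show thesis
  proof
    show "x \<in> S" "y \<in> S" using kl by (auto simp: T_def x_y_def)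
    obtain i where "i < n" "k i \<noteq> l i" using kl unfolding K_def by (metis PiE_ext lessThan_iff)
    then have "x i \<noteq> y i" by (simp add: x_y_def)
    then show "x \<noteq> y" by auto
    show "x i - y i \<in> \<int>" if "i < n" for i using that by (simp add: x_y_def)
  qed
qed

text \<open>The factor 2 comes from the coordinates \<open>Re z + Im z\<close> and
  \<open>Re z - Im z\<close>, whose squares add up to \<open>2 * |z|^2\<close>. The condition thus
  says \<open>|z| < r\<close>.\<close>

lemma emeasure_disc:
  assumes "r > 0"
  shows "emeasure (lborel \<Otimes>\<^sub>M lborel) {(a, b). a\<^sup>2 + b\<^sup>2 < 2 * r\<^sup>2} = ennreal (2 * pi * r\<^sup>2)"
proof -
  have "{(a, b). a\<^sup>2 + b\<^sup>2 < 2 * r\<^sup>2} = ball (0 :: real \<times> real) (sqrt 2 * r)"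
  proof -
    have "a\<^sup>2 + b\<^sup>2 < 2 * r\<^sup>2 \<longleftrightarrow> sqrt (a\<^sup>2 + b\<^sup>2) < sqrt 2 * r" for a b
    proof -
      have "sqrt 2 * r = sqrt (2 * r\<^sup>2)" using assms by (simp add: real_sqrt_mult)
      then show ?thesis by (simp only: real_sqrt_less_iff)
    qed
    then show ?thesis by (auto simp: norm_Pair)
  qed
  moreover have "emeasure lborel (ball (0 :: real \<times> real) (sqrt 2 * r)) = ennreal (pi * (sqrt 2 * r)\<^sup>2)"
    using assms by (subst emeasure_ball) (auto simp: unit_ball_vol_2 power2_eq_square)
  ultimately show ?thesis using assms by (simp add: lborel_prod power_mult_distrib mult_ac)
qed

text \<open>\<open>c\<close> stands for complex conjugation of indices. A fixed point contributes
  the interval of length \<open>2 * r i\<close>. A pair contributes a disc of area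
  \<open>2 * pi * (r i)^2\<close>, which is shared as \<open>sqrt (2 * pi) * r i\<close> by both
  indices; in this way the product runs over all of \<open>I\<close> and no representatives have to
  be chosen. The induction splits off one orbit of \<open>c\<close> by Fubini.\<close>

lemma emeasure_polydisc:
  assumes "finite I" "c \<in> I \<rightarrow> I" "\<And>i. i \<in> I \<Longrightarrow> c (c i) = i"
    and "\<And>i. i \<in> I \<Longrightarrow> r i > 0" "\<And>i. i \<in> I \<Longrightarrow> r (c i) = r i"
  shows "{u \<in> space (coord_measure I). \<forall>i\<in>I. (u i)\<^sup>2 + (u (c i))\<^sup>2 < 2 * (r i)\<^sup>2} \<in> sets (coord_measure I)"
    and "emeasure (coord_measure I) {u \<in> space (coord_measure I). \<forall>i\<in>I. (u i)\<^sup>2 + (u (c i))\<^sup>2 < 2 * (r i)\<^sup>2}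
       = ennreal (\<Prod>i\<in>I. r i * (if c i = i then 2 else sqrt (2 * pi)))"
proof -
  define D where "D I = {u \<in> space (coord_measure I). \<forall>i\<in>I. (u i)\<^sup>2 + (u (c i))\<^sup>2 < 2 * (r i)\<^sup>2}" for I
  define w where "w i = r i * (if c i = i then 2 else sqrt (2 * pi))" for i
  have D: "D I \<in> sets (coord_measure I)" if I: "finite I" "c \<in> I \<rightarrow> I" for I
  proof -
    have "{u \<in> space (coord_measure I). (u i)\<^sup>2 + (u (c i))\<^sup>2 < 2 * (r i)\<^sup>2} \<in> sets (coord_measure I)"
      if "i \<in> I" for i
    proof -
      have "(\<lambda>u. u j) \<in> borel_measurable (coord_measure I)" if "j \<in> I" for j
        using measurable_component_singleton[OF that, of "\<lambda>_. lborel :: real measure"] by simp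
      from this[OF \<open>i \<in> I\<close>] this[OF funcset_mem[OF I(2) \<open>i \<in> I\<close>]] show ?thesis
        by (intro borel_measurable_less) auto
    qed
    then show ?thesis unfolding D_def by (intro sets.sets_Collect_finite_All I(1))
  qed
  have "emeasure (coord_measure I) (D I) = ennreal (\<Prod>i\<in>I. w i)"
    using assms
  proof (induction "card I" arbitrary: I rule: less_induct)
    case less
    note fin = less.prems(1) and c = less.prems(2) and cc = less.prems(3)
      and pos = less.prems(4) and rc = less.prems(5)
    show ?case
    proof (cases "I = {}")
      case True
      then show ?thesis by (simp add: D_def space_PiM)
    next
      case False
      then obtain i where i: "i \<in> I" by auto
      define J where "J = I - {i, c i}"
      have J: "finite J" "i \<notin> J" "c i \<notin> J" "J \<subseteq> I" using fin by (auto simp: J_def)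
      have inv: "c k \<noteq> i" "c k \<noteq> c i" if "k \<in> J" for k
        using that cc i by (auto simp: J_def) (metis)+
      have cJ: "c \<in> J \<rightarrow> J" using inv c J_def by fastforce
      have "card J < card I" using fin i J by (intro psubset_card_mono) auto
      then have IH: "emeasure (coord_measure J) (D J) = ennreal (\<Prod>i\<in>J. w i)"
        using J(1) cJ J(4) cc pos rc by (intro less.hyps) auto
      have wpos: "w k \<ge> 0" if "k \<in> I" for k using pos[OF that] by (simp add: w_def)
      show ?thesis
      proof (cases "c i = i")
        case True
        then have ins: "I = insert i J" using i by (auto simp: J_def)
        have m: "indicator (D I) \<in> borel_measurable (coord_measure (insert i J))"
          unfolding ins[symmetric] using D[OF fin c] by simp
        have "emeasure (coord_measure I) (D I) = (\<integral>\<^sup>+u. indicator (D I) u \<partial>coord_measure (insert i J))"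
          unfolding ins[symmetric] by (rule nn_integral_indicator[OF D[OF fin c], symmetric])
        also have "\<dots> = (\<integral>\<^sup>+u. (\<integral>\<^sup>+y. indicator (D I) (u(i := y)) \<partial>lborel) \<partial>coord_measure J)"
          by (rule lborel_product.product_nn_integral_insert[OF J(1,2) m])
        also have "\<dots> = (\<integral>\<^sup>+u. (\<integral>\<^sup>+y. indicator (D J) u * indicator {-r i<..<r i} y \<partial>lborel) \<partial>coord_measure J)"
        proof (intro nn_integral_cong)
          fix u y assume u: "u \<in> space (coord_measure J)"
          have sp: "u(i := y) \<in> space (coord_measure I)"
            using u unfolding ins by (auto simp: space_PiM PiE_iff extensional_def)
          have "y\<^sup>2 + y\<^sup>2 < 2 * (r i)\<^sup>2 \<longleftrightarrow> y \<in> {-r i<..<r i}"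
            using abs_le_square_iff[of "r i" y] pos[OF i] by (auto simp: abs_less_iff)
          moreover have "((u(i := y)) k)\<^sup>2 + ((u(i := y)) (c k))\<^sup>2 = (u k)\<^sup>2 + (u (c k))\<^sup>2" if "k \<in> J" for k
            using that inv J by auto
          ultimately have "u(i := y) \<in> D I \<longleftrightarrow> u \<in> D J \<and> y \<in> {-r i<..<r i}"
            using u sp True unfolding D_def mem_Collect_eq ins by (simp add: conj_commute)
          then show "indicator (D I) (u(i := y)) = (indicator (D J) u * indicator {-r i<..<r i} y :: ennreal)"
            by (simp add: indicator_def)
        qed
        also have "\<dots> = (\<integral>\<^sup>+u. indicator (D J) u * ennreal (w i) \<partial>coord_measure J)"
          using pos[OF i] True by (simp add: nn_integral_cmult w_def mult.commute)
        also have "\<dots> = ennreal (\<Prod>k\<in>J. w k) * ennreal (w i)"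
          using D[OF J(1) cJ] by (simp add: nn_integral_multc IH)
        also have "\<dots> = ennreal (\<Prod>k\<in>I. w k)"
          unfolding ins using J wpos ins by (simp add: ennreal_mult prod_nonneg mult.commute)
        finally show ?thesis .
      next
        case False
        define j where "j = c i"
        have j: "j \<in> I" "j \<noteq> i" "c j = i" using i c cc False by (auto simp: j_def)
        have ins: "I = insert i (insert j J)" using i j by (auto simp: J_def j_def)
        have jJ: "finite (insert j J)" "i \<notin> insert j J" "j \<notin> J" using J j by (auto simp: j_def)
        have m: "indicator (D I) \<in> borel_measurable (coord_measure (insert i (insert j J)))"
          unfolding ins[symmetric] using D[OF fin c] by simp
        let ?d = "indicator {(a, b). a\<^sup>2 + b\<^sup>2 < 2 * (r i)\<^sup>2} :: real \<times> real \<Rightarrow> ennreal"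
        have dset [measurable]: "{(a, b). a\<^sup>2 + b\<^sup>2 < 2 * (r i)\<^sup>2} \<in> sets (lborel \<Otimes>\<^sub>M lborel)"
        proof -
          have "{z \<in> space (borel \<Otimes>\<^sub>M borel :: (real \<times> real) measure). (fst z)\<^sup>2 + (snd z)\<^sup>2 < 2 * (r i)\<^sup>2}
              \<in> sets (borel \<Otimes>\<^sub>M borel)" by measurable
          then show ?thesis by (simp add: space_pair_measure case_prod_unfold)
        qed
        have "emeasure (coord_measure I) (D I) = (\<integral>\<^sup>+u. indicator (D I) u \<partial>coord_measure (insert i (insert j J)))"
          unfolding ins[symmetric] by (rule nn_integral_indicator[OF D[OF fin c], symmetric])
        also have "\<dots> = (\<integral>\<^sup>+u. (\<integral>\<^sup>+y. indicator (D I) (u(i := y)) \<partial>lborel) \<partial>coord_measure (insert j J))"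
          by (rule lborel_product.product_nn_integral_insert[OF jJ(1,2) m])
        also have "\<dots> = (\<integral>\<^sup>+u. (\<integral>\<^sup>+y. indicator (D J) (restrict u J) * ?d (u j, y) \<partial>lborel) \<partial>coord_measure (insert j J))"
        proof (intro nn_integral_cong)
          fix u y assume u: "u \<in> space (coord_measure (insert j J))"
          have sp: "u(i := y) \<in> space (coord_measure I)"
            using u unfolding ins by (auto simp: space_PiM PiE_iff extensional_def)
          have sp2: "restrict u J \<in> space (coord_measure J)" by (auto simp: space_PiM)
          have "((u(i := y)) k)\<^sup>2 + ((u(i := y)) (c k))\<^sup>2 = (restrict u J k)\<^sup>2 + (restrict u J (c k))\<^sup>2" if "k \<in> J" for k
            using that inv cJ J by auto
          then have "u(i := y) \<in> D I \<longleftrightarrow> restrict u J \<in> D J \<and> (u j)\<^sup>2 + y\<^sup>2 < 2 * (r i)\<^sup>2"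
            using sp sp2 j rc[OF i] j_def unfolding D_def mem_Collect_eq ins by (auto simp: add.commute)
          then show "indicator (D I) (u(i := y)) = (indicator (D J) (restrict u J) * ?d (u j, y) :: ennreal)"
            by (simp add: indicator_def)
        qed
        also have "\<dots> = (\<integral>\<^sup>+u. indicator (D J) (restrict u J) * (\<integral>\<^sup>+y. ?d (u j, y) \<partial>lborel) \<partial>coord_measure (insert j J))"
          by (simp add: nn_integral_cmult)
        also have "\<dots> = (\<integral>\<^sup>+u. (\<integral>\<^sup>+x. indicator (D J) (restrict (u(j := x)) J)
            * (\<integral>\<^sup>+y. ?d ((u(j := x)) j, y) \<partial>lborel) \<partial>lborel) \<partial>coord_measure J)"
        proof (rule lborel_product.product_nn_integral_insert[OF J(1) jJ(3)])
          have "(\<lambda>u. u j) \<in> coord_measure (insert j J) \<rightarrow>\<^sub>M lborel"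
            by (rule measurable_component_singleton) simp
          moreover have "(\<lambda>x. \<integral>\<^sup>+y. ?d (x, y) \<partial>lborel) \<in> borel_measurable lborel" by measurable
          ultimately have "(\<lambda>u. \<integral>\<^sup>+y. ?d (u j, y) \<partial>lborel) \<in> borel_measurable (coord_measure (insert j J))"
            by (rule measurable_compose)
          moreover have "(\<lambda>u. indicator (D J) (restrict u J) :: ennreal) \<in> borel_measurable (coord_measure (insert j J))"
            by (rule measurable_compose[OF measurable_restrict_subset[of J]]) (use D[OF J(1) cJ] in auto)
          ultimately show "(\<lambda>u. indicator (D J) (restrict u J) * (\<integral>\<^sup>+y. ?d (u j, y) \<partial>lborel)) \<in> borel_measurable (coord_measure (insert j J))"
            by (intro borel_measurable_times_ennreal)
        qed
        also have "\<dots> = (\<integral>\<^sup>+u. (\<integral>\<^sup>+x. indicator (D J) u * (\<integral>\<^sup>+y. ?d (x, y) \<partial>lborel) \<partial>lborel) \<partial>coord_measure J)"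
        proof (intro nn_integral_cong)
          fix u x assume u: "u \<in> space (coord_measure J)"
          have "restrict (u(j := x)) J = restrict u J" using jJ by (auto simp: restrict_def)
          also have "\<dots> = u" using u by (auto simp: space_PiM PiE_iff extensional_restrict)
          finally show "indicator (D J) (restrict (u(j := x)) J) * (\<integral>\<^sup>+y. ?d ((u(j := x)) j, y) \<partial>lborel)
              = indicator (D J) u * (\<integral>\<^sup>+y. ?d (x, y) \<partial>lborel)" by simp
        qed
        also have "\<dots> = (\<integral>\<^sup>+u. indicator (D J) u * ennreal (2 * pi * (r i)\<^sup>2) \<partial>coord_measure J)"
        proof (intro nn_integral_cong)
          fix u
          have "(\<integral>\<^sup>+x. (\<integral>\<^sup>+y. ?d (x, y) \<partial>lborel) \<partial>lborel) = (\<integral>\<^sup>+z. ?d z \<partial>(lborel \<Otimes>\<^sub>M lborel))"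
            by (rule lborel.nn_integral_fst) measurable
          also have "\<dots> = ennreal (2 * pi * (r i)\<^sup>2)"
            by (subst nn_integral_indicator[OF dset]) (rule emeasure_disc[OF pos[OF i]])
          finally have d: "(\<integral>\<^sup>+x. (\<integral>\<^sup>+y. ?d (x, y) \<partial>lborel) \<partial>lborel) = ennreal (2 * pi * (r i)\<^sup>2)" .
          have "(\<lambda>x. \<integral>\<^sup>+y. ?d (x, y) \<partial>lborel) \<in> borel_measurable lborel" by measurable
          from nn_integral_cmult[OF this] d show "(\<integral>\<^sup>+x. indicator (D J) u * (\<integral>\<^sup>+y. ?d (x, y) \<partial>lborel) \<partial>lborel) = indicator (D J) u * ennreal (2 * pi * (r i)\<^sup>2)"
            by (simp only:)
        qed
        also have "\<dots> = ennreal (\<Prod>k\<in>J. w k) * ennreal (2 * pi * (r i)\<^sup>2)"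
          using D[OF J(1) cJ] by (simp add: nn_integral_multc IH)
        also have "2 * pi * (r i)\<^sup>2 = w i * w j"
        proof -
          have "sqrt (2 * pi) * sqrt (2 * pi) = 2 * pi" by simp
          then show ?thesis using False rc[OF i] j by (simp add: w_def j_def power2_eq_square mult_ac)
        qed
        also have "ennreal (\<Prod>k\<in>J. w k) * ennreal (w i * w j) = ennreal (\<Prod>k\<in>I. w k)"
          unfolding ins using J jJ wpos ins
          by (simp add: ennreal_mult[symmetric] prod_nonneg mult_ac)
        finally show ?thesis .
      qed
    qed
  qed
  then show "emeasure (coord_measure I) {u \<in> space (coord_measure I). \<forall>i\<in>I. (u i)\<^sup>2 + (u (c i))\<^sup>2 < 2 * (r i)\<^sup>2}
       = ennreal (\<Prod>i\<in>I. r i * (if c i = i then 2 else sqrt (2 * pi)))"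
    unfolding D_def w_def .
  show "{u \<in> space (coord_measure I). \<forall>i\<in>I. (u i)\<^sup>2 + (u (c i))\<^sup>2 < 2 * (r i)\<^sup>2} \<in> sets (coord_measure I)"
    using D[OF assms(1,2)] unfolding D_def .
qed

section \<open>Integral elements and minimal polynomials\<close>

lemma algebraic_int_eigenvalue:
  fixes x :: "'a :: field_char_0" and A :: "nat \<Rightarrow> nat \<Rightarrow> int"
  assumes eq: "\<And>i. i < n \<Longrightarrow> x * b i = (\<Sum>j<n. of_int (A i j) * b j)"
    and nz: "i0 < n" "b i0 \<noteq> 0"
  shows "algebraic_int x"
proof -
  define M where "M = Matrix.mat n n (\<lambda>(i, j). A i j)"
  define N where "N = (map_mat of_int M :: 'a mat)"
  have M: "M \<in> carrier_mat n n" and N: "N \<in> carrier_mat n n" by (simp_all add: M_def N_def)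
  have "N *\<^sub>v Matrix.vec n b = x \<cdot>\<^sub>v Matrix.vec n b"
    by (intro eq_vecI) (auto simp: M_def N_def scalar_prod_def eq lessThan_atLeast0)
  moreover have "Matrix.vec n b \<noteq> 0\<^sub>v n" using nz by (metis index_vec index_zero_vec(1))
  ultimately have "eigenvalue N x"
    using N unfolding eigenvalue_def eigenvector_def by (intro exI[of _ "Matrix.vec n b"]) auto
  then have "poly (char_poly N) x = 0" using eigenvalue_root_char_poly[OF N] by simp
  also have "char_poly N = map_poly of_int (char_poly M)"
    unfolding N_def by (rule of_int_hom.char_poly_hom[OF M])
  finally show ?thesis
    using degree_monic_char_poly[OF M] by (auto simp: algebraic_int_altdef_ipoly)
qed

definition int_span :: "'a :: field_char_0 set \<Rightarrow> 'a set" where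
  "int_span B = range (\<lambda>c :: 'a \<Rightarrow> int. \<Sum>b\<in>B. of_int (c b) * b)"

lemma int_span_add: "u \<in> int_span B \<Longrightarrow> v \<in> int_span B \<Longrightarrow> u + v \<in> int_span B"
proof -
  assume "u \<in> int_span B" "v \<in> int_span B"
  then obtain c c' where "u = (\<Sum>b\<in>B. of_int (c b) * b)" "v = (\<Sum>b\<in>B. of_int (c' b) * b)"
    unfolding int_span_def by auto
  then have "u + v = (\<Sum>b\<in>B. of_int (c b + c' b) * b)" by (simp add: sum.distrib algebra_simps)
  then show ?thesis unfolding int_span_def by (rule range_eqI[of _ _ "\<lambda>b. c b + c' b"])
qed

lemma int_span_scale: "u \<in> int_span B \<Longrightarrow> of_int k * u \<in> int_span B"
proof -
  assume "u \<in> int_span B"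
  then obtain c where "u = (\<Sum>b\<in>B. of_int (c b) * b)" unfolding int_span_def by auto
  then have "of_int k * u = (\<Sum>b\<in>B. of_int (k * c b) * b)" by (simp add: sum_distrib_left mult.assoc)
  then show ?thesis unfolding int_span_def by (rule range_eqI[of _ _ "\<lambda>b. k * c b"])
qed

lemma int_span_zero: "0 \<in> int_span B"
  unfolding int_span_def by (rule range_eqI[of _ _ "\<lambda>_. 0"]) simp

lemma int_span_sum: "(\<And>i. i \<in> I \<Longrightarrow> u i \<in> int_span B) \<Longrightarrow> sum u I \<in> int_span B"
  by (induction I rule: infinite_finite_induct) (auto intro: int_span_add int_span_zero)

lemma int_span_base: "finite B \<Longrightarrow> b \<in> B \<Longrightarrow> b \<in> int_span B"
  unfolding int_span_def
  by (rule range_eqI[of _ _ "\<lambda>b'. if b' = b then 1 else 0"]) (simp add: if_distrib[of of_int] if_distrib[of "\<lambda>z. z * _"] cong: if_cong)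

lemma int_span_stable:
  assumes "finite B" "\<And>b. b \<in> B \<Longrightarrow> x * b \<in> int_span B" "u \<in> int_span B"
  shows "x * u \<in> int_span B"
proof -
  obtain c where "u = (\<Sum>b\<in>B. of_int (c b) * b)" using assms(3) unfolding int_span_def by auto
  then have "x * u = (\<Sum>b\<in>B. of_int (c b) * (x * b))" by (simp add: sum_distrib_left mult_ac)
  then show ?thesis using assms(2) by (simp add: int_span_sum int_span_scale)
qed

text \<open>Multiplication by \<open>x\<close> acts on the generators through an integer matrix,
  with the vector of generators as an eigenvector for \<open>x\<close>. That vector must not vanish,
  hence \<open>b0\<close>.\<close>

lemma algebraic_int_int_span:
  assumes B: "finite B" and x: "\<And>b. b \<in> B \<Longrightarrow> x * b \<in> int_span B" and nz: "b0 \<in> B" "b0 \<noteq> 0"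
  shows "algebraic_int x"
proof -
  obtain h where h: "bij_betw h {..<card B} B"
    using B by (metis atLeast0LessThan ex_bij_betw_nat_finite)
  have "\<exists>c :: 'a \<Rightarrow> int. x * b = (\<Sum>b'\<in>B. of_int (c b') * b')" if "b \<in> B" for b
    using x[OF that] unfolding int_span_def by auto
  then obtain c :: "'a \<Rightarrow> 'a \<Rightarrow> int" where c: "\<And>b. b \<in> B \<Longrightarrow> x * b = (\<Sum>b'\<in>B. of_int (c b b') * b')"
    by metis
  obtain i0 where i0: "i0 < card B" "h i0 = b0" using h nz(1) by (metis bij_betw_iff_bijections lessThan_iff)
  show ?thesis
  proof (rule algebraic_int_eigenvalue)
    fix i assume "i < card B"
    then have "h i \<in> B" using h by (auto simp: bij_betw_def)
    then show "x * h i = (\<Sum>j<card B. of_int (c (h i) (h j)) * h j)"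
      using c[of "h i"] sum.reindex_bij_betw[OF h, of "\<lambda>b'. of_int (c (h i) b') * b'"] by simp
  qed (use i0 nz in auto)
qed

lemma algebraic_int_power_reduce:
  assumes "algebraic_int (x :: 'a :: field_char_0)"
  obtains m and a :: "nat \<Rightarrow> int" where "m > 0" "x ^ m = (\<Sum>i<m. of_int (a i) * x ^ i)"
proof -
  obtain p where p: "poly (map_poly of_int p) x = 0" "lead_coeff p = 1"
    using assms by (auto simp: algebraic_int_altdef_ipoly)
  have deg: "degree (map_poly of_int p :: 'a poly) = degree p" by simp
  have "0 = (\<Sum>i\<le>degree p. of_int (coeff p i) * x ^ i)"
    using p(1) unfolding poly_altdef by (simp add: deg)
  also have "\<dots> = (\<Sum>i<degree p. of_int (coeff p i) * x ^ i) + x ^ degree p"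
    using p(2) by (simp add: lessThan_Suc_atMost[symmetric])
  finally have *: "x ^ degree p = (\<Sum>i<degree p. of_int (- coeff p i) * x ^ i)"
    by (simp add: sum_negf eq_neg_iff_add_eq_0 add.commute)
  moreover have "degree p > 0"
  proof (rule ccontr)
    assume "\<not> ?thesis"
    then have "p = 1" using p(2) by (metis degree_eq_zeroE gr0I lead_coeff_pCons(2) one_pCons)
    then show False using p(1) by simp
  qed
  ultimately show thesis by (intro that[of "degree p" "\<lambda>i. - coeff p i"])
qed

text \<open>The products \<open>x ^ i * y ^ k\<close> with exponents below the degrees of the two
  monic equations span a module stable under \<open>x\<close> and \<open>y\<close>, hence under
  their sum and product.\<close>

lemma
  assumes x: "algebraic_int (x :: 'a :: field_char_0)" and y: "algebraic_int y"
  shows algebraic_int_plus: "algebraic_int (x + y)"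
    and algebraic_int_times: "algebraic_int (x * y)"
proof -
  obtain m a where m: "m > 0" "x ^ m = (\<Sum>i<m. of_int (a i) * x ^ i)"
    using algebraic_int_power_reduce[OF x] by blast
  obtain n a' where n: "n > 0" "y ^ n = (\<Sum>i<n. of_int (a' i) * y ^ i)"
    using algebraic_int_power_reduce[OF y] by blast
  define B where "B = (\<lambda>(i, k). x ^ i * y ^ k) ` ({..<m} \<times> {..<n})"
  have B: "finite B" by (simp add: B_def)
  have memB: "x ^ i * y ^ k \<in> int_span B" if "i < m" "k < n" for i k
    using that by (intro int_span_base[OF B]) (auto simp: B_def)
  have xB: "x * b \<in> int_span B" if "b \<in> B" for b
  proof -
    obtain i k where ik: "i < m" "k < n" "b = x ^ i * y ^ k" using \<open>b \<in> B\<close> by (auto simp: B_def)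
    show ?thesis
    proof (cases "Suc i < m")
      case True
      then show ?thesis using memB[OF True ik(2)] ik(3) by (simp add: mult.assoc)
    next
      case False
      then have "Suc i = m" using ik(1) by simp
      then have "x * b = x ^ m * y ^ k" using ik(3) by (auto simp: mult_ac)
      also have "\<dots> = (\<Sum>i<m. of_int (a i) * (x ^ i * y ^ k))"
        unfolding m(2) by (simp add: sum_distrib_right mult.assoc)
      finally show ?thesis using memB ik by (auto intro!: int_span_sum int_span_scale)
    qed
  qed
  have yB: "y * b \<in> int_span B" if "b \<in> B" for b
  proof -
    obtain i k where ik: "i < m" "k < n" "b = x ^ i * y ^ k" using \<open>b \<in> B\<close> by (auto simp: B_def)
    show ?thesis
    proof (cases "Suc k < n")
      case True
      then show ?thesis using memB[OF ik(1) True] ik(3) by (simp add: mult_ac)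
    next
      case False
      then have "Suc k = n" using ik(2) by simp
      then have "y * b = y ^ n * x ^ i" using ik(3) by (auto simp: mult_ac)
      also have "\<dots> = (\<Sum>k<n. of_int (a' k) * (x ^ i * y ^ k))"
        unfolding n(2) by (simp add: sum_distrib_left sum_distrib_right mult_ac)
      finally show ?thesis using memB ik by (auto intro!: int_span_sum int_span_scale)
    qed
  qed
  \<comment> \<open>Positivity of \<open>m\<close> and \<open>n\<close> lets the exponent pair
    \<open>(0, 0)\<close> occur, which supplies a nonzero generator.\<close>
  have 1: "1 \<in> B" unfolding B_def using m n by (auto intro!: image_eqI[of _ _ "(0, 0)"])
  show "algebraic_int (x + y)"
    using xB yB by (intro algebraic_int_int_span[OF B _ 1]) (auto simp: distrib_right intro: int_span_add)
  show "algebraic_int (x * y)"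
    using xB yB int_span_stable[OF B xB]
    by (intro algebraic_int_int_span[OF B _ 1]) (auto simp: mult.assoc)
qed

lemma algebraic_int_sum:
  "(\<And>i. i \<in> I \<Longrightarrow> algebraic_int (u i :: 'a :: field_char_0)) \<Longrightarrow> algebraic_int (sum u I)"
  by (induction I rule: infinite_finite_induct) (auto intro: algebraic_int_plus)

lemma algebraic_int_prod:
  "(\<And>i. i \<in> I \<Longrightarrow> algebraic_int (u i :: 'a :: field_char_0)) \<Longrightarrow> algebraic_int (prod u I)"
  by (induction I rule: infinite_finite_induct) (auto intro: algebraic_int_times)

text \<open>Subfields as plain sets under the operations of the type. Since
  \<open>inverse 0 = 0\<close>, closure under inverses can be demanded without exception.\<close>

definition field_subset :: "'a :: field_char_0 set \<Rightarrow> bool" where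
  "field_subset F \<longleftrightarrow> 0 \<in> F \<and> 1 \<in> F \<and>
     (\<forall>x\<in>F. \<forall>y\<in>F. x - y \<in> F \<and> x * y \<in> F) \<and> (\<forall>x\<in>F. inverse x \<in> F)"

lemma field_subsetD:
  assumes "field_subset F"
  shows "0 \<in> F" "1 \<in> F" "x \<in> F \<Longrightarrow> y \<in> F \<Longrightarrow> x - y \<in> F" "x \<in> F \<Longrightarrow> y \<in> F \<Longrightarrow> x * y \<in> F"
    "x \<in> F \<Longrightarrow> inverse x \<in> F" "x \<in> F \<Longrightarrow> - x \<in> F" "x \<in> F \<Longrightarrow> y \<in> F \<Longrightarrow> x + y \<in> F"
    "of_nat n \<in> F" "of_int k \<in> F" "of_rat q \<in> F"
proof -
  show 1: "0 \<in> F" "1 \<in> F" and diff: "x \<in> F \<Longrightarrow> y \<in> F \<Longrightarrow> x - y \<in> F"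
    and mult: "x \<in> F \<Longrightarrow> y \<in> F \<Longrightarrow> x * y \<in> F" and inv: "x \<in> F \<Longrightarrow> inverse x \<in> F" for x y
    using assms unfolding field_subset_def by auto
  show minus: "x \<in> F \<Longrightarrow> - x \<in> F" for x using diff[OF 1(1)] by simp
  show plus: "x \<in> F \<Longrightarrow> y \<in> F \<Longrightarrow> x + y \<in> F" for x y using diff[OF _ minus, of x y] by simp
  show nat: "of_nat n \<in> F" for n by (induction n) (auto intro: 1 plus)
  show int: "of_int k \<in> F" for k by (cases k rule: int_cases2) (auto intro: nat minus)
  obtain a b where "q = of_int a / of_int b" by (metis quotient_of_div surj_pair)
  then have "of_rat q = of_int a * inverse (of_int b :: 'a)"
    by (simp add: of_rat_divide) (simp add: divide_inverse)
  then show "of_rat q \<in> F" by (simp add: int inv mult)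
qed

text \<open>Stands for the polynomial ring over \<open>F\<close>: the subfield varies and is not a
  type, so its polynomials live in \<open>'a poly\<close>.\<close>

definition coeffs_in :: "'a :: field_char_0 set \<Rightarrow> 'a poly \<Rightarrow> bool" where
  "coeffs_in F p \<longleftrightarrow> (\<forall>i. coeff p i \<in> F)"

lemma coeffs_in_diff: "field_subset F \<Longrightarrow> coeffs_in F p \<Longrightarrow> coeffs_in F q \<Longrightarrow> coeffs_in F (p - q)"
  by (auto simp: coeffs_in_def field_subsetD)

lemma coeffs_in_add: "field_subset F \<Longrightarrow> coeffs_in F p \<Longrightarrow> coeffs_in F q \<Longrightarrow> coeffs_in F (p + q)"
  by (auto simp: coeffs_in_def field_subsetD)

lemma field_subset_sum: "field_subset F \<Longrightarrow> (\<And>i. i \<in> I \<Longrightarrow> u i \<in> F) \<Longrightarrow> sum u I \<in> F"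
  by (induction I rule: infinite_finite_induct) (auto simp: field_subsetD)

lemma coeffs_in_mult: "field_subset F \<Longrightarrow> coeffs_in F p \<Longrightarrow> coeffs_in F q \<Longrightarrow> coeffs_in F (p * q)"
  by (auto simp: coeffs_in_def coeff_mult field_subsetD intro!: field_subset_sum)

lemma coeffs_in_smult: "field_subset F \<Longrightarrow> c \<in> F \<Longrightarrow> coeffs_in F q \<Longrightarrow> coeffs_in F (smult c q)"
  by (auto simp: coeffs_in_def field_subsetD)

lemma coeffs_in_pCons: "coeffs_in F (pCons a p) \<longleftrightarrow> a \<in> F \<and> coeffs_in F p"
  unfolding coeffs_in_def by (metis coeff_pCons_0 coeff_pCons_Suc not0_implies_Suc)

lemma coeffs_in_0: "field_subset F \<Longrightarrow> coeffs_in F 0"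
  by (simp add: coeffs_in_def field_subsetD)

lemma coeffs_in_monom: "field_subset F \<Longrightarrow> c \<in> F \<Longrightarrow> coeffs_in F (monom c n)"
  by (simp add: coeffs_in_def field_subsetD)

lemma coeffs_in_pcompose: "field_subset F \<Longrightarrow> coeffs_in F p \<Longrightarrow> coeffs_in F q \<Longrightarrow> coeffs_in F (pcompose p q)"
proof (induction p)
  case (pCons a p)
  then show ?case
    by (simp add: pcompose_pCons coeffs_in_pCons coeffs_in_add coeffs_in_mult coeffs_in_0)
qed (simp add: coeffs_in_0)

lemma coeffs_in_of_rat: "field_subset F \<Longrightarrow> coeffs_in F (map_poly of_rat p)"
  by (simp add: coeffs_in_def coeff_map_poly field_subsetD)

text \<open>Long division by a monic polynomial only adds, subtracts and multiplies coefficients, so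
  quotient and remainder never leave \<open>F\<close>.\<close>

lemma coeffs_in_division:
  assumes F: "field_subset F" and h: "coeffs_in F h" "lead_coeff h = 1" and q: "coeffs_in F q"
  shows "\<exists>s r. coeffs_in F s \<and> coeffs_in F r \<and> q = h * s + r \<and> (r = 0 \<or> degree r < degree h)"
  using q
proof (induction "degree q" arbitrary: q rule: less_induct)
  case less
  show ?case
  proof (cases "degree q < degree h \<or> q = 0")
    case True
    then show ?thesis using less.prems F by (intro exI[of _ 0] exI[of _ q]) (auto simp: coeffs_in_0)
  next
    case False
    then have deg: "degree h \<le> degree q" and q0: "q \<noteq> 0" by auto
    let ?m = "monom (lead_coeff q) (degree q - degree h)"
    have m: "coeffs_in F ?m" using less.prems F by (intro coeffs_in_monom) (auto simp: coeffs_in_def)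
    let ?q = "q - h * ?m"
    have q': "coeffs_in F ?q" using F less.prems h m by (intro coeffs_in_diff coeffs_in_mult)
    have dm: "degree (h * ?m) = degree q"
      using q0 h(2) deg by (subst degree_mult_eq) (auto simp: degree_monom_eq)
    have lm: "coeff (h * ?m) (degree q) = lead_coeff q"
      using lead_coeff_mult[of h ?m] h(2) q0 by (simp add: dm degree_monom_eq)
    show ?thesis
    proof (cases "?q = 0")
      case True
      then show ?thesis using m F by (intro exI[of _ ?m] exI[of _ 0]) (auto simp: coeffs_in_0)
    next
      case False
      have "degree ?q \<le> degree q" using dm by (metis degree_diff_le_max max.idem)
      moreover have "degree ?q \<noteq> degree q"
        using False lm by (metis coeff_diff diff_self leading_coeff_0_iff)
      ultimately have "degree ?q < degree q" by simp
      from less.hyps[OF this q'] obtain s r where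
        sr: "coeffs_in F s" "coeffs_in F r" "?q = h * s + r" "r = 0 \<or> degree r < degree h" by auto
      have "q = h * (s + ?m) + r" using sr(3) by (simp add: algebra_simps)
      then show ?thesis using sr F m by (intro exI[of _ "s + ?m"] exI[of _ r]) (auto simp: coeffs_in_add)
    qed
  qed
qed

text \<open>Take a nonzero polynomial over \<open>F\<close> of least degree with root \<beta> and
  make it monic. The remainder of any other such polynomial has smaller degree and the root \<beta>,
  so it vanishes.\<close>

lemma minimal_poly_over:
  assumes F: "field_subset F" and q: "coeffs_in F q" "q \<noteq> 0" "poly q \<beta> = 0"
  obtains h where "coeffs_in F h" "lead_coeff h = 1" "poly h \<beta> = 0"
    "\<And>p. coeffs_in F p \<Longrightarrow> poly p \<beta> = 0 \<Longrightarrow> h dvd p"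
proof -
  let ?P = "\<lambda>n. \<exists>h. coeffs_in F h \<and> h \<noteq> 0 \<and> poly h \<beta> = 0 \<and> degree h = n"
  have "?P (LEAST n. ?P n)" by (rule LeastI[of ?P "degree q"]) (use q in auto)
  then obtain h0 where h0: "coeffs_in F h0" "h0 \<noteq> 0" "poly h0 \<beta> = 0" "degree h0 = (LEAST n. ?P n)"
    by blast
  have least: "degree h0 \<le> degree p" if "coeffs_in F p" "p \<noteq> 0" "poly p \<beta> = 0" for p
    unfolding h0(4) by (rule Least_le) (use that in blast)
  define h where "h = smult (inverse (lead_coeff h0)) h0"
  have lc: "lead_coeff h0 \<in> F" "lead_coeff h0 \<noteq> 0" using h0(1,2) by (auto simp: coeffs_in_def)
  have h: "coeffs_in F h" "lead_coeff h = 1" "poly h \<beta> = 0" "degree h = degree h0"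
    unfolding h_def using h0 lc F by (auto intro!: coeffs_in_smult simp: field_subsetD)
  have "h dvd p" if p: "coeffs_in F p" "poly p \<beta> = 0" for p
  proof -
    obtain s r where sr: "coeffs_in F s" "coeffs_in F r" "p = h * s + r" "r = 0 \<or> degree r < degree h"
      using coeffs_in_division[OF F h(1,2) p(1)] by auto
    have "poly r \<beta> = 0" using p(2) h(3) sr(3) by simp
    have "r = 0"
    proof (rule ccontr)
      assume "r \<noteq> 0"
      with least[OF sr(2) this \<open>poly r \<beta> = 0\<close>] sr(4) h(4) show False by auto
    qed
    then show ?thesis using sr(3) by simp
  qed
  with h show thesis using that by blast
qed

lemma linear_minimal_poly:
  assumes F: "field_subset F" and h: "coeffs_in F h" "lead_coeff h = 1" "poly h \<beta> = 0" "degree h < 2"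
  shows "\<beta> \<in> F"
proof -
  have "degree h \<noteq> 0"
  proof
    assume "degree h = 0"
    then show False using h(2,3) by (simp add: poly_altdef)
  qed
  then have "degree h = 1" using h(4) by simp
  then have "\<beta> = - coeff h 0" using h(2,3) by (simp add: poly_altdef eq_neg_iff_add_eq_0 add.commute)
  moreover have "coeff h 0 \<in> F" using h(1) by (simp add: coeffs_in_def)
  ultimately show ?thesis using F by (simp add: field_subsetD)
qed

interpretation of_rat_poly_hom: map_poly_inj_idom_hom of_rat ..

text \<open>In characteristic 0 the derivative of \<open>f\<close> is nonzero of smaller degree,
  hence coprime to \<open>f\<close>. A Bezout identity over the rationals, evaluated at
  \<open>z\<close>, excludes a common root in any extension.\<close>

lemma irreducible_rat_separable:
  fixes f :: "rat poly" and z :: "'b :: field_char_0"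
  assumes f: "irreducible f" and z: "poly (map_poly of_rat f) z = 0"
  shows "poly (pderiv (map_poly of_rat f)) z \<noteq> 0"
proof -
  have "degree f > 0" using f irreducible_not_unit[OF f] is_unit_iff_degree[of f] by (cases "f = 0") auto
  then have "pderiv f \<noteq> 0" "degree (pderiv f) < degree f"
    by (auto simp: pderiv_eq_0_iff degree_pderiv)
  then have "\<not> f dvd pderiv f" using dvd_imp_degree_le by fastforce
  then have "coprime f (pderiv f)"
    by (rule prime_elem_imp_coprime[OF irreducible_imp_prime_elem[OF f]])
  then have "gcd f (pderiv f) = 1" by (simp add: coprime_iff_gcd_eq_1)
  with bezout_coefficients_fst_snd[of f "pderiv f"]
  obtain u v where "u * f + v * pderiv f = 1" by metis
  from arg_cong[OF this, of "\<lambda>p. poly (map_poly of_rat p) z"]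
  have "poly (map_poly of_rat u) z * poly (map_poly of_rat f) z
     + poly (map_poly of_rat v) z * poly (map_poly of_rat (pderiv f)) z = 1"
    by (simp add: hom_distribs)
  then show ?thesis using z by (auto simp: of_rat_hom.map_poly_pderiv)
qed

text \<open>Divide by \<open>X - a\<close>. The cofactor has a root \<open>b\<close>, and its value
  at \<open>a\<close> is the derivative of \<open>h\<close> there, which is nonzero; so
  \<open>b\<close> differs from \<open>a\<close>.\<close>

lemma second_root:
  fixes h :: "'b :: alg_closed_field poly"
  assumes "degree h \<ge> 2" "poly h a = 0" "poly (pderiv h) a \<noteq> 0"
  obtains b where "b \<noteq> a" "poly h b = 0"
proof -
  obtain k where k: "h = [:- a, 1:] * k" using assms(2) by (auto simp: poly_eq_0_iff_dvd)
  moreover from this have "k \<noteq> 0" using assms(1) by auto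
  ultimately have "degree h = 1 + degree k" by (simp only: degree_mult_eq) (subst degree_mult_eq; simp)
  then have "degree k > 0" using assms(1) by simp
  then obtain b where b: "poly k b = 0" using alg_closed_imp_poly_has_root by auto
  have "poly (pderiv h) a = poly k a" unfolding k pderiv_mult by (simp add: pderiv_pCons)
  then have "b \<noteq> a" using b assms(3) by auto
  then show thesis using that[of b] b k by simp
qed

section \<open>Primitive elements\<close>

interpretation to_ac: field_char_0_hom "to_ac :: 'a :: field_char_0 \<Rightarrow> 'a alg_closure"
  by unfold_locales auto

interpretation to_ac_poly: map_poly_inj_idom_hom "to_ac :: 'a :: field_char_0 \<Rightarrow> 'a alg_closure" ..

lemma to_ac_of_rat: "to_ac (of_rat q) = of_rat q"
proof -
  obtain a b where "q = of_int a / of_int b" by (metis quotient_of_div surj_pair)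
  then show ?thesis by (simp add: of_rat_divide)
qed

lemma map_to_ac_of_rat: "map_poly to_ac (map_poly of_rat p) = map_poly of_rat p"
  by (simp add: map_poly_map_poly comp_def to_ac_of_rat)

text \<open>The classical choice \<theta> + c \<beta>. Over a subfield \<open>F\<close> containing
  it, the minimal polynomial of \<beta> divides both \<open>g\<close> and
  \<open>f(\<gamma> - c X)\<close>. A second root would express \<open>c\<close> through conjugates
  of \<theta> and \<beta>, which finitely many values of \<open>c\<close> do; otherwise the minimal
  polynomial is linear. The conjugates are taken in the algebraic closure of \<open>'a\<close>,
  because embeddings into the complex numbers are constructed only later, from the primitive
  element.\<close>

lemma primitive_element_pair:
  fixes \<theta> \<beta> :: "'a :: field_char_0"
  assumes f: "irreducible f" "poly (map_poly of_rat f) \<theta> = 0"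
    and g: "irreducible g" "poly (map_poly of_rat g) \<beta> = 0"
  obtains \<gamma> where "\<And>F. field_subset F \<Longrightarrow> \<gamma> \<in> F \<Longrightarrow> \<theta> \<in> F \<and> \<beta> \<in> F"
proof -
  let ?A = "{z :: 'a alg_closure. poly (map_poly of_rat f) z = 0}"
  let ?B = "{z :: 'a alg_closure. poly (map_poly of_rat g) z = 0}"
  have f0: "f \<noteq> 0" and g0: "g \<noteq> 0" using f g by auto
  \<comment> \<open>The slopes for which \<theta> + c \<beta> would coincide with
    \<open>a + c b\<close> for other conjugates. Pairs with \<open>b = to_ac \<beta>\<close> divide
    by zero and merely put 0 into the set.\<close>
  define bad where "bad = (\<lambda>(a, b). (a - to_ac \<theta>) / (to_ac \<beta> - b)) ` (?A \<times> ?B)"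
  have "finite ?A" "finite ?B" using f0 g0 by (auto intro!: poly_roots_finite)
  then have "finite bad" by (simp add: bad_def)
  moreover have "infinite (range (of_nat :: nat \<Rightarrow> 'a alg_closure))"
    by (rule range_inj_infinite) (simp add: inj_on_def)
  ultimately have "\<not> range (of_nat :: nat \<Rightarrow> 'a alg_closure) \<subseteq> bad" using finite_subset by blast
  then obtain c :: nat where c: "(of_nat c :: 'a alg_closure) \<notin> bad" by auto
  define \<gamma> where "\<gamma> = \<theta> + of_nat c * \<beta>"
  show thesis
  proof (rule that)
    fix F assume F: "field_subset F" and \<gamma>: "\<gamma> \<in> F"
    have cF: "of_nat c \<in> F" using F by (simp add: field_subsetD)
    let ?g = "map_poly of_rat g :: 'a poly"
    \<comment> \<open>This is \<open>f(\<gamma> - c X)\<close>, a polynomial over \<open>F\<close>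
      that takes the value \<open>f(\<theta>) = 0\<close> at \<beta>.\<close>
    let ?f = "pcompose (map_poly of_rat f) [:\<gamma>, - of_nat c:] :: 'a poly"
    obtain h where h: "coeffs_in F h" "lead_coeff h = 1" "poly h \<beta> = 0"
      "\<And>p. coeffs_in F p \<Longrightarrow> poly p \<beta> = 0 \<Longrightarrow> h dvd p"
      by (rule minimal_poly_over[OF F coeffs_in_of_rat[OF F, of g] _ g(2)]) (use g0 in auto)
    have hg: "h dvd ?g" using h(4)[OF coeffs_in_of_rat[OF F] g(2)] .
    have "coeffs_in F ?f"
      using F \<gamma> cF by (intro coeffs_in_pcompose coeffs_in_of_rat) (auto simp: coeffs_in_pCons coeffs_in_0 field_subsetD)
    moreover have "poly ?f \<beta> = 0" using f(2) by (simp add: poly_pcompose \<gamma>_def mult.commute)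
    ultimately have hf: "h dvd ?f" by (rule h(4))
    have "degree h < 2"
    proof (rule ccontr)
      assume deg: "\<not> ?thesis"
      let ?h = "map_poly to_ac h"
      have hg': "?h dvd map_poly of_rat g"
        using to_ac_poly.hom_dvd[OF hg] by (simp add: map_to_ac_of_rat)
      have hf': "?h dvd pcompose (map_poly of_rat f) [:to_ac \<gamma>, - of_nat c:]"
        using to_ac_poly.hom_dvd[OF hf] by (simp add: to_ac.map_poly_pcompose map_to_ac_of_rat hom_distribs)
      have r: "poly ?h (to_ac \<beta>) = 0" using h(3) by simp
      have "poly (map_poly of_rat g) (to_ac \<beta>) = 0" using hg' r by (auto simp: dvd_def)
      then have "poly (pderiv (map_poly of_rat g)) (to_ac \<beta>) \<noteq> 0" by (rule irreducible_rat_separable[OF g(1)])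
      then have "poly (pderiv ?h) (to_ac \<beta>) \<noteq> 0" using hg' r by (auto simp: dvd_def pderiv_mult)
      then obtain b where b: "b \<noteq> to_ac \<beta>" "poly ?h b = 0"
        using second_root[of ?h "to_ac \<beta>"] r deg by (auto simp: not_less)
      have bB: "b \<in> ?B" using hg' b(2) by (auto simp: dvd_def)
      define a where "a = to_ac \<gamma> - of_nat c * b"
      have aA: "a \<in> ?A" using hf' b(2) by (auto simp: dvd_def poly_pcompose a_def mult.commute dest!: arg_cong[of _ _ "\<lambda>p. poly p b"])
      have "of_nat c * (to_ac \<beta> - b) = a - to_ac \<theta>"
        by (simp add: a_def \<gamma>_def hom_distribs algebra_simps)
      then have "of_nat c = (a - to_ac \<theta>) / (to_ac \<beta> - b)" using b(1) by (simp add: field_simps)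
      then have "of_nat c \<in> bad" unfolding bad_def using aA bB by (auto intro!: image_eqI[of _ _ "(a, b)"])
      with c show False by simp
    qed
    then have \<beta>: "\<beta> \<in> F" by (rule linear_minimal_poly[OF F h(1-3)])
    have "\<theta> = \<gamma> - of_nat c * \<beta>" by (simp add: \<gamma>_def)
    then show "\<theta> \<in> F \<and> \<beta> \<in> F" using F \<beta> \<gamma> cF by (simp add: field_subsetD)
  qed
qed

section \<open>Subfields, spans and dimension of HOL-Algebra in terms of the operations of the
  type\<close>

lemma ring_of_type_algebra_simps:
  "carrier ring_of_type_algebra = UNIV" "x \<otimes>\<^bsub>ring_of_type_algebra\<^esub> y = x * y"
  "x \<oplus>\<^bsub>ring_of_type_algebra\<^esub> y = x + y" "\<one>\<^bsub>ring_of_type_algebra\<^esub> = 1" "\<zero>\<^bsub>ring_of_type_algebra\<^esub> = 0"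
  by (simp_all add: ring_of_type_algebra_def)

lemma type_algebra_minus:
  fixes x :: "'a :: field_char_0"
  shows "\<ominus>\<^bsub>ring_of_type_algebra\<^esub> x = - x"
proof -
  interpret R: Ring.field "ring_of_type_algebra :: 'a ring" by (rule field_from_type_algebra)
  show ?thesis by (rule R.minus_equality) (simp_all add: ring_of_type_algebra_simps)
qed

lemma type_algebra_inv:
  fixes x :: "'a :: field_char_0"
  assumes "x \<noteq> 0"
  shows "inv\<^bsub>ring_of_type_algebra\<^esub> x = inverse x"
proof -
  interpret R: Ring.field "ring_of_type_algebra :: 'a ring" by (rule field_from_type_algebra)
  show ?thesis
    by (rule R.comm_inv_char) (use assms in \<open>simp_all add: ring_of_type_algebra_simps\<close>)
qed

lemma subfield_type_algebra:
  fixes F :: "'a :: field_char_0 set"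
  assumes "field_subset F"
  shows "subfield F ring_of_type_algebra"
proof -
  interpret R: Ring.field "ring_of_type_algebra :: 'a ring" by (rule field_from_type_algebra)
  show ?thesis
  proof (rule R.subfieldI')
    show "subring F ring_of_type_algebra"
      by (rule R.subringI)
        (use assms in \<open>simp_all add: ring_of_type_algebra_simps type_algebra_minus field_subsetD\<close>)
  qed (use assms in \<open>simp add: ring_of_type_algebra_simps type_algebra_inv field_subsetD\<close>)
qed

lemma field_subset_generate_field:
  fixes H :: "'a :: field_char_0 set"
  shows "field_subset (generate_field ring_of_type_algebra H)" (is "field_subset ?F")
proof -
  note intros = generate_field.intros[where R = "ring_of_type_algebra :: 'a ring" and H = H,
      unfolded ring_of_type_algebra_simps type_algebra_minus]
  have minus: "x - y \<in> ?F" if "x \<in> ?F" "y \<in> ?F" for x y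
    using intros(5)[OF that(1) intros(3)[OF that(2)]] by simp
  have zero: "0 \<in> ?F" using minus[OF intros(1) intros(1)] by simp
  have inv: "inverse x \<in> ?F" if "x \<in> ?F" for x
    using intros(4)[OF that] zero by (cases "x = 0") (auto simp: type_algebra_inv)
  show ?thesis unfolding field_subset_def
    using intros(1,6) minus zero inv by blast
qed

lemma field_subset_Rats: "field_subset (\<rat> :: 'a :: field_char_0 set)"
  unfolding field_subset_def by (intro conjI ballI Rats_diff Rats_mult Rats_inverse Rats_0 Rats_1)

lemma combine_type_algebra:
  fixes Us :: "'a :: field_char_0 list"
  assumes "length Ks = length Us"
  shows "ring.combine ring_of_type_algebra Ks Us = (\<Sum>i<length Us. Ks ! i * Us ! i)"
proof -
  interpret R: Ring.field "ring_of_type_algebra :: 'a ring" by (rule field_from_type_algebra)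
  show ?thesis using assms
  proof (induction Ks Us rule: list_induct2)
    case Nil
    then show ?case by (simp add: ring_of_type_algebra_simps)
  next
    case (Cons k Ks u Us)
    then show ?case
      by (simp add: ring_of_type_algebra_simps lessThan_Suc_eq_insert_0 sum.reindex comp_def)
  qed
qed

lemma Rats_list_of_rat:
  assumes "set Ks \<subseteq> \<rat>"
  shows "\<exists>q. \<forall>i<length Ks. Ks ! i = of_rat (q i)"
proof -
  have "\<exists>r. i < length Ks \<longrightarrow> Ks ! i = of_rat r" for i
  proof (cases "i < length Ks")
    case True
    then have "Ks ! i \<in> \<rat>" using assms nth_mem by blast
    then show ?thesis by (auto elim: Rats_cases)
  qed simp
  then have "\<exists>q. \<forall>i. i < length Ks \<longrightarrow> Ks ! i = of_rat (q i)" by (intro choice allI)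
  then show ?thesis .
qed

lemma number_field_algebraic:
  fixes x :: "'a :: field_char_0"
  assumes "number_field TYPE('a)"
  obtains p where "p \<noteq> 0" "poly (map_poly of_rat p) x = 0"
proof -
  interpret R: Ring.field "ring_of_type_algebra :: 'a ring" by (rule field_from_type_algebra)
  have Q: "subfield (\<rat> :: 'a set) ring_of_type_algebra"
    by (rule subfield_type_algebra[OF field_subset_Rats])
  obtain n where n: "R.dimension n \<rat> UNIV"
    using assms unfolding number_field_def R.finite_dimension_def by auto
  let ?Us = "map (\<lambda>i. x ^ i) [0..<Suc n]"
  have "\<not> R.independent \<rat> ?Us"
    using R.independent_length_le_dimension[OF Q n, of ?Us] by auto
  then obtain Ks where Ks: "length Ks = length ?Us" "R.combine Ks ?Us = 0" "set Ks \<subseteq> \<rat>" "set Ks \<noteq> {0}"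
    by (rule R.dependent_imp_non_trivial_combine[OF Q, unfolded ring_of_type_algebra_simps, OF subset_UNIV])
  obtain q where q: "\<And>i. i < length Ks \<Longrightarrow> Ks ! i = of_rat (q i)" using Rats_list_of_rat[OF Ks(3)] by blast
  define p where "p = (\<Sum>i<Suc n. monom (q i) i)"
  have cp: "coeff p i = (if i < Suc n then q i else 0)" for i
    unfolding p_def by (simp add: coeff_sum)
  have "0 = (\<Sum>i<Suc n. Ks ! i * x ^ i)"
    using Ks(2) combine_type_algebra[OF Ks(1)] by (simp del: upt_Suc)
  also have "\<dots> = (\<Sum>i<Suc n. of_rat (q i) * x ^ i)" using q Ks(1) by (intro sum.cong) auto
  also have "\<dots> = poly (map_poly of_rat p) x"
    unfolding p_def by (simp add: of_rat_poly_hom.hom_sum poly_sum poly_monom del: sum.lessThan_Suc)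
  finally have "poly (map_poly of_rat p) x = 0" ..
  moreover have "p \<noteq> 0"
  proof
    assume "p = 0"
    then have "q i = 0" if "i < Suc n" for i using cp[of i] that by simp
    then have "set Ks \<subseteq> {0}" using q Ks(1) by (auto simp: in_set_conv_nth)
    \<comment> \<open>\<open>set Ks \<noteq> {0}\<close> expresses a nontrivial relation only for a
      nonempty list; here there are \<open>n + 1\<close> coefficients.\<close>
    moreover have "set Ks \<noteq> {}" using Ks(1) by auto
    ultimately show False using Ks(4) by (simp add: subset_singleton_iff)
  qed
  ultimately show thesis using that by blast
qed

lemma irreducible_poly_exists:
  fixes x :: "'a :: field_char_0"
  assumes "p \<noteq> 0" "poly (map_poly of_rat p) x = 0"
  shows "\<exists>f :: rat poly. irreducible f \<and> poly (map_poly of_rat f) x = 0"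
  using assms
proof (induction "degree p" arbitrary: p rule: less_induct)
  case less
  show ?case
  proof (cases "irreducible p")
    case True
    then show ?thesis using less.prems(2) by blast
  next
    case False
    have "degree p \<noteq> 0"
    proof
      assume "degree p = 0"
      then obtain c where c: "p = [:c:]" by (rule degree_eq_zeroE)
      show False using less.prems unfolding c by simp
    qed
    then have "\<not> is_unit p" using is_unit_iff_degree[OF less.prems(1)] by simp
    then obtain a b where ab: "p = a * b" "\<not> is_unit a" "\<not> is_unit b"
      using False less.prems(1) unfolding irreducible_def by auto
    have nz: "a \<noteq> 0" "b \<noteq> 0" using ab(1) less.prems(1) by auto
    have "degree p = degree a + degree b" unfolding ab(1) using nz by (rule degree_mult_eq)
    moreover have "degree a \<noteq> 0" "degree b \<noteq> 0"
      using ab(2,3) nz is_unit_iff_degree[OF nz(1)] is_unit_iff_degree[OF nz(2)] by simp_all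
    ultimately have "degree a < degree p" "degree b < degree p" by simp_all
    moreover have "poly (map_poly of_rat a) x = 0 \<or> poly (map_poly of_rat b) x = 0"
      using less.prems(2) unfolding ab(1) of_rat_poly_hom.hom_mult poly_mult by simp
    ultimately show ?thesis
      using less.hyps[of a, OF _ nz(1)] less.hyps[of b, OF _ nz(2)] by (elim disjE) simp_all
  qed
qed

lemma number_field_irreducible:
  fixes x :: "'a :: field_char_0"
  assumes "number_field TYPE('a)"
  obtains f :: "rat poly" where "irreducible f" "poly (map_poly of_rat f) x = 0"
proof -
  obtain p where "p \<noteq> 0" "poly (map_poly of_rat p) x = 0" by (rule number_field_algebraic[OF assms])
  from irreducible_poly_exists[OF this] show thesis by (elim exE conjE) (rule that)
qed

text \<open>The elements of a finite spanning list are absorbed one at a time into a single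
  generator by \<open>primitive_element_pair\<close>.\<close>

lemma number_field_primitive_element:
  assumes nf: "number_field TYPE('a :: field_char_0)"
  obtains \<theta> :: "'a :: field_char_0" where "\<And>F. field_subset F \<Longrightarrow> \<theta> \<in> F \<Longrightarrow> F = UNIV"
proof -
  interpret R: Ring.field "ring_of_type_algebra :: 'a ring" by (rule field_from_type_algebra)
  have Q: "subfield (\<rat> :: 'a set) ring_of_type_algebra"
    by (rule subfield_type_algebra[OF field_subset_Rats])
  obtain n where n: "R.dimension n \<rat> UNIV"
    using assms unfolding number_field_def R.finite_dimension_def by auto
  obtain Us where Us: "R.Span \<rat> Us = UNIV" using R.exists_base[OF Q n] by auto
  have "\<exists>\<gamma>. \<forall>F. field_subset F \<longrightarrow> \<gamma> \<in> F \<longrightarrow> set Us \<subseteq> F"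
  proof (induction Us)
    case (Cons u Us)
    then obtain \<gamma> where \<gamma>: "\<And>F. field_subset F \<Longrightarrow> \<gamma> \<in> F \<Longrightarrow> set Us \<subseteq> F" by blast
    obtain f where f: "irreducible f" "poly (map_poly of_rat f) \<gamma> = 0"
      by (rule number_field_irreducible[OF nf])
    obtain g where g: "irreducible g" "poly (map_poly of_rat g) u = 0"
      by (rule number_field_irreducible[OF nf])
    obtain \<delta> where "\<And>F. field_subset F \<Longrightarrow> \<delta> \<in> F \<Longrightarrow> \<gamma> \<in> F \<and> u \<in> F"
      using primitive_element_pair[OF f g] by blast
    with \<gamma> show ?case by (intro exI[of _ \<delta>]) auto
  qed auto
  then obtain \<theta> where \<theta>: "\<And>F. field_subset F \<Longrightarrow> \<theta> \<in> F \<Longrightarrow> set Us \<subseteq> F" by blast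
  have "F = UNIV" if F: "field_subset F" "\<theta> \<in> F" for F
  proof -
    have "x \<in> F" for x
    proof -
      have "x \<in> R.Span \<rat> Us" using Us by simp
      then obtain Ks where Ks: "set Ks \<subseteq> \<rat>" "length Ks = length Us" "x = R.combine Ks Us"
        using R.Span_mem_iff_length_version[OF Q, of Us x] by (auto simp: ring_of_type_algebra_simps)
      have "Ks ! i \<in> F" if "i < length Us" for i
      proof -
        have "Ks ! i \<in> \<rat>" using Ks(1,2) that by auto
        then show ?thesis by (elim Rats_cases) (simp add: F field_subsetD)
      qed
      moreover have "Us ! i \<in> F" if "i < length Us" for i using \<theta>[OF F] that by auto
      ultimately show "x \<in> F"
        unfolding Ks(3) combine_type_algebra[OF Ks(2)]
        using F(1) by (intro field_subset_sum) (auto simp: field_subsetD)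
    qed
    then show ?thesis by auto
  qed
  then show thesis by (rule that)
qed

text \<open>Presents the field as \<open>\<rat>[X] / (f)\<close>, with \<open>f\<close> not
  normalised to be monic. Coordinates, embeddings and the degree are all read off from this
  presentation.\<close>

locale primitive_element =
  fixes \<theta> :: "'a :: field_char_0" and f :: "rat poly"
  assumes f_irreducible: "irreducible f"
    and f_root: "poly (map_poly of_rat f) \<theta> = 0"
    and generates: "\<And>x. \<exists>q. x = poly (map_poly of_rat q) \<theta>"
begin

lemma f_nz: "f \<noteq> 0" using f_irreducible by auto

lemma f_dvd: "poly (map_poly of_rat q) \<theta> = 0 \<longleftrightarrow> f dvd q"
proof
  assume q: "poly (map_poly of_rat q) \<theta> = 0"
  show "f dvd q"
  proof (rule ccontr)
    assume "\<not> f dvd q"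
    then have "coprime f q" by (rule prime_elem_imp_coprime[OF irreducible_imp_prime_elem[OF f_irreducible]])
    then have "gcd f q = 1" by (simp add: coprime_iff_gcd_eq_1)
    with bezout_coefficients_fst_snd[of f q] obtain u v where "u * f + v * q = 1" by metis
    from arg_cong[OF this, of "\<lambda>p. poly (map_poly of_rat p) \<theta>"] q f_root show False
      by (simp add: of_rat_poly_hom.hom_mult of_rat_poly_hom.hom_add)
  qed
next
  assume "f dvd q"
  then show "poly (map_poly of_rat q) \<theta> = 0"
    using f_root by (auto simp: of_rat_poly_hom.hom_mult elim!: dvdE)
qed

lemma degree_pos: "degree f > 0"
  using f_irreducible irreducible_not_unit[OF f_irreducible] is_unit_iff_degree[of f] by (cases "f = 0") auto

definition rep :: "'a \<Rightarrow> rat poly" where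
  "rep x = (SOME q. x = poly (map_poly of_rat q) \<theta> \<and> (q = 0 \<or> degree q < degree f))"

lemma rep: "poly (map_poly of_rat (rep x)) \<theta> = x" "rep x = 0 \<or> degree (rep x) < degree f"
proof -
  obtain q where q: "x = poly (map_poly of_rat q) \<theta>" using generates by blast
  have "poly (map_poly of_rat (f * (q div f) + q mod f)) \<theta> = poly (map_poly of_rat (q mod f)) \<theta>"
    unfolding of_rat_poly_hom.hom_add of_rat_poly_hom.hom_mult by (simp add: f_root)
  then have "x = poly (map_poly of_rat (q mod f)) \<theta>" using q by simp
  moreover have "q mod f = 0 \<or> degree (q mod f) < degree f" using f_nz by (rule degree_mod_less)
  ultimately have "\<exists>q. x = poly (map_poly of_rat q) \<theta> \<and> (q = 0 \<or> degree q < degree f)"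
    by (intro exI[of _ "q mod f"] conjI)
  from someI_ex[OF this, folded rep_def]
  show "poly (map_poly of_rat (rep x)) \<theta> = x" "rep x = 0 \<or> degree (rep x) < degree f" by simp_all
qed

lemma rep_sum: "x = (\<Sum>i<degree f. of_rat (coeff (rep x) i) * \<theta> ^ i)"
proof -
  have "x = (\<Sum>i\<le>degree (rep x). of_rat (coeff (rep x) i) * \<theta> ^ i)"
    using rep(1)[of x] by (simp add: poly_altdef)
  also have "\<dots> = (\<Sum>i<degree f. of_rat (coeff (rep x) i) * \<theta> ^ i)"
    using rep(2)[of x] degree_pos by (intro sum.mono_neutral_left) (auto simp: coeff_eq_0)
  finally show ?thesis .
qed

lemma power_basis_independent:
  assumes "(\<Sum>i<degree f. of_rat (q i) * \<theta> ^ i) = 0" "i < degree f"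
  shows "q i = 0"
proof -
  define p where "p = (\<Sum>i<degree f. monom (q i) i)"
  have cp: "coeff p i = (if i < degree f then q i else 0)" for i
    unfolding p_def by (simp add: coeff_sum)
  have "poly (map_poly of_rat p) \<theta> = 0"
    using assms(1) by (simp add: p_def of_rat_poly_hom.hom_sum poly_sum poly_monom)
  then have "f dvd p" using f_dvd by blast
  have "p = 0"
  proof (rule ccontr)
    assume "p \<noteq> 0"
    then have "degree f \<le> degree p" using \<open>f dvd p\<close> by (simp add: dvd_imp_degree_le)
    then have "coeff p (degree p) = 0" by (simp add: cp)
    with \<open>p \<noteq> 0\<close> show False by simp
  qed
  then show ?thesis using cp[of i] assms(2) by simp
qed

lemma field_degree_eq: "field_degree TYPE('a) = degree f"
proof -
  interpret R: Ring.field "ring_of_type_algebra :: 'a ring" by (rule field_from_type_algebra)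
  have Q: "subfield (\<rat> :: 'a set) ring_of_type_algebra"
    by (rule subfield_type_algebra[OF field_subset_Rats])
  let ?Us = "map (\<lambda>i. \<theta> ^ i) [0..<degree f]"
  have "R.independent \<rat> ?Us"
  proof (rule ccontr)
    assume "\<not> ?thesis"
    then obtain Ks where Ks: "length Ks = length ?Us" "R.combine Ks ?Us = 0" "set Ks \<subseteq> \<rat>" "set Ks \<noteq> {0}"
      by (rule R.dependent_imp_non_trivial_combine[OF Q, unfolded ring_of_type_algebra_simps, OF subset_UNIV])
    obtain q where q: "\<And>i. i < length Ks \<Longrightarrow> Ks ! i = of_rat (q i)" using Rats_list_of_rat[OF Ks(3)] by blast
    have "0 = (\<Sum>i<degree f. Ks ! i * \<theta> ^ i)"
      using Ks(2) combine_type_algebra[OF Ks(1)] by (simp del: upt_Suc)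
    also have "\<dots> = (\<Sum>i<degree f. of_rat (q i) * \<theta> ^ i)" using q Ks(1) by (intro sum.cong) auto
    finally have "q i = 0" if "i < degree f" for i using power_basis_independent that by simp
    then have "set Ks \<subseteq> {0}" using q Ks(1) by (auto simp: in_set_conv_nth)
    moreover have "set Ks \<noteq> {}" using Ks(1) degree_pos by auto
    ultimately show False using Ks(4) by (simp add: subset_singleton_iff)
  qed
  moreover have "R.Span \<rat> ?Us = UNIV"
  proof -
    have "x \<in> R.Span \<rat> ?Us" for x
    proof -
      let ?Ks = "map (\<lambda>i. of_rat (coeff (rep x) i)) [0..<degree f]"
      have "x = R.combine ?Ks ?Us"
        using rep_sum[of x] by (subst combine_type_algebra) auto
      then show ?thesis
        by (subst R.Span_mem_iff_length_version[OF Q]) (auto simp: ring_of_type_algebra_simps intro!: exI[of _ ?Ks])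
    qed
    then show ?thesis by auto
  qed
  ultimately have "R.dimension (length ?Us) \<rat> UNIV" by (rule R.dimensionI[OF Q])
  then show ?thesis
    using R.dimI[OF Q, of "length ?Us" UNIV] by (simp add: field_degree_def over_def)
qed

end

text \<open>The polynomial expressions in \<theta> are closed under inverses by a Bezout identity
  with the irreducible \<open>f\<close>. They form a subfield containing \<theta>, which is
  therefore everything.\<close>

lemma number_field_primitive:
  assumes nf: "number_field TYPE('a :: field_char_0)"
  obtains \<theta> :: "'a :: field_char_0" and f where "primitive_element \<theta> f"
proof -
  obtain \<theta> :: 'a where \<theta>: "\<And>F. field_subset F \<Longrightarrow> \<theta> \<in> F \<Longrightarrow> F = UNIV"
    using number_field_primitive_element[OF nf] by blast
  obtain f where f: "irreducible f" "poly (map_poly of_rat f) \<theta> = 0"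
    by (rule number_field_irreducible[OF nf])
  let ?S = "range (\<lambda>q. poly (map_poly of_rat q) \<theta>)"
  have "field_subset ?S"
    unfolding field_subset_def
  proof (intro conjI ballI)
    show "0 \<in> ?S" by (rule range_eqI[of _ _ 0]) simp
    show "1 \<in> ?S" by (rule range_eqI[of _ _ 1]) simp
  next
    fix x y assume "x \<in> ?S" "y \<in> ?S"
    then obtain p q where "x = poly (map_poly of_rat p) \<theta>" "y = poly (map_poly of_rat q) \<theta>" by auto
    then have "x - y = poly (map_poly of_rat (p - q)) \<theta>" "x * y = poly (map_poly of_rat (p * q)) \<theta>"
      by (simp_all add: of_rat_poly_hom.hom_minus of_rat_poly_hom.hom_mult)
    then show "x - y \<in> ?S" "x * y \<in> ?S" by simp_all
  next
    fix x assume "x \<in> ?S"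
    then obtain q where q: "x = poly (map_poly of_rat q) \<theta>" by auto
    show "inverse x \<in> ?S"
    proof (cases "x = 0")
      case True
      then show ?thesis by (intro range_eqI[of _ _ 0]) simp
    next
      case False
      then have "\<not> f dvd q" using f(2) q by (auto simp: of_rat_poly_hom.hom_mult elim!: dvdE)
      then have "coprime f q" by (rule prime_elem_imp_coprime[OF irreducible_imp_prime_elem[OF f(1)]])
      then have "gcd f q = 1" by (simp add: coprime_iff_gcd_eq_1)
      with bezout_coefficients_fst_snd[of f q] obtain u v where "u * f + v * q = 1" by metis
      from arg_cong[OF this, of "\<lambda>p. poly (map_poly of_rat p) \<theta>"] q f(2)
      have "poly (map_poly of_rat v) \<theta> * x = 1"
        by (simp add: of_rat_poly_hom.hom_mult of_rat_poly_hom.hom_add)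
      then have "inverse x = poly (map_poly of_rat v) \<theta>" using False by (simp add: field_simps)
      then show ?thesis by blast
    qed
  qed
  moreover have "\<theta> \<in> ?S" by (rule range_eqI[of _ _ "[:0, 1:]"]) (simp add: map_poly_pCons)
  ultimately have "?S = UNIV" by (rule \<theta>)
  then have "primitive_element \<theta> f" using f by unfold_locales auto
  then show thesis by (rule that)
qed

section \<open>Embeddings into the complex numbers\<close>

lemma ring_hom_type_algebra_iff:
  fixes \<sigma> :: "'a :: field_char_0 \<Rightarrow> 'b :: field_char_0"
  shows "\<sigma> \<in> Ring.ring_hom ring_of_type_algebra ring_of_type_algebra \<longleftrightarrow> field_char_0_hom \<sigma>"
proof
  assume *: "\<sigma> \<in> Ring.ring_hom ring_of_type_algebra ring_of_type_algebra"
  have add: "\<sigma> (x + y) = \<sigma> x + \<sigma> y" and mult: "\<sigma> (x * y) = \<sigma> x * \<sigma> y" and one: "\<sigma> 1 = 1" for x y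
    using ring_hom_add[OF *, of x y] ring_hom_mult[OF *, of x y] ring_hom_one[OF *]
    by (simp_all add: ring_of_type_algebra_simps)
  have zero: "\<sigma> 0 = 0" using add[of 0 0] by simp
  show "field_char_0_hom \<sigma>"
    by unfold_locales (simp_all add: add mult one zero)
next
  assume "field_char_0_hom \<sigma>"
  then interpret field_char_0_hom \<sigma> .
  show "\<sigma> \<in> Ring.ring_hom ring_of_type_algebra ring_of_type_algebra"
    by (rule ring_hom_memI) (simp_all add: ring_of_type_algebra_simps hom_add hom_mult)
qed

lemma ring_hom_type_algebra_eq:
  "Ring.ring_hom (ring_of_type_algebra :: 'a :: field_char_0 ring) (ring_of_type_algebra :: 'b :: field_char_0 ring)
     = {\<sigma>. field_char_0_hom \<sigma>}"
  by (rule Set.set_eqI) (simp add: ring_hom_type_algebra_iff)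

lemma (in field_char_0_hom) hom_of_rat: "hom (of_rat q) = of_rat q"
proof -
  obtain a b where "q = of_int a / of_int b" by (metis quotient_of_div surj_pair)
  then show ?thesis by (simp add: of_rat_divide hom_div hom_of_int)
qed

lemma (in field_char_0_hom) hom_poly_of_rat:
  "hom (poly (map_poly of_rat p) x) = poly (map_poly of_rat p) (hom x)"
proof -
  have "map_poly hom (map_poly of_rat p) = map_poly of_rat p"
    by (simp add: map_poly_map_poly comp_def hom_of_rat)
  then show ?thesis using poly_map_poly[of "map_poly of_rat p" x] by simp
qed

context primitive_element
begin

lemma hom_eqI:
  assumes "field_char_0_hom \<sigma>" "field_char_0_hom \<tau>" "\<sigma> \<theta> = \<tau> \<theta>"
  shows "\<sigma> = \<tau>"
proof
  fix x
  interpret \<sigma>: field_char_0_hom \<sigma> by fact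
  interpret \<tau>: field_char_0_hom \<tau> by fact
  show "\<sigma> x = \<tau> x"
    using \<sigma>.hom_poly_of_rat[of "rep x" \<theta>] \<tau>.hom_poly_of_rat[of "rep x" \<theta>] by (simp add: rep(1) assms(3))
qed

lemma hom_root:
  assumes "field_char_0_hom \<sigma>"
  shows "poly (map_poly of_rat f) (\<sigma> \<theta>) = 0"
proof -
  interpret field_char_0_hom \<sigma> by fact
  show ?thesis using hom_poly_of_rat[of f \<theta>] by (simp add: f_root)
qed

text \<open>Evaluating representatives at \<open>z\<close> instead of \<theta> is well defined: two
  polynomials that agree at \<theta> differ by a multiple of \<open>f\<close>, which vanishes at
  \<open>z\<close>.\<close>

lemma root_hom:
  fixes z :: "'b :: field_char_0"
  assumes z: "poly (map_poly of_rat f) z = 0"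
  shows "\<exists>\<sigma>. field_char_0_hom \<sigma> \<and> \<sigma> \<theta> = z"
proof -
  have eq: "poly (map_poly of_rat p) z = poly (map_poly of_rat q) z"
    if "poly (map_poly of_rat p) \<theta> = poly (map_poly of_rat q) \<theta>" for p q
  proof -
    have "f dvd p - q" using that f_dvd[of "p - q"] by (simp add: of_rat_poly_hom.hom_minus)
    then obtain k where "p - q = f * k" by (rule dvdE)
    then have "p = f * k + q" by (simp add: algebra_simps)
    then show ?thesis using z by (simp add: of_rat_poly_hom.hom_add of_rat_poly_hom.hom_mult)
  qed
  define \<sigma> where "\<sigma> x = poly (map_poly of_rat (rep x)) z" for x
  have \<sigma>: "\<sigma> x = poly (map_poly of_rat p) z" if "x = poly (map_poly of_rat p) \<theta>" for x p
    unfolding \<sigma>_def by (rule eq) (simp add: rep(1) that)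
  have "field_char_0_hom \<sigma>"
  proof unfold_locales
    show "\<sigma> 0 = 0" using \<sigma>[of 0 0] by simp
    show "\<sigma> 1 = 1" using \<sigma>[of 1 1] by simp
    fix x y
    show "\<sigma> (x + y) = \<sigma> x + \<sigma> y" using \<sigma>[of "x + y" "rep x + rep y"]
      by (simp add: of_rat_poly_hom.hom_add rep(1)) (simp add: \<sigma>_def)
    show "\<sigma> (x * y) = \<sigma> x * \<sigma> y" using \<sigma>[of "x * y" "rep x * rep y"]
      by (simp add: of_rat_poly_hom.hom_mult rep(1)) (simp add: \<sigma>_def)
  qed
  moreover have "\<sigma> \<theta> = z" using \<sigma>[of \<theta> "[:0, 1:]"] by (simp add: map_poly_pCons)
  ultimately show ?thesis by blast
qed

lemma bij_betw_homs_roots: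
  "bij_betw (\<lambda>\<sigma>. \<sigma> \<theta>) {\<sigma> :: 'a \<Rightarrow> complex. field_char_0_hom \<sigma>} {z. poly (map_poly of_rat f) z = 0}"
  unfolding bij_betw_def
proof
  show "inj_on (\<lambda>\<sigma>. \<sigma> \<theta>) {\<sigma> :: 'a \<Rightarrow> complex. field_char_0_hom \<sigma>}"
    by (rule inj_onI) (simp add: hom_eqI)
  show "(\<lambda>\<sigma>. \<sigma> \<theta>) ` {\<sigma> :: 'a \<Rightarrow> complex. field_char_0_hom \<sigma>} = {z. poly (map_poly of_rat f) z = 0}"
  proof (intro equalityI subsetI)
    fix z assume "z \<in> {z :: complex. poly (map_poly of_rat f) z = 0}"
    then obtain \<sigma> where "field_char_0_hom \<sigma>" "\<sigma> \<theta> = z" using root_hom by auto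
    then show "z \<in> (\<lambda>\<sigma>. \<sigma> \<theta>) ` {\<sigma> :: 'a \<Rightarrow> complex. field_char_0_hom \<sigma>}" by (intro image_eqI[of _ _ \<sigma>]) simp_all
  next
    fix z assume "z \<in> (\<lambda>\<sigma>. \<sigma> \<theta>) ` {\<sigma> :: 'a \<Rightarrow> complex. field_char_0_hom \<sigma>}"
    then show "z \<in> {z. poly (map_poly of_rat f) z = 0}" using hom_root by auto
  qed
qed

lemma card_roots: "card {z :: complex. poly (map_poly of_rat f) z = 0} = degree f"
proof -
  have "rsquarefree (map_poly of_rat f :: complex poly)"
    unfolding rsquarefree_roots using irreducible_rat_separable[OF f_irreducible] by blast
  then show ?thesis
    using rsquarefree_card_degree[of "map_poly of_rat f :: complex poly"] f_nz by simp
qed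

lemma enumerates_embeddings_exists: "\<exists>\<sigma> :: nat \<Rightarrow> 'a \<Rightarrow> complex. enumerates_embeddings \<sigma>"
proof -
  have "card {\<sigma> :: 'a \<Rightarrow> complex. field_char_0_hom \<sigma>} = degree f"
    using bij_betw_same_card[OF bij_betw_homs_roots] card_roots by simp
  moreover have "finite {\<sigma> :: 'a \<Rightarrow> complex. field_char_0_hom \<sigma>}"
    using calculation degree_pos card_ge_0_finite by metis
  ultimately obtain \<sigma> where "bij_betw \<sigma> {0..<degree f} {\<sigma> :: 'a \<Rightarrow> complex. field_char_0_hom \<sigma>}"
    using ex_bij_betw_nat_finite by metis
  then show ?thesis
    unfolding enumerates_embeddings_def field_degree_eq ring_hom_type_algebra_eq
    by (intro exI[of _ \<sigma>]) (simp add: lessThan_atLeast0)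
qed

end

text \<open>The enumeration is a parameter because the final argument must use the one that occurs
  in the value chosen for \<open>discriminant\<close>.\<close>

locale number_field_embeddings = primitive_element \<theta> f
  for \<theta> :: "'a :: field_char_0" and f :: "rat poly" +
  fixes \<sigma> :: "nat \<Rightarrow> 'a \<Rightarrow> complex"
  assumes enum: "enumerates_embeddings \<sigma>"
begin

abbreviation "d \<equiv> degree f"

lemma bij_\<sigma>: "bij_betw \<sigma> {..<d} {\<sigma>. field_char_0_hom \<sigma>}"
  using enum unfolding enumerates_embeddings_def field_degree_eq ring_hom_type_algebra_eq .

lemma hom_\<sigma>: "i < d \<Longrightarrow> field_char_0_hom (\<sigma> i)"
  using bij_\<sigma> unfolding bij_betw_def by blast

lemma \<sigma>_surj: "field_char_0_hom \<tau> \<Longrightarrow> \<exists>i<d. \<sigma> i = \<tau>"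
  using bij_\<sigma> unfolding bij_betw_def by (metis imageE lessThan_iff mem_Collect_eq)

lemma \<sigma>_inj: "i < d \<Longrightarrow> j < d \<Longrightarrow> \<sigma> i \<theta> = \<sigma> j \<theta> \<Longrightarrow> i = j"
  using hom_eqI[OF hom_\<sigma> hom_\<sigma>] bij_\<sigma> unfolding bij_betw_def inj_on_def by blast

lemma \<sigma>_simps:
  assumes "i < d"
  shows "\<sigma> i (x + y) = \<sigma> i x + \<sigma> i y" "\<sigma> i (x * y) = \<sigma> i x * \<sigma> i y" "\<sigma> i 0 = 0" "\<sigma> i 1 = 1"
    "\<sigma> i (x - y) = \<sigma> i x - \<sigma> i y" "\<sigma> i (- x) = - \<sigma> i x" "\<sigma> i (x ^ k) = \<sigma> i x ^ k" "\<sigma> i (of_rat q) = of_rat q"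
    "\<sigma> i (sum u I) = (\<Sum>k\<in>I. \<sigma> i (u k))" "\<sigma> i x = 0 \<longleftrightarrow> x = 0" "\<sigma> i (of_int m) = of_int m"
    "\<sigma> i (inverse x) = inverse (\<sigma> i x)"
    "\<sigma> i (poly (map_poly of_rat p) x) = poly (map_poly of_rat p) (\<sigma> i x)"
proof -
  interpret field_char_0_hom "\<sigma> i" using assms by (rule hom_\<sigma>)
  show "\<sigma> i (x + y) = \<sigma> i x + \<sigma> i y" "\<sigma> i (x * y) = \<sigma> i x * \<sigma> i y" "\<sigma> i 0 = 0" "\<sigma> i 1 = 1"
    "\<sigma> i (x - y) = \<sigma> i x - \<sigma> i y" "\<sigma> i (- x) = - \<sigma> i x" "\<sigma> i (x ^ k) = \<sigma> i x ^ k" "\<sigma> i (of_rat q) = of_rat q"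
    "\<sigma> i (sum u I) = (\<Sum>k\<in>I. \<sigma> i (u k))" "\<sigma> i x = 0 \<longleftrightarrow> x = 0" "\<sigma> i (of_int m) = of_int m"
    "\<sigma> i (inverse x) = inverse (\<sigma> i x)"
    "\<sigma> i (poly (map_poly of_rat p) x) = poly (map_poly of_rat p) (\<sigma> i x)"
    by (simp_all add: hom_add hom_mult hom_minus hom_uminus hom_power hom_of_rat hom_sum hom_of_int hom_inverse hom_poly_of_rat)
qed

lemma root_\<sigma>:
  assumes "poly (map_poly of_rat f) (z :: complex) = 0"
  shows "\<exists>i<d. \<sigma> i \<theta> = z"
proof -
  obtain \<tau> where "field_char_0_hom \<tau>" "\<tau> \<theta> = z" using root_hom[OF assms] by blast
  with \<sigma>_surj show ?thesis by metis
qed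

text \<open>
  A second root of the image under \<open>\<sigma> w\<close> of the minimal polynomial of \<open>\<theta>\<close> over \<open>F\<close> would be \<open>\<sigma> j \<theta>\<close> for
  some \<open>j \<noteq> w\<close> with \<open>\<sigma> j \<alpha> = \<sigma> w \<alpha>\<close>; hence that polynomial is linear.
\<close>
lemma field_subset_separating_UNIV:
  assumes F: "field_subset F" and \<alpha>: "\<alpha> \<in> F" and w: "w < d"
    and sep: "\<And>j. j < d \<Longrightarrow> j \<noteq> w \<Longrightarrow> \<sigma> j \<alpha> \<noteq> \<sigma> w \<alpha>"
  shows "F = UNIV"
proof -
  obtain h where h: "coeffs_in F h" "lead_coeff h = 1" "poly h \<theta> = 0"
    "\<And>p. coeffs_in F p \<Longrightarrow> poly p \<theta> = 0 \<Longrightarrow> h dvd p"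
    by (rule minimal_poly_over[OF F coeffs_in_of_rat[OF F, of f] _ f_root]) (use f_nz in auto)
  have "degree h < 2"
  proof (rule ccontr)
    assume deg: "\<not> ?thesis"
    interpret s: field_char_0_hom "\<sigma> w" using w by (rule hom_\<sigma>)
    interpret sp: map_poly_inj_idom_hom "\<sigma> w" ..
    let ?h = "map_poly (\<sigma> w) h"
    have map_rat: "map_poly (\<sigma> w) (map_poly of_rat p) = map_poly of_rat p" for p
      by (simp add: map_poly_map_poly comp_def s.hom_of_rat)
    have hf: "?h dvd map_poly of_rat f"
      using sp.hom_dvd[OF h(4)[OF coeffs_in_of_rat[OF F] f_root]] by (simp add: map_rat)
    \<comment> \<open>Writing \<alpha> as \<open>q(\<theta>)\<close> with rational \<open>q\<close>
      gives a polynomial \<open>q - \<alpha>\<close> over \<open>F\<close> with root \<theta>. Under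
      \<open>\<sigma> w\<close> its rational part is fixed, so a root
      \<open>\<sigma> j \<theta>\<close> of the image of \<open>h\<close> satisfies
      \<open>\<sigma> j \<alpha> = \<sigma> w \<alpha>\<close>.\<close>
    let ?q = "map_poly of_rat (rep \<alpha>) :: 'a poly"
    have "coeffs_in F (?q - [:\<alpha>:])"
      using F \<alpha> by (intro coeffs_in_diff coeffs_in_of_rat) (simp_all add: coeffs_in_pCons coeffs_in_0)
    then have "h dvd ?q - [:\<alpha>:]" by (rule h(4)) (simp add: rep(1))
    then have hq: "?h dvd map_poly of_rat (rep \<alpha>) - [:\<sigma> w \<alpha>:]"
    proof -
      have "map_poly (\<sigma> w) [:\<alpha>:] = [:\<sigma> w \<alpha>:]"
        by (rule poly_eqI) (simp add: coeff_map_poly coeff_pCons split: nat.split)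
      then show ?thesis
        using sp.hom_dvd[OF \<open>h dvd ?q - [:\<alpha>:]\<close>] by (simp add: map_rat sp.hom_minus)
    qed
    have r: "poly ?h (\<sigma> w \<theta>) = 0" using h(3) by simp
    have "poly (pderiv (map_poly of_rat f)) (\<sigma> w \<theta>) \<noteq> 0"
      by (rule irreducible_rat_separable[OF f_irreducible hom_root[OF hom_\<sigma>[OF w]]])
    then have "poly (pderiv ?h) (\<sigma> w \<theta>) \<noteq> 0" using hf r by (auto simp: dvd_def pderiv_mult)
    then obtain b where b: "b \<noteq> \<sigma> w \<theta>" "poly ?h b = 0"
      using second_root[of ?h "\<sigma> w \<theta>"] r deg by (auto simp: not_less)
    have "poly (map_poly of_rat f) b = 0" using hf b(2) by (auto simp: dvd_def)
    then obtain j where j: "j < d" "\<sigma> j \<theta> = b" using root_\<sigma> by blast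
    obtain k where "map_poly of_rat (rep \<alpha>) - [:\<sigma> w \<alpha>:] = ?h * k" using hq by (rule dvdE)
    then have "poly (map_poly of_rat (rep \<alpha>) - [:\<sigma> w \<alpha>:]) b = 0" by (simp only: poly_mult b(2) mult_zero_left)
    then have "poly (map_poly of_rat (rep \<alpha>)) (\<sigma> j \<theta>) = \<sigma> w \<alpha>" using j by simp
    then have "\<sigma> j \<alpha> = \<sigma> w \<alpha>" using \<sigma>_simps(13)[OF j(1), of "rep \<alpha>" \<theta>] by (simp add: rep(1))
    moreover have "j \<noteq> w" using j b by auto
    ultimately show False using sep j by blast
  qed
  then have \<theta>: "\<theta> \<in> F" by (rule linear_minimal_poly[OF F h(1-3)])
  have "\<theta> ^ k \<in> F" for k using F \<theta> by (induction k) (auto simp: field_subsetD)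
  then have "x \<in> F" for x
    by (subst rep_sum) (use F in \<open>auto intro!: field_subset_sum simp: field_subsetD\<close>)
  then show ?thesis by auto
qed

section \<open>The matrix of embeddings; characteristic polynomial, norm and trace\<close>

definition rat_spanning :: "(nat \<Rightarrow> 'a) \<Rightarrow> bool" where
  "rat_spanning b \<longleftrightarrow> (\<forall>x. \<exists>c. x = (\<Sum>j<d. of_rat (c j) * b j))"

text \<open>For an integral basis \<open>b\<close> the square of its determinant is the
  discriminant. Its inverse recovers rational coordinates from the complex conjugates.\<close>

definition embedding_mat :: "(nat \<Rightarrow> 'a) \<Rightarrow> complex mat" where
  "embedding_mat b = Matrix.mat d d (\<lambda>(i, j). \<sigma> i (b j))"

lemma embedding_mat_carrier [simp]: "embedding_mat b \<in> carrier_mat d d"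
  by (simp add: embedding_mat_def)

lemma power_basis_spanning: "rat_spanning (\<lambda>j. \<theta> ^ j)"
  unfolding rat_spanning_def
proof
  fix x
  show "\<exists>c. x = (\<Sum>j<d. of_rat (c j) * \<theta> ^ j)"
    by (rule exI[of _ "\<lambda>j. coeff (rep x) j"]) (rule rep_sum)
qed

text \<open>A relation tested on the powers of \<theta> extends by linearity to
  \<open>\<Sum>i<d. v i * q(\<sigma> i \<theta>) = 0\<close> for every complex polynomial
  \<open>q\<close>. One that vanishes at all conjugates of \<theta> except the \<open>k\<close>-th
  isolates \<open>v k\<close>.\<close>

lemma embeddings_independent:
  assumes "\<And>x. (\<Sum>i<d. v i * \<sigma> i x) = 0" and "k < d"
  shows "v k = 0"
proof -
  have *: "(\<Sum>i<d. v i * poly q (\<sigma> i \<theta>)) = 0" for q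
  proof -
    have "(\<Sum>i<d. v i * poly q (\<sigma> i \<theta>)) = (\<Sum>i<d. \<Sum>m\<le>degree q. coeff q m * (v i * \<sigma> i \<theta> ^ m))"
      by (simp add: poly_altdef sum_distrib_left mult_ac)
    also have "\<dots> = (\<Sum>m\<le>degree q. coeff q m * (\<Sum>i<d. v i * \<sigma> i (\<theta> ^ m)))"
      by (subst sum.swap) (simp add: sum_distrib_left \<sigma>_simps)
    also have "\<dots> = 0" by (simp add: assms(1))
    finally show ?thesis .
  qed
  define q where "q = (\<Prod>j\<in>{..<d} - {k}. [:- \<sigma> j \<theta>, 1:])"
  have q0: "poly q (\<sigma> i \<theta>) = 0" if "i < d" "i \<noteq> k" for i
    using that unfolding q_def poly_prod by (intro prod_zero) auto
  have qk: "poly q (\<sigma> k \<theta>) \<noteq> 0"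
    using \<sigma>_inj[of k] assms(2) unfolding q_def poly_prod by (auto simp: prod_zero_iff)
  have "0 = (\<Sum>i<d. v i * poly q (\<sigma> i \<theta>))" using *[of q] by simp
  also have "\<dots> = v k * poly q (\<sigma> k \<theta>)"
    using assms(2) q0 by (subst sum.remove[of _ k]) (auto intro: sum.neutral)
  finally show ?thesis using qk by simp
qed

lemma det_embedding_mat_nz:
  assumes "rat_spanning b"
  shows "det (embedding_mat b) \<noteq> 0"
proof
  assume "det (embedding_mat b) = 0"
  then have "det (embedding_mat b)\<^sup>T = 0" using det_transpose[OF embedding_mat_carrier] by simp
  then obtain v where v: "v \<in> carrier_vec d" "v \<noteq> 0\<^sub>v d" "(embedding_mat b)\<^sup>T *\<^sub>v v = 0\<^sub>v d"
    using det_0_iff_vec_prod_zero_field[of "(embedding_mat b)\<^sup>T" d] by auto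
  have b: "(\<Sum>i<d. vec_index v i * \<sigma> i (b j)) = 0" if "j < d" for j
  proof -
    have "(\<Sum>i<d. vec_index v i * \<sigma> i (b j)) = vec_index ((embedding_mat b)\<^sup>T *\<^sub>v v) j"
      using that v(1) by (auto simp: embedding_mat_def scalar_prod_def lessThan_atLeast0 intro!: sum.cong)
    then show ?thesis using v(3) that by simp
  qed
  have "(\<Sum>i<d. vec_index v i * \<sigma> i x) = 0" for x
  proof -
    obtain c where x: "x = (\<Sum>j<d. of_rat (c j) * b j)" using assms unfolding rat_spanning_def by blast
    have "(\<Sum>i<d. vec_index v i * \<sigma> i x) = (\<Sum>i<d. \<Sum>j<d. of_rat (c j) * (vec_index v i * \<sigma> i (b j)))"
      unfolding x by (intro sum.cong refl) (simp add: \<sigma>_simps sum_distrib_left mult_ac)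
    also have "\<dots> = (\<Sum>j<d. of_rat (c j) * (\<Sum>i<d. vec_index v i * \<sigma> i (b j)))"
      by (subst sum.swap) (simp add: sum_distrib_left)
    also have "\<dots> = 0" by (simp add: b)
    finally show ?thesis .
  qed
  then have "vec_index v k = 0" if "k < d" for k
    using embeddings_independent[of "\<lambda>i. vec_index v i" k] that by blast
  then have "v = 0\<^sub>v d" using v(1) by (intro eq_vecI) auto
  with v(2) show False by simp
qed

text \<open>\<open>A\<close> is the rational matrix of multiplication by \<open>x\<close> in the
  power basis. The matrix of embeddings diagonalises it, with the \<open>\<sigma> i x\<close> on the
  diagonal, which makes their elementary symmetric functions rational.\<close>

lemma conjugates_rational:
  obtains A :: "rat mat" where "A \<in> carrier_mat d d"
    "map_poly of_rat (char_poly A) = (\<Prod>i<d. [:- \<sigma> i x, 1:])"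
    "(\<Prod>i<d. \<sigma> i x) = of_rat (det A)"
    "(\<Sum>i<d. \<sigma> i x) = of_rat (\<Sum>i<d. A $$ (i, i))"
proof -
  let ?b = "\<lambda>j. \<theta> ^ j"
  have "\<forall>j. \<exists>c. x * ?b j = (\<Sum>k<d. of_rat (c k) * ?b k)"
    using power_basis_spanning unfolding rat_spanning_def by simp
  then obtain m where m: "\<And>j. x * ?b j = (\<Sum>k<d. of_rat (m j k) * ?b k)" by metis
  define A where "A = Matrix.mat d d (\<lambda>(j, k). m j k)"
  let ?A = "map_mat of_rat A :: complex mat"
  define T where "T = (embedding_mat ?b)\<^sup>T"
  define D where "D = Matrix.mat d d (\<lambda>(i, j). if i = j then \<sigma> i x else 0)"
  have A: "A \<in> carrier_mat d d" and A': "?A \<in> carrier_mat d d" and T: "T \<in> carrier_mat d d" and D: "D \<in> carrier_mat d d"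
    by (simp_all add: A_def T_def D_def)
  have T_index: "T $$ (j, i) = \<sigma> i (?b j)" if "j < d" "i < d" for i j
    using that by (simp add: T_def embedding_mat_def)
  have dT: "det T \<noteq> 0"
    unfolding T_def using det_embedding_mat_nz[OF power_basis_spanning] det_transpose[OF embedding_mat_carrier] by metis
  obtain Q where Q: "Q \<in> carrier_mat d d" "Q * T = 1\<^sub>m d" "T * Q = 1\<^sub>m d"
    using det_non_zero_imp_unit[OF T dT, of undefined] by (auto simp: Units_def ring_mat_def)
  \<comment> \<open>Column \<open>i\<close> of \<open>T\<close> lists the conjugates
    \<open>\<sigma> i (\<theta> ^ j)\<close>. It is an eigenvector for \<open>\<sigma> i x\<close>:
    apply \<open>\<sigma> i\<close> to the expansion of \<open>x * \<theta> ^ j\<close>.\<close>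
  have AT: "?A * T = T * D"
  proof (rule eq_matI)
    fix j i assume "j < dim_row (T * D)" "i < dim_col (T * D)"
    then have ij: "j < d" "i < d" using T D by auto
    have "(?A * T) $$ (j, i) = (\<Sum>k<d. of_rat (m j k) * \<sigma> i (?b k))"
      using ij T by (auto simp: A_def scalar_prod_def lessThan_atLeast0 T_index intro!: sum.cong)
    also have "\<dots> = \<sigma> i (x * ?b j)" unfolding m using ij by (simp add: \<sigma>_simps del: power_Suc)
    also have "\<dots> = \<sigma> i (?b j) * \<sigma> i x" using ij by (simp add: \<sigma>_simps)
    also have "\<dots> = (\<Sum>k<d. if k = i then \<sigma> i (?b j) * \<sigma> i x else 0)" using ij by simp
    also have "\<dots> = (\<Sum>k<d. T $$ (j, k) * D $$ (k, i))"
      using ij by (intro sum.cong) (auto simp: T_index D_def)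
    also have "\<dots> = (T * D) $$ (j, i)"
      using ij T D by (auto simp: scalar_prod_def lessThan_atLeast0 intro!: sum.cong)
    finally show "(?A * T) $$ (j, i) = (T * D) $$ (j, i)" .
  qed (use T D A' in auto)
  have eq: "?A = T * D * Q"
  proof -
    have "T * D * Q = ?A * (T * Q)" unfolding AT[symmetric] using A' T Q by (simp add: assoc_mult_mat[of _ d d _ d _ d])
    then show ?thesis using A' by (simp only: Q(3)) simp
  qed
  have sim: "similar_mat ?A D"
    unfolding similar_mat_def similar_mat_wit_def Let_def
    by (intro exI[of _ T] exI[of _ Q]) (use A' T D Q eq in auto)
  have utD: "upper_triangular D" by (auto simp: D_def upper_triangular_def)
  have dD: "diag_mat D = map (\<lambda>i. \<sigma> i x) [0..<d]" by (auto simp: diag_mat_def D_def)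
  have "map_poly of_rat (char_poly A) = char_poly ?A" by (rule of_rat_hom.char_poly_hom[OF A, symmetric])
  also have "\<dots> = char_poly D" by (rule char_poly_similar[OF sim])
  also have "\<dots> = (\<Prod>i<d. [:- \<sigma> i x, 1:])"
    unfolding char_poly_upper_triangular[OF D utD] dD
    by (simp add: prod.list_conv_set_nth lessThan_atLeast0 comp_def)
  finally have 1: "map_poly of_rat (char_poly A) = (\<Prod>i<d. [:- \<sigma> i x, 1:])" .
  have "of_rat (det A) = det ?A" by (rule of_rat_hom.hom_det[symmetric])
  also have "\<dots> = det D" by (rule det_similar[OF sim])
  also have "\<dots> = (\<Prod>i<d. \<sigma> i x)"
    unfolding det_upper_triangular[OF utD D] dD by (simp add: prod.list_conv_set_nth lessThan_atLeast0)
  finally have 2: "(\<Prod>i<d. \<sigma> i x) = of_rat (det A)" ..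
  \<comment> \<open>Invariance of the trace under similarity, by exchanging the two sums and using
    \<open>Q * T = 1\<close>.\<close>
  have "of_rat (\<Sum>i<d. A $$ (i, i)) = (\<Sum>j<d. ?A $$ (j, j))"
    using A by (simp add: of_rat_sum)
  also have "\<dots> = (\<Sum>j<d. \<Sum>i<d. T $$ (j, i) * \<sigma> i x * Q $$ (i, j))"
  proof (rule sum.cong[OF refl])
    fix j assume "j \<in> {..<d}"
    then have j: "j < d" by simp
    have TD: "(T * D) $$ (j, i) = T $$ (j, i) * \<sigma> i x" if "i < d" for i
    proof -
      have "(T * D) $$ (j, i) = (\<Sum>k<d. T $$ (j, k) * D $$ (k, i))"
        using j that T D by (auto simp: scalar_prod_def lessThan_atLeast0 intro!: sum.cong)
      also have "\<dots> = (\<Sum>k<d. if k = i then T $$ (j, i) * \<sigma> i x else 0)"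
        using that by (intro sum.cong) (auto simp: D_def)
      finally show ?thesis using that by simp
    qed
    define P where "P = T * D"
    have "P \<in> carrier_mat d d" using T D by (simp add: P_def)
    then have "(P * Q) $$ (j, j) = (\<Sum>i<d. P $$ (j, i) * Q $$ (i, j))"
      using j Q(1) by (auto simp: scalar_prod_def lessThan_atLeast0 intro!: sum.cong)
    then have "?A $$ (j, j) = (\<Sum>i<d. (T * D) $$ (j, i) * Q $$ (i, j))" unfolding eq P_def .
    then show "?A $$ (j, j) = (\<Sum>i<d. T $$ (j, i) * \<sigma> i x * Q $$ (i, j))" by (simp add: TD)
  qed
  also have "\<dots> = (\<Sum>i<d. \<sigma> i x * (\<Sum>j<d. Q $$ (i, j) * T $$ (j, i)))"
    by (subst sum.swap) (simp add: sum_distrib_left mult_ac)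
  also have "\<dots> = (\<Sum>i<d. \<sigma> i x)"
  proof (rule sum.cong[OF refl])
    fix i assume i: "i \<in> {..<d}"
    have "(\<Sum>j<d. Q $$ (i, j) * T $$ (j, i)) = (Q * T) $$ (i, i)"
      using i Q(1) T by (auto simp: scalar_prod_def lessThan_atLeast0 intro!: sum.cong)
    then show "\<sigma> i x * (\<Sum>j<d. Q $$ (i, j) * T $$ (j, i)) = \<sigma> i x" using i by (simp add: Q(2))
  qed
  finally have 3: "(\<Sum>i<d. \<sigma> i x) = of_rat (\<Sum>i<d. A $$ (i, i))" ..
  from A 1 2 3 show thesis by (rule that)
qed

lemma algebraic_int_\<sigma>:
  assumes "algebraic_int x" "i < d"
  shows "algebraic_int (\<sigma> i x)"
proof -
  interpret s: field_char_0_hom "\<sigma> i" using assms(2) by (rule hom_\<sigma>)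
  obtain p where p: "poly (map_poly of_int p) x = 0" "lead_coeff p = 1"
    using assms(1) by (auto simp: algebraic_int_altdef_ipoly)
  have "map_poly (\<sigma> i) (map_poly of_int p) = map_poly of_int p"
    by (simp add: map_poly_map_poly comp_def s.hom_of_int)
  then have "poly (map_poly of_int p) (\<sigma> i x) = 0"
    using s.poly_map_poly[of "map_poly of_int p" x] p(1) by simp
  then show ?thesis using p(2) by (auto simp: algebraic_int_altdef_ipoly)
qed

text \<open>The product of the conjugates is rational and an algebraic integer, hence a nonzero
  integer.\<close>

lemma norm_ge_1:
  assumes x: "algebraic_int x" "x \<noteq> 0"
  shows "(\<Prod>i<d. cmod (\<sigma> i x)) \<ge> 1"
proof -
  obtain A :: "rat mat" where A: "(\<Prod>i<d. \<sigma> i x) = of_rat (det A)" using conjugates_rational[of x] by blast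
  have "algebraic_int (\<Prod>i<d. \<sigma> i x)" using x by (intro algebraic_int_prod algebraic_int_\<sigma>) auto
  then have "(\<Prod>i<d. \<sigma> i x) \<in> \<int>" using A by (intro rational_algebraic_int_is_int) auto
  then obtain k where k: "(\<Prod>i<d. \<sigma> i x) = of_int k" by (elim Ints_cases)
  have "(\<Prod>i<d. \<sigma> i x) \<noteq> 0" using x \<sigma>_simps(10) by (auto simp: prod_zero_iff)
  then have "k \<noteq> 0" using k by auto
  then have "cmod (of_int k) \<ge> 1" by (simp add: norm_of_int)
  then show ?thesis using k by (simp add: prod_norm)
qed

text \<open>Connects the definition of \<open>totally_real\<close> with embeddings. The irreducible
  \<open>p\<close> shares the root \<open>\<sigma> 0 x\<close> with the characteristic polynomial of
  \<open>x\<close>, so it divides it, and all roots of that polynomial are values of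
  embeddings.\<close>

lemma conjugate_eq_embedding:
  assumes "conjugate_over_rat x z"
  shows "\<exists>i<d. \<sigma> i x = z"
proof -
  obtain p :: "rat poly" where p: "irreducible p" "poly (map_poly of_rat p) x = 0" "poly (map_poly of_rat p) z = 0"
    using assms unfolding conjugate_over_rat_def by blast
  obtain A :: "rat mat" where A: "map_poly of_rat (char_poly A) = (\<Prod>i<d. [:- \<sigma> i x, 1:])"
    using conjugates_rational[of x] by blast
  let ?g = "char_poly A"
  have root: "poly (map_poly of_rat ?g) y = 0 \<longleftrightarrow> (\<exists>i<d. \<sigma> i x = y)" for y
    unfolding A poly_prod by (auto simp: prod_zero_iff)
  have d0: "0 < d" by (rule degree_pos)
  have "p dvd ?g"
  proof (rule ccontr)
    assume "\<not> p dvd ?g"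
    then have "coprime p ?g" by (rule prime_elem_imp_coprime[OF irreducible_imp_prime_elem[OF p(1)]])
    then have "gcd p ?g = 1" by (simp add: coprime_iff_gcd_eq_1)
    with bezout_coefficients_fst_snd[of p ?g] obtain u v where "u * p + v * ?g = 1" by metis
    then have "poly (map_poly of_rat (u * p + v * ?g)) (\<sigma> 0 x) = (1 :: complex)" by simp
    moreover have "poly (map_poly of_rat p) (\<sigma> 0 x) = 0"
      using \<sigma>_simps(13)[OF d0, of p x] p(2) \<sigma>_simps(3)[OF d0] by simp
    moreover have "poly (map_poly of_rat ?g) (\<sigma> 0 x) = 0" using root d0 by blast
    ultimately show False by (simp add: of_rat_poly_hom.hom_add of_rat_poly_hom.hom_mult)
  qed
  then obtain k where "?g = p * k" by (rule dvdE)
  then have "poly (map_poly of_rat ?g) z = 0" using p(3) by (simp add: of_rat_poly_hom.hom_mult)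
  then show ?thesis using root by blast
qed

end

section \<open>Integral bases and the discriminant\<close>

lemma common_denominator:
  fixes q :: "'i \<Rightarrow> rat"
  assumes "finite I"
  shows "\<exists>N::nat. N > 0 \<and> (\<forall>i\<in>I. of_nat N * q i \<in> \<int>)"
  using assms
proof (induction I)
  case empty
  then show ?case by (intro exI[of _ 1]) simp
next
  case (insert i I)
  then obtain N where N: "N > 0" "\<forall>i\<in>I. of_nat N * q i \<in> \<int>" by blast
  obtain a b where ab: "quotient_of (q i) = (a, b)" by (cases "quotient_of (q i)") auto
  have b: "b > 0" using quotient_of_denom_pos[OF ab] .
  have "of_nat (nat b) * q i = of_int a"
    using quotient_of_div[OF ab] b by (simp add: field_simps)
  then have "of_nat (nat b) * q i \<in> \<int>" by simp
  then have "of_nat N * (of_nat (nat b) * q i) \<in> \<int>" by (rule Ints_mult[OF Ints_of_nat])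
  moreover have "of_nat (nat b) * (of_nat N * q j) \<in> \<int>" if "j \<in> I" for j
    by (rule Ints_mult[OF Ints_of_nat]) (use N(2) that in blast)
  moreover have "of_nat (N * nat b) * q j = of_nat N * (of_nat (nat b) * q j)"
    "of_nat (N * nat b) * q j = of_nat (nat b) * (of_nat N * q j)" for j
    by simp_all
  ultimately have "of_nat (N * nat b) * q j \<in> \<int>" if "j \<in> insert i I" for j
    using that by (cases "j = i") (metis, metis insertE)
  then show ?case using N(1) b by (intro exI[of _ "N * nat b"]) simp
qed

context number_field_embeddings
begin

text \<open>A common denominator of the matrix of multiplication by \<open>x\<close> makes the
  matrix of \<open>N * x\<close> integral, and an eigenvalue of an integral matrix is an algebraic
  integer.\<close>

lemma integral_multiple:
  obtains N :: nat where "N > 0" "algebraic_int (of_nat N * (x :: 'a))"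
proof -
  let ?b = "\<lambda>j. \<theta> ^ j"
  have "\<forall>j. \<exists>c. x * ?b j = (\<Sum>k<d. of_rat (c k) * ?b k)"
    using power_basis_spanning unfolding rat_spanning_def by simp
  then obtain m where m: "\<And>j. x * ?b j = (\<Sum>k<d. of_rat (m j k) * ?b k)" by metis
  obtain N :: nat where N: "N > 0" "\<forall>p\<in>{..<d} \<times> {..<d}. of_nat N * (case p of (j, k) \<Rightarrow> m j k) \<in> \<int>"
    using common_denominator[of "{..<d} \<times> {..<d}" "\<lambda>(j, k). m j k"] by auto
  define z where "z j k = \<lfloor>of_nat N * m j k\<rfloor>" for j k
  have z: "of_nat N * m j k = of_int (z j k)" if "j < d" "k < d" for j k
    using N(2) that by (auto simp: z_def elim!: Ints_cases)
  have "algebraic_int (of_nat N * x)"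
  proof (rule algebraic_int_eigenvalue[where n = d and b = ?b and A = z])
    fix j assume j: "j < d"
    have "of_nat N * x * ?b j = (\<Sum>k<d. of_rat (of_nat N * m j k) * ?b k)"
      using m[of j] by (simp add: mult.assoc sum_distrib_left of_rat_mult)
    also have "\<dots> = (\<Sum>k<d. of_int (z j k) * ?b k)" using z[OF j] by simp
    finally show "of_nat N * x * ?b j = (\<Sum>k<d. of_int (z j k) * ?b k)" .
  next
    show "0 < d" by (rule degree_pos)
  qed simp
  with N(1) show thesis by (rule that)
qed

lemma rat_spanning_independent:
  assumes b: "rat_spanning b" and c: "(\<Sum>j<d. of_rat (c j) * b j) = 0" and k: "k < d"
  shows "c k = 0"
proof -
  let ?E = "embedding_mat b"
  let ?v = "Matrix.vec d (\<lambda>j. of_rat (c j) :: complex)"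
  have "?E *\<^sub>v ?v = 0\<^sub>v d"
  proof (rule eq_vecI)
    fix i assume "i < dim_vec (0\<^sub>v d :: complex Matrix.vec)"
    then have i: "i < d" by simp
    have "vec_index (?E *\<^sub>v ?v) i = (\<Sum>j<d. \<sigma> i (of_rat (c j) * b j))"
      using i by (auto simp: embedding_mat_def scalar_prod_def lessThan_atLeast0 \<sigma>_simps mult.commute intro!: sum.cong)
    also have "\<dots> = \<sigma> i (\<Sum>j<d. of_rat (c j) * b j)" using i by (simp add: \<sigma>_simps)
    also have "\<dots> = 0" using i by (simp add: c \<sigma>_simps)
    finally show "vec_index (?E *\<^sub>v ?v) i = vec_index (0\<^sub>v d) i" using i by simp
  qed (simp add: embedding_mat_def)
  then have "?v = 0\<^sub>v d"
    using det_embedding_mat_nz[OF b] det_0_iff_vec_prod_zero_field[OF embedding_mat_carrier, of b]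
    by (metis vec_carrier)
  then have "vec_index ?v k = 0" using k by simp
  then show ?thesis using k by simp
qed

text \<open>The square is the determinant of \<open>E\<^sup>T * E\<close>, the Gram matrix of the
  trace form. Its entries are traces of algebraic integers, and these are integers.\<close>

lemma discriminant_integer:
  assumes "\<And>j. j < d \<Longrightarrow> algebraic_int (b j)"
  shows "\<exists>z::int. (det (embedding_mat b))\<^sup>2 = of_int z"
proof -
  let ?E = "embedding_mat b"
  have tr: "(\<Sum>i<d. \<sigma> i (b j * b k)) \<in> \<int>" if "j < d" "k < d" for j k
  proof (rule rational_algebraic_int_is_int)
    show "algebraic_int (\<Sum>i<d. \<sigma> i (b j * b k))"
      using assms that by (intro algebraic_int_sum algebraic_int_\<sigma> algebraic_int_times) auto
    obtain A :: "rat mat" where "(\<Sum>i<d. \<sigma> i (b j * b k)) = of_rat (\<Sum>i<d. A $$ (i, i))"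
      using conjugates_rational[of "b j * b k"] by blast
    then show "(\<Sum>i<d. \<sigma> i (b j * b k)) \<in> \<rat>" by simp
  qed
  \<comment> \<open>The traces are complex numbers already known to be integers; the floor of the
    real part only recovers them in type \<open>int\<close>.\<close>
  define M where "M = Matrix.mat d d (\<lambda>(j, k). \<lfloor>Re (\<Sum>i<d. \<sigma> i (b j * b k))\<rfloor>)"
  have "?E\<^sup>T * ?E = map_mat of_int M"
  proof (rule eq_matI)
    fix j k assume "j < dim_row (map_mat of_int M :: complex mat)" "k < dim_col (map_mat of_int M :: complex mat)"
    then have jk: "j < d" "k < d" by (simp_all add: M_def)
    have "(?E\<^sup>T * ?E) $$ (j, k) = (\<Sum>i<d. \<sigma> i (b j * b k))"
      using jk by (auto simp: embedding_mat_def scalar_prod_def lessThan_atLeast0 \<sigma>_simps intro!: sum.cong)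
    also have "\<dots> = map_mat of_int M $$ (j, k)"
    proof -
      obtain z where "(\<Sum>i<d. \<sigma> i (b j * b k)) = of_int z" using tr[OF jk] by (rule Ints_cases)
      then show ?thesis using jk by (simp add: M_def del: Re_sum)
    qed
    finally show "(?E\<^sup>T * ?E) $$ (j, k) = map_mat of_int M $$ (j, k)" .
  qed (simp_all add: M_def embedding_mat_def)
  then have "det (?E\<^sup>T * ?E) = of_int (det M)" by simp
  moreover have "det (?E\<^sup>T * ?E) = (det ?E)\<^sup>2"
    using det_mult[of "?E\<^sup>T" d ?E] det_transpose[OF embedding_mat_carrier, of b]
    by (simp add: power2_eq_square)
  ultimately show ?thesis by metis
qed

text \<open>The exchange multiplies the matrix of embeddings by one that differs from the identity
  in a single line, so only the coordinate of \<open>x\<close> at the exchanged element survives in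
  the determinant.\<close>

lemma det_embedding_mat_update:
  assumes k: "k < d" and x: "x = (\<Sum>j<d. of_rat (c j) * b j)"
  shows "det (embedding_mat (b(k := x))) = of_rat (c k) * det (embedding_mat b)"
proof -
  define C where "C = Matrix.mat d d (\<lambda>(i, j). if i = k then of_rat (c j) else if j = i then 1 else (0 :: complex))"
  have C: "C \<in> carrier_mat d d" by (simp add: C_def)
  have "embedding_mat (b(k := x)) = embedding_mat b * C\<^sup>T"
  proof (rule eq_matI)
    fix i l assume "i < dim_row (embedding_mat b * C\<^sup>T)" "l < dim_col (embedding_mat b * C\<^sup>T)"
    then have il: "i < d" "l < d" by (simp_all add: C_def embedding_mat_def)
    have "(embedding_mat b * C\<^sup>T) $$ (i, l) = (\<Sum>j<d. \<sigma> i (b j) * C $$ (l, j))"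
      using il C by (auto simp: embedding_mat_def scalar_prod_def lessThan_atLeast0 intro!: sum.cong)
    also have "\<dots> = \<sigma> i ((b(k := x)) l)"
    proof (cases "l = k")
      case True
      then show ?thesis using il by (simp add: C_def x \<sigma>_simps mult.commute)
    next
      case False
      then have "(\<Sum>j<d. \<sigma> i (b j) * C $$ (l, j)) = (\<Sum>j<d. if j = l then \<sigma> i (b j) else 0)"
        using il by (intro sum.cong) (auto simp: C_def)
      then show ?thesis using False il by simp
    qed
    finally show "embedding_mat (b(k := x)) $$ (i, l) = (embedding_mat b * C\<^sup>T) $$ (i, l)"
      using il by (simp add: embedding_mat_def)
  qed (simp_all add: C_def embedding_mat_def)
  then have "det (embedding_mat (b(k := x))) = det (embedding_mat b) * det C"
    using C det_transpose[OF C] det_mult[of "embedding_mat b" d "C\<^sup>T"] by simp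
  also have "det C = C $$ (k, k)" by (rule det_one_row_matrix[OF C k]) (simp add: C_def)
  also have "C $$ (k, k) = of_rat (c k)" using k by (simp add: C_def)
  finally show ?thesis by (simp only: mult.commute)
qed

lemma rat_spanning_update:
  assumes b: "rat_spanning b" and k: "k < d" and x: "x = (\<Sum>j<d. of_rat (c j) * b j)" and ck: "c k \<noteq> 0"
  shows "rat_spanning (b(k := x))"
  unfolding rat_spanning_def
proof
  fix y
  obtain a where y: "y = (\<Sum>j<d. of_rat (a j) * b j)" using b unfolding rat_spanning_def by blast
  let ?J = "{..<d} - {k}"
  have split: "(\<Sum>j<d. u j) = u k + (\<Sum>j\<in>?J. u j)" for u :: "nat \<Rightarrow> 'a"
    using k by (simp add: sum.remove)
  \<comment> \<open>Solve the expansion of \<open>x\<close> for \<open>b k\<close>, which is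
    possible as \<open>c k \<noteq> 0\<close>, and substitute the result into the expansion of
    \<open>y\<close>.\<close>
  define e where "e = (\<lambda>j. if j = k then a k / c k else a j - a k / c k * c j)"
  have "(\<Sum>j<d. of_rat (e j) * (b(k := x)) j)
      = of_rat (a k / c k) * x + (\<Sum>j\<in>?J. of_rat (a j) * b j - of_rat (a k / c k) * (of_rat (c j) * b j))"
    unfolding split by (simp add: e_def) (intro sum.cong; simp add: of_rat_diff of_rat_mult of_rat_divide algebra_simps)
  also have "\<dots> = of_rat (a k / c k) * (x - (\<Sum>j\<in>?J. of_rat (c j) * b j)) + (\<Sum>j\<in>?J. of_rat (a j) * b j)"
    by (simp add: sum_subtractf sum_distrib_left algebra_simps)
  also have "x - (\<Sum>j\<in>?J. of_rat (c j) * b j) = of_rat (c k) * b k" unfolding x split by simp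
  also have "of_rat (a k / c k) * (of_rat (c k) * b k) = of_rat (a k) * b k"
    using ck by (simp add: of_rat_divide)
  finally have "y = (\<Sum>j<d. of_rat (e j) * (b(k := x)) j)" unfolding y split[of "\<lambda>j. of_rat (a j) * b j"] by simp
  then show "\<exists>c. y = (\<Sum>j<d. of_rat (c j) * (b(k := x)) j)" by (rule exI[of _ e])
qed

lemma integral_rat_spanning_exists:
  "\<exists>b. (\<forall>j<d. algebraic_int (b j)) \<and> rat_spanning b"
proof -
  have "\<exists>N::nat. N > 0 \<and> algebraic_int (of_nat N * \<theta> ^ j)" for j
  proof -
    obtain M :: nat where "M > 0" "algebraic_int (of_nat M * \<theta> ^ j)" by (rule integral_multiple)
    then show ?thesis by (intro exI[of _ M] conjI)
  qed
  then obtain N :: "nat \<Rightarrow> nat" where N: "\<And>j. N j > 0" "\<And>j. algebraic_int (of_nat (N j) * \<theta> ^ j)" by metis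
  have N0: "N j \<noteq> 0" for j using N(1)[of j] by simp
  have "rat_spanning (\<lambda>j. of_nat (N j) * \<theta> ^ j)"
    unfolding rat_spanning_def
  proof
    fix x
    have "of_rat (coeff (rep x) j / of_nat (N j)) * (of_nat (N j) * \<theta> ^ j) = of_rat (coeff (rep x) j) * \<theta> ^ j" for j
      using N0[of j] by (simp add: of_rat_divide)
    then have "x = (\<Sum>j<d. of_rat (coeff (rep x) j / of_nat (N j)) * (of_nat (N j) * \<theta> ^ j))"
      using rep_sum[of x] by (simp only:)
    then show "\<exists>c. x = (\<Sum>j<d. of_rat (c j) * (of_nat (N j) * \<theta> ^ j))"
      by (rule exI[of _ "\<lambda>j. coeff (rep x) j / of_nat (N j)"])
  qed
  with N(2) show ?thesis by (intro exI[of _ "\<lambda>j. of_nat (N j) * \<theta> ^ j"]) simp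
qed

text \<open>Among spanning families of algebraic integers choose one whose discriminant, an integer,
  has least modulus. If an algebraic integer had a non-integral \<open>k\<close>-th coordinate,
  subtracting an integer multiple of \<open>b k\<close> would leave an algebraic integer with that
  coordinate in \<open>(0, 1)\<close>. Exchanging it for \<open>b k\<close> would multiply the
  discriminant by the square of the coordinate.\<close>

lemma integral_basis_exists: "\<exists>\<omega> :: nat \<Rightarrow> 'a. integral_basis \<omega>"
proof -
  define P where "P n b \<longleftrightarrow> (\<forall>j<d. algebraic_int (b j)) \<and> rat_spanning b \<and> cmod ((det (embedding_mat b))\<^sup>2) = real n"
    for n :: nat and b
  have P_ex: "\<exists>n. P n b" if "\<forall>j<d. algebraic_int (b j)" "rat_spanning b" for b
  proof -
    have "\<exists>z::int. (det (embedding_mat b))\<^sup>2 = of_int z"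
      by (rule discriminant_integer) (use that(1) in simp)
    then obtain z :: int where "(det (embedding_mat b))\<^sup>2 = of_int z" ..
    then have "cmod ((det (embedding_mat b))\<^sup>2) = real (nat \<bar>z\<bar>)" by (simp add: norm_of_int)
    then have "P (nat \<bar>z\<bar>) b" using that unfolding P_def by simp
    then show ?thesis ..
  qed
  define n where "n = (LEAST n. \<exists>b. P n b)"
  obtain b0 where "\<forall>j<d. algebraic_int (b0 j)" "rat_spanning b0" using integral_rat_spanning_exists by (elim exE conjE)
  from P_ex[OF this] have "\<exists>n b. P n b" by (elim exE) (intro exI)
  then have "\<exists>b. P n b" unfolding n_def by (rule LeastI_ex)
  then obtain b where b: "P n b" by blast
  have least: "n \<le> m" if "P m b'" for m b' unfolding n_def by (rule Least_le) (rule exI, rule that)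
  have bi: "\<And>j. j < d \<Longrightarrow> algebraic_int (b j)" and bs: "rat_spanning b" using b unfolding P_def by auto
  have integral: "c k \<in> \<int>" if x: "algebraic_int x" "x = (\<Sum>j<d. of_rat (c j) * b j)" and k: "k < d" for x c k
  proof (rule ccontr)
    assume "c k \<notin> \<int>"
    define c' where "c' = c(k := frac (c k))"
    define y where "y = x - of_int \<lfloor>c k\<rfloor> * b k"
    have fr: "0 < frac (c k)" "frac (c k) < 1" using \<open>c k \<notin> \<int>\<close> by (simp_all add: frac_gt_0_iff frac_lt_1)
    have "of_rat (of_int \<lfloor>c k\<rfloor>) = (of_int \<lfloor>c k\<rfloor> :: 'a)" by simp
    then have "of_rat (frac (c k)) = of_rat (c k) - (of_int \<lfloor>c k\<rfloor> :: 'a)" unfolding frac_def of_rat_diff by simp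
    then have "of_rat (c k) * b k - of_int \<lfloor>c k\<rfloor> * b k = of_rat (frac (c k)) * b k"
      by (simp add: left_diff_distrib)
    then have y: "y = (\<Sum>j<d. of_rat (c' j) * b j)"
      unfolding y_def x(2) c'_def using k by (simp add: sum.remove)
    have "algebraic_int y" unfolding y_def diff_conv_add_uminus
      by (intro algebraic_int_plus x(1) algebraic_int_minus algebraic_int_times algebraic_int_of_int bi k)
    then have "\<forall>j<d. algebraic_int ((b(k := y)) j)" using bi by simp
    moreover have "rat_spanning (b(k := y))"
      by (rule rat_spanning_update[OF bs k y]) (use fr in \<open>simp add: c'_def\<close>)
    ultimately obtain m where m: "P m (b(k := y))" using P_ex by blast
    have "real m = cmod ((of_rat (frac (c k)))\<^sup>2) * real n"
      using m b det_embedding_mat_update[OF k y] unfolding P_def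
      by (simp add: c'_def power_mult_distrib norm_mult)
    also have "cmod ((of_rat (frac (c k)))\<^sup>2) = (real_of_rat (frac (c k)))\<^sup>2"
    proof -
      have "(of_rat (frac (c k)) :: complex) = of_real (of_rat (frac (c k)))"
        by (rule of_real_hom.hom_of_rat[symmetric])
      then show ?thesis by (simp only: norm_power norm_of_real power2_abs)
    qed
    also have "(real_of_rat (frac (c k)))\<^sup>2 * real n < 1 * real n"
    proof (rule mult_strict_right_mono)
      show "(real_of_rat (frac (c k)))\<^sup>2 < 1" using fr by (simp add: power_less_one_iff abs_square_less_1)
      show "real n > 0" 
      proof -
        have "real n = cmod ((det (embedding_mat b))\<^sup>2)" using b unfolding P_def by simp
        then show ?thesis using det_embedding_mat_nz[OF bs] by (simp only: zero_less_norm_iff) simp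
      qed
    qed
    finally show False using least[OF m] by simp
  qed
  have "integral_basis b"
    unfolding integral_basis_def field_degree_eq
  proof (intro conjI allI impI)
    fix j assume "j < d" then show "algebraic_int (b j)" by (rule bi)
  next
    fix x :: 'a assume x: "algebraic_int x"
    obtain c where c: "x = (\<Sum>j<d. of_rat (c j) * b j)" using bs unfolding rat_spanning_def by blast
    \<comment> \<open>Restricted to \<open>{..<d}\<close> because \<open>integral_basis\<close> asks
      for uniqueness among extensional coefficient functions.\<close>
    define z where "z = (\<lambda>j\<in>{..<d}. \<lfloor>c j\<rfloor>)"
    have z: "of_rat (c j) = (of_int (z j) :: 'a)" if "j < d" for j
      using integral[OF x c that] that by (auto simp: z_def elim!: Ints_cases)
    show "\<exists>!c. c \<in> {..<d} \<rightarrow>\<^sub>E UNIV \<and> x = (\<Sum>i<d. of_int (c i) * b i)"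
    proof (rule ex1I[of _ z])
      show "z \<in> {..<d} \<rightarrow>\<^sub>E UNIV \<and> x = (\<Sum>i<d. of_int (z i) * b i)"
        unfolding c using z by (auto simp: z_def)
    next
      fix e assume e: "e \<in> {..<d} \<rightarrow>\<^sub>E (UNIV :: int set) \<and> x = (\<Sum>i<d. of_int (e i) * b i)"
      have "(\<Sum>j<d. of_rat (of_int (e j) - c j) * b j) = 0"
        using e c by (simp add: of_rat_diff algebra_simps sum_subtractf)
      then have "of_int (e j) - c j = 0" if "j < d" for j
        by (rule rat_spanning_independent[OF bs, of "\<lambda>j. of_int (e j) - c j"]) (rule that)
      then have "c j = of_int (e j)" if "j < d" for j using that by simp
      then have "e j = z j" if "j < d" for j using that by (simp add: z_def)
      then show "e = z" using e by (auto simp: fun_eq_iff z_def PiE_def extensional_def)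
    qed
  qed
  then show ?thesis by blast
qed

lemma integral_basis_spanning:
  assumes \<omega>: "integral_basis \<omega>"
  shows "rat_spanning \<omega>"
  unfolding rat_spanning_def
proof
  fix x :: 'a
  obtain N :: nat where N: "N > 0" "algebraic_int (of_nat N * x)" by (rule integral_multiple)
  then obtain c :: "nat \<Rightarrow> int" where "of_nat N * x = (\<Sum>i<d. of_int (c i) * \<omega> i)"
    using \<omega> unfolding integral_basis_def field_degree_eq by blast
  then have "x = (\<Sum>i<d. of_int (c i) * \<omega> i) / of_nat N" using N(1) by (simp add: field_simps)
  also have "\<dots> = (\<Sum>j<d. of_rat (of_int (c j) / of_nat N) * \<omega> j)"
    by (simp add: sum_divide_distrib of_rat_divide)
  finally show "\<exists>c. x = (\<Sum>j<d. of_rat (c j) * \<omega> j)"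
    by (rule exI[of _ "\<lambda>j. of_int (c j) / of_nat N"])
qed

end

context primitive_element
begin

text \<open>With the existence of integral bases and of embeddings the choice in
  \<open>discriminant\<close> is meaningful. The basis and the enumeration behind the chosen value
  are kept for the rest of the argument.\<close>

lemma discriminant_witness:
  obtains \<omega> :: "nat \<Rightarrow> 'a" and \<sigma> where "integral_basis \<omega>" "enumerates_embeddings \<sigma>"
    "discriminant TYPE('a) = (det (Matrix.mat (degree f) (degree f) (\<lambda>(i, j). \<sigma> i (\<omega> j))))\<^sup>2"
proof -
  obtain \<sigma> :: "nat \<Rightarrow> 'a \<Rightarrow> complex" where \<sigma>: "enumerates_embeddings \<sigma>"
    using enumerates_embeddings_exists by blast
  interpret number_field_embeddings \<theta> f \<sigma> by unfold_locales (rule \<sigma>)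
  obtain \<omega> :: "nat \<Rightarrow> 'a" where \<omega>: "integral_basis \<omega>" using integral_basis_exists by blast
  have "\<exists>D (\<omega> :: nat \<Rightarrow> 'a) \<sigma>. integral_basis \<omega> \<and> enumerates_embeddings \<sigma> \<and>
     D = (det (Matrix.mat (field_degree TYPE('a)) (field_degree TYPE('a)) (\<lambda>(i, j). \<sigma> i (\<omega> j))))\<^sup>2"
    using \<omega> \<sigma> by blast
  then have "\<exists>(\<omega> :: nat \<Rightarrow> 'a) \<sigma>. integral_basis \<omega> \<and> enumerates_embeddings \<sigma> \<and>
     discriminant TYPE('a) = (det (Matrix.mat (field_degree TYPE('a)) (field_degree TYPE('a)) (\<lambda>(i, j). \<sigma> i (\<omega> j))))\<^sup>2"
    unfolding discriminant_def by (rule someI_ex)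
  then show thesis unfolding field_degree_eq by (elim exE conjE) (rule that)
qed

end

section \<open>Archimedean places\<close>

lemma Cauchy_norm_iff:
  fixes u :: "nat \<Rightarrow> 'b :: real_normed_field"
  shows "(\<forall>e>0. \<exists>N. \<forall>m\<ge>N. \<forall>n\<ge>N. norm (u m - u n) < e) \<longleftrightarrow> Cauchy u"
  by (simp add: Cauchy_def dist_norm)

text \<open>Taking limits along \<open>s\<close> identifies the completion with \<open>'b\<close> and the closure of \<open>\<rat>\<close> with \<open>\<real>\<close>.\<close>
lemma local_degree_eq_dimension:
  fixes s :: "'a :: field_char_0 \<Rightarrow> 'b :: {real_normed_field, banach}"
  assumes s: "field_char_0_hom s" and v: "v = (\<lambda>x. norm (s x))"
    and dense: "\<And>z. \<exists>f. (\<lambda>n. s (f n)) \<longlonglongrightarrow> z"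
    and dim: "ring.dimension (ring_of_type_algebra :: 'b ring) n (range of_real) UNIV"
  shows "local_degree v = n"
proof -
  interpret s: field_char_0_hom s by (rule s)
  let ?S = "cauchy_ring v" and ?T = "ring_of_type_algebra :: 'b ring"
  have ring_T: "ring ?T" by (rule ring_from_type_algebra)
  \<comment> \<open>Since \<open>'b\<close> is complete, Cauchy sequences for \<open>v\<close> are
    those whose images under \<open>s\<close> converge.\<close>
  have carrier: "f \<in> carrier ?S \<longleftrightarrow> convergent (\<lambda>n. s (f n))" for f
    unfolding cauchy_ring_def v by (simp add: Cauchy_norm_iff s.hom_minus[symmetric] Cauchy_convergent_iff[symmetric] flip: Cauchy_norm_iff)
  have ops: "f \<oplus>\<^bsub>?S\<^esub> g = (\<lambda>n. f n + g n)" "f \<otimes>\<^bsub>?S\<^esub> g = (\<lambda>n. f n * g n)"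
    "\<one>\<^bsub>?S\<^esub> = (\<lambda>_. 1)" "\<zero>\<^bsub>?S\<^esub> = (\<lambda>_. 0)" for f g
    by (simp_all add: cauchy_ring_def)
  have ring_S: "ring ?S"
  proof (rule ringI)
    show "abelian_group ?S"
    proof (rule abelian_groupI)
      fix f assume f: "f \<in> carrier ?S"
      have "(\<lambda>n. - f n) \<in> carrier ?S"
        using f unfolding carrier by (simp add: s.hom_uminus convergent_minus_iff[symmetric])
      then show "\<exists>g\<in>carrier ?S. g \<oplus>\<^bsub>?S\<^esub> f = \<zero>\<^bsub>?S\<^esub>"
        by (rule bexI[rotated]) (simp add: ops)
    qed (auto simp: carrier ops s.hom_add fun_eq_iff convergent_const intro: convergent_add)
    show "Group.monoid ?S"
      by (rule monoidI) (auto simp: carrier ops s.hom_mult fun_eq_iff convergent_const intro: convergent_mult)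
  qed (auto simp: ops fun_eq_iff algebra_simps)
  define L where "L f = lim (\<lambda>n. s (f n))" for f
  have L: "(\<lambda>n. s (f n)) \<longlonglongrightarrow> L f" if "f \<in> carrier ?S" for f
    using that unfolding carrier L_def by (simp add: convergent_LIMSEQ_iff)
  have L_eq: "L f = z" "f \<in> carrier ?S" if "(\<lambda>n. s (f n)) \<longlonglongrightarrow> z" for f z
    using that unfolding L_def carrier by (auto intro: limI convergentI)
  have hom_L: "ring_hom_ring ?S ?T L"
  proof (rule ring_hom_ringI[OF ring_S ring_T])
    fix f g assume fg: "f \<in> carrier ?S" "g \<in> carrier ?S"
    show "L (f \<otimes>\<^bsub>?S\<^esub> g) = L f \<otimes>\<^bsub>?T\<^esub> L g"
      by (rule L_eq(1)) (simp add: ops ring_of_type_algebra_simps s.hom_mult tendsto_mult L fg)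
    show "L (f \<oplus>\<^bsub>?S\<^esub> g) = L f \<oplus>\<^bsub>?T\<^esub> L g"
      by (rule L_eq(1)) (simp add: ops ring_of_type_algebra_simps s.hom_add tendsto_add L fg)
  next
    show "L \<one>\<^bsub>?S\<^esub> = \<one>\<^bsub>?T\<^esub>"
      by (rule L_eq(1)) (simp add: ops ring_of_type_algebra_simps)
  qed (simp only: ring_of_type_algebra_simps UNIV_I)
  \<comment> \<open>Together with surjectivity, which is the density hypothesis, this identifies the
    quotient with \<open>'b\<close> by the first isomorphism theorem.\<close>
  have kernel: "a_kernel ?S ?T L = null_seqs v"
  proof (intro equalityI subsetI)
    fix f assume "f \<in> a_kernel ?S ?T L"
    then have "f \<in> carrier ?S" "L f = 0" by (simp_all add: a_kernel_def' ring_of_type_algebra_simps)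
    with L[of f] show "f \<in> null_seqs v" unfolding null_seqs_def v by (simp add: tendsto_norm_zero_iff)
  next
    fix f assume "f \<in> null_seqs v"
    then have "(\<lambda>n. s (f n)) \<longlonglongrightarrow> 0" unfolding null_seqs_def v by (simp add: tendsto_norm_zero_iff)
    from L_eq[OF this] show "f \<in> a_kernel ?S ?T L" by (simp add: a_kernel_def' ring_of_type_algebra_simps)
  qed
  have surj: "L ` carrier ?S = carrier ?T"
  proof -
    have "z \<in> L ` carrier ?S" for z
    proof -
      obtain f where "(\<lambda>n. s (f n)) \<longlonglongrightarrow> z" using dense by blast
      from L_eq[OF this] show ?thesis by (intro image_eqI[of _ _ f]) simp_all
    qed
    then show ?thesis by (auto simp: ring_of_type_algebra_simps)
  qed
  let ?R = "completion v"
  have R_eq: "?R = ?S Quot a_kernel ?S ?T L" by (simp add: Defs.completion_def kernel)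
  have ring_R: "ring ?R" unfolding R_eq by (rule ideal.quotient_is_ring[OF ring_hom_ring.kernel_is_ideal[OF hom_L]])
  define \<Phi> where "\<Phi> C = the_elem (L ` C)" for C
  have \<Phi>: "\<Phi> \<in> ring_iso ?R ?T"
    using ring_hom_ring.FactRing_iso_set[OF hom_L surj] unfolding R_eq[symmetric] \<Phi>_def .
  then have bij: "bij_betw \<Phi> (carrier ?R) UNIV" by (simp add: ring_iso_def ring_of_type_algebra_simps)
  define \<Psi> where "\<Psi> = inv_into (carrier ?R) \<Phi>"
  have \<Psi>: "\<Psi> \<in> ring_iso ?T ?R" unfolding \<Psi>_def by (rule ring_iso_set_sym[OF ring_R \<Phi>])
  have \<Phi>_coset: "\<Phi> (null_seqs v +>\<^bsub>?S\<^esub> f) = L f" if "f \<in> carrier ?S" for f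
    using ring_hom_ring.the_elem_simp[OF hom_L that] unfolding kernel \<Phi>_def .
  have coset_carrier: "null_seqs v +>\<^bsub>?S\<^esub> f \<in> carrier ?R" if "f \<in> carrier ?S" for f
    using that unfolding Defs.completion_def FactRing_def by (auto simp: A_RCOSETS_def')
  have \<Psi>_L: "\<Psi> (L f) = null_seqs v +>\<^bsub>?S\<^esub> f" if "f \<in> carrier ?S" for f
    unfolding \<Psi>_def \<Phi>_coset[OF that, symmetric]
    by (rule inv_into_f_f[OF bij_betw_imp_inj_on[OF bij] coset_carrier[OF that]])
  \<comment> \<open>Every real number is a limit of rationals, which \<open>s\<close> fixes.
    Conversely a Cauchy sequence of rationals already converges in the reals, as
    \<open>of_real\<close> preserves the norm.\<close>
  have rat: "\<Psi> ` range of_real = rat_completion v"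
  proof (intro equalityI subsetI)
    fix C assume "C \<in> \<Psi> ` range of_real"
    then obtain r where r: "C = \<Psi> (of_real r)" by blast
    have "\<forall>n. \<exists>q. \<bar>r - of_rat q\<bar> < 1 / Suc n"
    proof
      fix n
      obtain q where "r - 1 / Suc n < of_rat q" "of_rat q < r"
        using of_rat_dense[of "r - 1 / Suc n" r] by auto
      then have "\<bar>r - of_rat q\<bar> < 1 / Suc n" by linarith
      then show "\<exists>q. \<bar>r - of_rat q\<bar> < 1 / Suc n" by (rule exI)
    qed
    then obtain q where q: "\<And>n. \<bar>r - of_rat (q n)\<bar> < 1 / Suc n" by metis
    have "(\<lambda>n. real_of_rat (q n) - r) \<longlonglongrightarrow> 0"
    proof (rule Lim_null_comparison[OF _ LIMSEQ_inverse_real_of_nat])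
      have "norm (real_of_rat (q n) - r) \<le> inverse (real (Suc n))" for n
        using q[of n] by (simp add: inverse_eq_divide)
      then show "\<forall>\<^sub>F n in sequentially. norm (real_of_rat (q n) - r) \<le> inverse (real (Suc n))" by simp
    qed
    then have "(\<lambda>n. real_of_rat (q n)) \<longlonglongrightarrow> r" by (rule LIM_zero_cancel)
    then have "(\<lambda>n. of_real (real_of_rat (q n)) :: 'b) \<longlonglongrightarrow> of_real r" by (rule tendsto_of_real)
    then have "(\<lambda>n. s (of_rat (q n))) \<longlonglongrightarrow> of_real r"
      by (simp add: s.hom_of_rat of_real_hom.hom_of_rat)
    from L_eq[OF this] \<Psi>_L[of "\<lambda>n. of_rat (q n)"] r
    have "C = null_seqs v +>\<^bsub>?S\<^esub> (\<lambda>n. of_rat (q n))" "(\<lambda>n. of_rat (q n)) \<in> carrier ?S" by simp_all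
    moreover have "range (\<lambda>n. of_rat (q n) :: 'a) \<subseteq> \<rat>" by (simp add: image_subset_iff)
    ultimately show "C \<in> rat_completion v"
      unfolding rat_completion_def mem_Collect_eq by (intro exI[of _ "\<lambda>n. of_rat (q n)"] conjI)
  next
    fix C assume "C \<in> rat_completion v"
    then obtain f where f: "C = null_seqs v +>\<^bsub>?S\<^esub> f" "f \<in> carrier ?S" "range f \<subseteq> \<rat>"
      unfolding rat_completion_def mem_Collect_eq by (elim exE conjE)
    have "\<forall>n. \<exists>q. f n = of_rat q"
    proof
      fix n have "f n \<in> \<rat>" using f(3) by blast
      then show "\<exists>q. f n = of_rat q" by (rule Rats_cases) (rule exI)
    qed
    then obtain q where q: "\<And>n. f n = of_rat (q n)" by metis
    have sf: "s (f n) = of_real (real_of_rat (q n))" for n by (simp add: q s.hom_of_rat of_real_hom.hom_of_rat)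
    have "Cauchy (\<lambda>n. s (f n))" using f(2) unfolding carrier Cauchy_convergent_iff .
    then have "Cauchy (\<lambda>n. real_of_rat (q n))"
      unfolding sf Cauchy_def dist_norm of_real_diff[symmetric] norm_of_real real_norm_def .
    then obtain r where "(\<lambda>n. real_of_rat (q n)) \<longlonglongrightarrow> r" by (auto simp: Cauchy_convergent_iff convergent_def)
    then have "(\<lambda>n. s (f n)) \<longlonglongrightarrow> of_real r" unfolding sf by (rule tendsto_of_real)
    from L_eq[OF this] have "C = \<Psi> (of_real r)" using \<Psi>_L[of f] f by simp
    then show "C \<in> \<Psi> ` range of_real" by blast
  qed
  have \<Psi>_bij: "bij_betw \<Psi> UNIV (carrier ?R)"
    using \<Psi> by (simp add: ring_iso_def ring_of_type_algebra_simps)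
  have hom_P: "ring_hom_ring ?T ?R \<Psi>"
    by (rule ring_hom_ringI2[OF ring_T ring_R]) (use \<Psi> in \<open>simp add: ring_iso_def\<close>)
  have "\<Psi> 1 \<noteq> \<Psi> 0" using bij_betw_imp_inj_on[OF \<Psi>_bij] by (auto dest: injD)
  then have one_zero: "\<one>\<^bsub>?R\<^esub> \<noteq> \<zero>\<^bsub>?R\<^esub>"
    using ring_hom_one[OF ring_hom_ring.homh[OF hom_P]] ring_hom_zero[OF ring_hom_ring.homh[OF hom_P] ring_T ring_R]
    by (simp add: ring_of_type_algebra_simps)
  have "field_subset (range of_real :: 'b set)"
    unfolding field_subset_def
    by (auto simp: image_iff simp flip: of_real_diff of_real_mult of_real_inverse intro: exI[of _ 0] exI[of _ 1])
  then have sub: "subfield (range of_real) ?T" by (rule subfield_type_algebra)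
  have "ring.dimension ?R n (\<Psi> ` range of_real) (\<Psi> ` UNIV)"
    by (rule ring_hom_ring.inj_hom_dimension[OF hom_P sub one_zero bij_betw_imp_inj_on[OF \<Psi>_bij] dim])
  moreover have "subfield (\<Psi> ` range of_real) ?R" by (rule ring_hom_ring.img_is_subfield(2)[OF hom_P  sub one_zero])
  ultimately have "ring.dim ?R (\<Psi> ` range of_real) (\<Psi> ` UNIV) = n"
    using ring.dimI[OF ring_R] by (simp add: over_def)
  then show ?thesis
    unfolding local_degree_def rat[symmetric] bij_betw_imp_surj_on[OF \<Psi>_bij, symmetric] .
qed

lemma dimension_real_complex:
  "ring.dimension (ring_of_type_algebra :: real ring) 1 (range of_real) UNIV"
  "ring.dimension (ring_of_type_algebra :: complex ring) 2 (range of_real) UNIV"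
proof -
  interpret R: Ring.field "ring_of_type_algebra :: real ring" by (rule field_from_type_algebra)
  have "field_subset (UNIV :: real set)" by (simp add: field_subset_def)
  then have "subfield (UNIV :: real set) ring_of_type_algebra" by (rule subfield_type_algebra)
  from R.dimension_one[OF this]
  show "R.dimension 1 (range of_real) UNIV" by simp
next
  interpret C: Ring.field "ring_of_type_algebra :: complex ring" by (rule field_from_type_algebra)
  have "field_subset (range of_real :: complex set)"
    unfolding field_subset_def
    by (auto simp: image_iff simp flip: of_real_diff of_real_mult of_real_inverse intro: exI[of _ 0] exI[of _ 1])
  then have "subfield (range of_real :: complex set) ring_of_type_algebra" by (rule subfield_type_algebra)
  then have 1: "C.dimension 1 (range of_real) (range of_real)" by (rule C.dimension_one)
  have "\<i> \<notin> range complex_of_real" by (auto simp: complex_eq_iff)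
  then have "C.dimension (Suc 1) (range of_real) (C.line_extension (range of_real) \<i> (range of_real))"
    by (intro C.Suc_dim 1) (simp_all add: ring_of_type_algebra_simps)
  moreover have "C.line_extension (range of_real) \<i> (range of_real) = UNIV"
  proof -
    have "z \<in> C.line_extension (range of_real) \<i> (range of_real)" for z
      unfolding C.line_extension_mem_iff ring_of_type_algebra_simps
      by (rule bexI[of _ "of_real (Im z)"], rule bexI[of _ "of_real (Re z)"]) (simp_all add: complex_eq_iff)
    then show ?thesis by auto
  qed
  ultimately show "C.dimension 2 (range of_real) UNIV" by (simp add: numeral_2_eq_2)
qed

section \<open>Absolute values and the classification of the archimedean ones\<close>

lemma absolute_valueD:
  assumes "absolute_value v"
  shows "v x \<ge> 0" "v x = 0 \<longleftrightarrow> x = 0" "v (x * y) = v x * v y" "v (x + y) \<le> v x + v y"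
  using assms unfolding absolute_value_def by blast+

lemma absolute_value_one:
  assumes "absolute_value v"
  shows "v 1 = 1"
proof -
  have "v 1 * v 1 = v 1" "v 1 \<noteq> 0"
    using absolute_valueD(3)[OF assms, of 1 1] absolute_valueD(2)[OF assms, of 1] by simp_all
  then show ?thesis by simp
qed

lemma absolute_value_power:
  assumes "absolute_value v"
  shows "v (x ^ k) = v x ^ k"
  by (induction k) (simp_all add: absolute_value_one[OF assms] absolute_valueD(3)[OF assms])

lemma absolute_value_sum:
  assumes "absolute_value v"
  shows "v (sum u I) \<le> (\<Sum>i\<in>I. v (u i))"
proof (induction I rule: infinite_finite_induct)
  case (insert i I)
  have "v (sum u (insert i I)) = v (u i + sum u I)" using insert by simp
  also have "\<dots> \<le> v (u i) + v (sum u I)" by (rule absolute_valueD(4)[OF assms])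
  also have "\<dots> \<le> (\<Sum>i\<in>insert i I. v (u i))" using insert by simp
  finally show ?case .
qed (use absolute_valueD(2)[OF assms, of 0] in simp_all)

lemma norm_hom_absolute_value:
  fixes s :: "'a :: field_char_0 \<Rightarrow> complex"
  assumes "field_char_0_hom s"
  shows "(\<lambda>x. cmod (s x)) \<in> arch_places"
proof -
  interpret field_char_0_hom s by fact
  have "cmod (s (of_rat q)) = \<bar>real_of_rat q\<bar>" for q
  proof -
    have "s (of_rat q) = of_real (of_rat q)" by (simp only: hom_of_rat of_real_hom.hom_of_rat)
    then show ?thesis by (simp only: norm_of_real)
  qed
  then show ?thesis
    unfolding arch_places_def absolute_value_def
    by (simp add: hom_add hom_mult norm_mult norm_triangle_ineq)
qed

context number_field_embeddings
begin

text \<open>Complex conjugation as an involution of the indices: its fixed points are the real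
  embeddings, its two-element orbits the complex places.\<close>

definition conj_index :: "nat \<Rightarrow> nat" where
  "conj_index i = (SOME j. j < d \<and> \<sigma> j = (\<lambda>x. cnj (\<sigma> i x)))"

lemma conj_index:
  assumes "i < d"
  shows "conj_index i < d" "\<sigma> (conj_index i) x = cnj (\<sigma> i x)"
proof -
  interpret s: field_char_0_hom "\<sigma> i" using assms by (rule hom_\<sigma>)
  have "field_char_0_hom (\<lambda>x. cnj (\<sigma> i x))"
    by unfold_locales (simp_all add: s.hom_add s.hom_mult)
  then have "\<exists>j. j < d \<and> \<sigma> j = (\<lambda>x. cnj (\<sigma> i x))" using \<sigma>_surj by blast
  from someI_ex[OF this, folded conj_index_def]
  show "conj_index i < d" "\<sigma> (conj_index i) x = cnj (\<sigma> i x)" by simp_all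
qed

lemma conj_index_conj_index: "i < d \<Longrightarrow> conj_index (conj_index i) = i"
  using conj_index(1)[of i] conj_index(1)[of "conj_index i"] conj_index(2)[of i \<theta>] conj_index(2)[of "conj_index i" \<theta>]
  by (intro \<sigma>_inj) simp_all

lemma conj_index_fixed: "i < d \<Longrightarrow> conj_index i = i \<longleftrightarrow> (\<forall>x. \<sigma> i x \<in> \<real>)"
proof
  assume i: "i < d" "conj_index i = i"
  then show "\<forall>x. \<sigma> i x \<in> \<real>" using conj_index(2)[OF i(1)] by (simp add: Reals_cnj_iff)
next
  assume i: "i < d" and "\<forall>x. \<sigma> i x \<in> \<real>"
  then show "conj_index i = i"
    using conj_index[OF i] by (intro \<sigma>_inj) (simp_all add: Reals_cnj_iff)
qed

text \<open>The coordinates solving the linear system with right hand side \<open>a\<close> are real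
  by the symmetry of \<open>a\<close>. Rational numbers close to them are the coordinates of the
  desired \<open>x\<close>.\<close>

lemma embeddings_dense:
  assumes a: "\<And>i. i < d \<Longrightarrow> a (conj_index i) = cnj (a i)" and e: "e > 0"
  shows "\<exists>x. \<forall>i<d. cmod (\<sigma> i x - a i) < e"
proof -
  let ?b = "\<lambda>j. \<theta> ^ j"
  let ?E = "embedding_mat ?b"
  have E: "?E \<in> carrier_mat d d" by simp
  obtain Q where Q: "Q \<in> carrier_mat d d" "Q * ?E = 1\<^sub>m d" "?E * Q = 1\<^sub>m d"
    using det_non_zero_imp_unit[OF E det_embedding_mat_nz[OF power_basis_spanning], of undefined]
    by (auto simp: Units_def ring_mat_def)
  define r where "r = Q *\<^sub>v Matrix.vec d a"
  have r: "r \<in> carrier_vec d" using Q by (simp add: r_def)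
  have Er: "?E *\<^sub>v r = Matrix.vec d a"
    unfolding r_def assoc_mult_mat_vec[OF E Q(1) vec_carrier, symmetric] Q(3) by simp
  have sum_r: "(\<Sum>j<d. \<sigma> i (?b j) * vec_index r j) = a i" if "i < d" for i
  proof -
    have "(\<Sum>j<d. \<sigma> i (?b j) * vec_index r j) = vec_index (?E *\<^sub>v r) i"
      using that r by (auto simp: embedding_mat_def scalar_prod_def lessThan_atLeast0 intro!: sum.cong)
    then show ?thesis using that unfolding Er by simp
  qed
  \<comment> \<open>Conjugating the system permutes its equations and its right hand side alike. The
    conjugate of \<open>r\<close> is then another solution, and the matrix is nonsingular.\<close>
  have real: "vec_index r j \<in> \<real>" if "j < d" for j
  proof -
    let ?v = "Matrix.vec d (\<lambda>j. cnj (vec_index r j) - vec_index r j)"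
    have "?E *\<^sub>v ?v = 0\<^sub>v d"
    proof (rule eq_vecI)
      fix i assume "i < dim_vec (0\<^sub>v d :: complex Matrix.vec)"
      then have i: "i < d" by simp
      have "vec_index (?E *\<^sub>v ?v) i = (\<Sum>j<d. \<sigma> i (?b j) * cnj (vec_index r j)) - (\<Sum>j<d. \<sigma> i (?b j) * vec_index r j)"
        using i by (auto simp: embedding_mat_def scalar_prod_def lessThan_atLeast0 sum_subtractf[symmetric] right_diff_distrib intro!: sum.cong)
      also have "(\<Sum>j<d. \<sigma> i (?b j) * cnj (vec_index r j)) = cnj (\<Sum>j<d. \<sigma> (conj_index i) (?b j) * vec_index r j)"
        by (simp add: conj_index(2)[OF i])
      also have "\<dots> = a i" using sum_r[OF conj_index(1)[OF i]] a[OF i] by simp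
      finally show "vec_index (?E *\<^sub>v ?v) i = vec_index (0\<^sub>v d) i" using i sum_r[OF i] by simp
    qed (simp add: embedding_mat_def)
    then have "?v = 0\<^sub>v d"
      using det_embedding_mat_nz[OF power_basis_spanning] det_0_iff_vec_prod_zero_field[OF E]
      by (metis vec_carrier)
    then have "vec_index ?v j = 0" using that by simp
    then show ?thesis using that by (simp add: Reals_cnj_iff)
  qed
  define B where "B = 1 + (\<Sum>i<d. \<Sum>j<d. cmod (\<sigma> i (?b j)))"
  have B: "(\<Sum>j<d. cmod (\<sigma> i (?b j))) < B" if "i < d" for i
  proof -
    have "(\<Sum>j<d. cmod (\<sigma> i (?b j))) \<le> (\<Sum>i<d. \<Sum>j<d. cmod (\<sigma> i (?b j)))"
      by (rule member_le_sum) (use that in \<open>auto intro: sum_nonneg\<close>)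
    then show ?thesis by (simp add: B_def)
  qed
  have "B > 0" unfolding B_def by (intro add_pos_nonneg sum_nonneg) auto
  have "\<exists>q. \<bar>of_rat q - Re (vec_index r j)\<bar> < e / B" for j
  proof -
    have "e / B > 0" using e \<open>B > 0\<close> by simp
    then obtain q where "Re (vec_index r j) - e / B < of_rat q" "of_rat q < Re (vec_index r j)"
      using of_rat_dense[of "Re (vec_index r j) - e / B" "Re (vec_index r j)"] by auto
    then have "\<bar>of_rat q - Re (vec_index r j)\<bar> < e / B" by linarith
    then show ?thesis by (rule exI)
  qed
  then obtain q where q: "\<And>j. \<bar>of_rat (q j) - Re (vec_index r j)\<bar> < e / B" by metis
  have q': "cmod (of_rat (q j) - vec_index r j) < e / B" if "j < d" for j
  proof -
    have "of_rat (q j) - vec_index r j = of_real (of_rat (q j) - Re (vec_index r j))"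
      using real[OF that] by (simp add: of_real_hom.hom_of_rat)
    then show ?thesis using q[of j] by (simp only: norm_of_real)
  qed
  define x where "x = (\<Sum>j<d. of_rat (q j) * ?b j)"
  have "cmod (\<sigma> i x - a i) < e" if i: "i < d" for i
  proof -
    have "\<sigma> i x - a i = (\<Sum>j<d. (of_rat (q j) - vec_index r j) * \<sigma> i (?b j))"
      unfolding x_def sum_r[OF i, symmetric] using i
      by (simp add: \<sigma>_simps sum_subtractf[symmetric] left_diff_distrib right_diff_distrib mult.commute)
    also have "cmod \<dots> \<le> (\<Sum>j<d. cmod ((of_rat (q j) - vec_index r j) * \<sigma> i (?b j)))" by (rule norm_sum)
    also have "\<dots> \<le> (\<Sum>j<d. e / B * cmod (\<sigma> i (?b j)))"
    proof (rule sum_mono)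
      fix j assume "j \<in> {..<d}"
      then show "cmod ((of_rat (q j) - vec_index r j) * \<sigma> i (?b j)) \<le> e / B * cmod (\<sigma> i (?b j))"
        unfolding norm_mult by (intro mult_right_mono[OF less_imp_le[OF q'] norm_ge_zero]) simp
    qed
    also have "\<dots> = e / B * (\<Sum>j<d. cmod (\<sigma> i (?b j)))" by (simp add: sum_distrib_left)
    also have "\<dots> < e / B * B" using B[OF i] e \<open>B > 0\<close> by (intro mult_strict_left_mono) auto
    finally show ?thesis using \<open>B > 0\<close> by simp
  qed
  then show ?thesis by blast
qed

text \<open>The rational coordinates of \<open>x\<close> depend linearly on its conjugates through
  the inverse matrix \<open>Q\<close>, and on rationals \<open>v\<close> is the usual absolute
  value.\<close>

lemma arch_place_bound:
  assumes v: "v \<in> (arch_places :: ('a \<Rightarrow> real) set)"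
  obtains C where "C > 0" "\<And>x m. (\<And>i. i < d \<Longrightarrow> cmod (\<sigma> i x) \<le> m) \<Longrightarrow> v x \<le> C * m"
proof -
  have av: "absolute_value v" and rat: "\<And>q. v (of_rat q) = \<bar>real_of_rat q\<bar>"
    using v unfolding arch_places_def by blast+
  let ?b = "\<lambda>j. \<theta> ^ j"
  let ?E = "embedding_mat ?b"
  have E: "?E \<in> carrier_mat d d" by simp
  obtain Q where Q: "Q \<in> carrier_mat d d" "Q * ?E = 1\<^sub>m d" "?E * Q = 1\<^sub>m d"
    using det_non_zero_imp_unit[OF E det_embedding_mat_nz[OF power_basis_spanning], of undefined]
    by (auto simp: Units_def ring_mat_def)
  define C where "C = 1 + (\<Sum>j<d. (\<Sum>i<d. cmod (Q $$ (j, i))) * v (?b j))"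
  have C0: "(\<Sum>j<d. (\<Sum>i<d. cmod (Q $$ (j, i))) * v (?b j)) \<ge> 0"
    by (intro sum_nonneg mult_nonneg_nonneg absolute_valueD(1)[OF av]) auto
  have "v x \<le> C * m" if m: "\<And>i. i < d \<Longrightarrow> cmod (\<sigma> i x) \<le> m" for x m
  proof -
    have "m \<ge> 0" using m[OF degree_pos] norm_ge_zero order_trans by blast
    let ?q = "\<lambda>j. coeff (rep x) j"
    have \<sigma>x: "\<sigma> i x = (\<Sum>j<d. \<sigma> i (?b j) * of_rat (?q j))" if "i < d" for i
      using arg_cong[OF rep_sum[of x], of "\<sigma> i"] that by (simp add: \<sigma>_simps mult.commute)
    let ?v = "Matrix.vec d (\<lambda>j. of_rat (?q j) :: complex)"
    have Ev: "?E *\<^sub>v ?v = Matrix.vec d (\<lambda>i. \<sigma> i x)"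
      by (rule eq_vecI) (auto simp: embedding_mat_def scalar_prod_def lessThan_atLeast0 \<sigma>x intro!: sum.cong)
    have Qv: "Q *\<^sub>v Matrix.vec d (\<lambda>i. \<sigma> i x) = ?v"
      unfolding Ev[symmetric] assoc_mult_mat_vec[OF Q(1) E vec_carrier, symmetric] Q(2) by simp
    have qj: "of_rat (?q j) = (\<Sum>i<d. Q $$ (j, i) * \<sigma> i x)" if "j < d" for j
    proof -
      have "vec_index (Q *\<^sub>v Matrix.vec d (\<lambda>i. \<sigma> i x)) j = (\<Sum>i<d. Q $$ (j, i) * \<sigma> i x)"
        using that Q(1) by (auto simp: scalar_prod_def lessThan_atLeast0 intro!: sum.cong)
      then show ?thesis using that unfolding Qv by simp
    qed
    have vq: "v (of_rat (?q j)) \<le> (\<Sum>i<d. cmod (Q $$ (j, i))) * m" if "j < d" for j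
    proof -
      have "v (of_rat (?q j)) = cmod (of_real (of_rat (?q j)))" by (simp only: rat norm_of_real)
      also have "\<dots> = cmod (\<Sum>i<d. Q $$ (j, i) * \<sigma> i x)" by (simp only: of_real_hom.hom_of_rat qj[OF that])
      also have "\<dots> \<le> (\<Sum>i<d. cmod (Q $$ (j, i) * \<sigma> i x))" by (rule norm_sum)
      also have "\<dots> \<le> (\<Sum>i<d. cmod (Q $$ (j, i)) * m)"
        using m by (intro sum_mono) (auto simp: norm_mult intro: mult_left_mono)
      finally show ?thesis by (simp add: sum_distrib_right)
    qed
    have "v x = v (\<Sum>j<d. of_rat (?q j) * ?b j)" using rep_sum[of x] by (simp only:)
    also have "\<dots> \<le> (\<Sum>j<d. v (of_rat (?q j) * ?b j))" by (rule absolute_value_sum[OF av])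
    also have "\<dots> \<le> (\<Sum>j<d. (\<Sum>i<d. cmod (Q $$ (j, i))) * m * v (?b j))"
      using vq absolute_valueD(1)[OF av] by (intro sum_mono) (auto simp: absolute_valueD(3)[OF av] intro!: mult_right_mono)
    also have "\<dots> = (\<Sum>j<d. (\<Sum>i<d. cmod (Q $$ (j, i))) * v (?b j) * m)" by (simp add: mult_ac)
    also have "\<dots> = (C - 1) * m" by (simp only: C_def sum_distrib_right[symmetric]) simp
    also have "\<dots> \<le> C * m" using \<open>m \<ge> 0\<close> by (simp add: left_diff_distrib)
    finally show ?thesis .
  qed
  moreover have "C > 0" using C0 by (simp add: C_def)
  ultimately show thesis using that by blast
qed

text \<open>Suppose that for each \<open>i\<close> there is an element on which \<open>v\<close>
  exceeds \<open>|\<sigma> i|\<close>; a power \<open>y i\<close> of it makes the ratio large.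
  Elements \<open>z i\<close> that are nearly concentrated at \<open>i\<close> and its conjugate
  have a sum close to 1, so \<open>v (z i) \<ge> 1 / (2 * d)\<close> for some \<open>i\<close>. For
  this \<open>i\<close> the product \<open>y i * z i\<close> is small at every embedding: at
  \<open>i\<close> and its conjugate because of \<open>y i\<close>, elsewhere because of
  \<open>z i\<close>. The bound by \<open>C\<close> then contradicts multiplicativity of
  \<open>v\<close>.\<close>

lemma arch_place_dominated:
  assumes v: "v \<in> (arch_places :: ('a \<Rightarrow> real) set)"
  shows "\<exists>i<d. \<forall>x. v x \<le> cmod (\<sigma> i x)"
proof (rule ccontr)
  assume "\<not> ?thesis"
  then have "\<exists>x. i < d \<longrightarrow> cmod (\<sigma> i x) < v x" for i by (auto simp: not_le)
  then obtain x where x: "\<And>i. i < d \<Longrightarrow> cmod (\<sigma> i (x i)) < v (x i)" by metis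
  have av: "absolute_value v" using v unfolding arch_places_def by blast
  obtain C where C: "C > 0" "\<And>x m. (\<And>i. i < d \<Longrightarrow> cmod (\<sigma> i x) \<le> m) \<Longrightarrow> v x \<le> C * m"
    using arch_place_bound[OF v] by blast
  have d: "real d > 0" using degree_pos by simp
  \<comment> \<open>The constant \<open>4 * C * d\<close> gathers the later losses: \<open>C\<close>
    from the general bound, 2 from \<open>|\<sigma> j (z i)| \<le> 2\<close>, and
    \<open>2 * d\<close> from the lower bound for \<open>v (z i)\<close>.\<close>
  have "\<exists>y. i < d \<longrightarrow> 4 * C * d * cmod (\<sigma> i y) < v y \<and> v y > 0" for i
  proof (cases "i < d")
    case True
    define r where "r = cmod (\<sigma> i (x i)) / v (x i)"
    have vpos: "v (x i) > 0" using x[OF True] norm_ge_zero order_le_less_trans by blast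
    have "r < 1" "r \<ge> 0" using x[OF True] vpos by (simp_all add: r_def)
    have "1 / (4 * C * d) > 0" using C d by simp
    then obtain k where k: "r ^ k < 1 / (4 * C * d)" using real_arch_pow_inv[OF _ \<open>r < 1\<close>] by blast
    have "cmod (\<sigma> i (x i ^ k)) = r ^ k * v (x i) ^ k"
      using vpos True by (simp add: r_def \<sigma>_simps norm_power power_divide)
    also have "\<dots> < 1 / (4 * C * d) * v (x i) ^ k" using k vpos by (intro mult_strict_right_mono) auto
    finally have "4 * C * d * cmod (\<sigma> i (x i ^ k)) < v (x i ^ k)"
      using C d by (simp add: field_simps absolute_value_power[OF av])
    moreover have "v (x i ^ k) > 0" using vpos by (simp add: absolute_value_power[OF av])
    ultimately show ?thesis by blast
  qed simp
  then obtain y where y: "\<And>i. i < d \<Longrightarrow> 4 * C * d * cmod (\<sigma> i (y i)) < v (y i)" "\<And>i. i < d \<Longrightarrow> v (y i) > 0"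
    by metis
  define M where "M = 1 + (\<Sum>i<d. \<Sum>j<d. cmod (\<sigma> j (y i)))"
  have M: "cmod (\<sigma> j (y i)) \<le> M" if "i < d" "j < d" for i j
  proof -
    have "cmod (\<sigma> j (y i)) \<le> (\<Sum>j<d. cmod (\<sigma> j (y i)))" by (rule member_le_sum) (use that in auto)
    also have "\<dots> \<le> (\<Sum>i<d. \<Sum>j<d. cmod (\<sigma> j (y i)))"
      by (rule member_le_sum) (use that in \<open>auto intro: sum_nonneg\<close>)
    finally show ?thesis by (simp add: M_def)
  qed
  have "M > 0" unfolding M_def by (intro add_pos_nonneg sum_nonneg) auto
  define V where "V = Min ((\<lambda>i. v (y i)) ` {..<d})"
  have V: "V \<le> v (y i)" if "i < d" for i unfolding V_def using that by (intro Min_le) auto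
  have "V > 0" unfolding V_def using y(2) degree_pos by (subst Min_gr_iff) auto
  \<comment> \<open>The three terms ensure in turn \<open>|\<sigma> j (z i)| \<le> 2\<close>, that
    the sum of the \<open>z i\<close> is within \<open>1 / 2\<close> of 1 under \<open>v\<close>,
    and that the contribution \<open>2 * d * C * (e * M)\<close> of the other embeddings stays below
    every \<open>v (y i)\<close>.\<close>
  define e where "e = min 1 (min (1 / (2 * C * d)) (V / (4 * C * d * M)))"
  have e: "e > 0" "e \<le> 1" "C * (d * e) \<le> 1 / 2" "2 * d * C * (e * M) < V"
  proof -
    show "e > 0" "e \<le> 1" using C d \<open>V > 0\<close> \<open>M > 0\<close> by (simp_all add: e_def)
    have "e \<le> 1 / (2 * C * d)" by (simp add: e_def)
    then have "C * (d * e) \<le> C * (d * (1 / (2 * C * d)))" using C d by (intro mult_left_mono) auto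
    then show "C * (d * e) \<le> 1 / 2" using C d by simp
    have "e \<le> V / (4 * C * d * M)" by (simp add: e_def)
    then have "2 * d * C * (e * M) \<le> 2 * d * C * (V / (4 * C * d * M) * M)"
      using C d \<open>M > 0\<close> by (intro mult_left_mono mult_right_mono) auto
    also have "\<dots> = V / 2" using C d \<open>M > 0\<close> by (simp add: field_simps)
    finally show "2 * d * C * (e * M) < V" using \<open>V > 0\<close> by simp
  qed
  \<comment> \<open>A partition of unity invariant under conjugation. For a real \<open>i\<close>
    both terms coincide and give 1; for a complex pair the two indices give the same function, with
    the value \<open>1 / 2\<close> at each of its points.\<close>
  define a where "a i j = (of_bool (j = i) + of_bool (j = conj_index i)) / (2 :: complex)" for i j
  have "\<exists>z. i < d \<longrightarrow> (\<forall>j<d. cmod (\<sigma> j z - a i j) < e)" for i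
  proof (cases "i < d")
    case True
    have "a i (conj_index j) = cnj (a i j)" if "j < d" for j
    proof -
      have "conj_index j = i \<longleftrightarrow> j = conj_index i" "conj_index j = conj_index i \<longleftrightarrow> j = i"
        using conj_index_conj_index[OF True] conj_index_conj_index[OF that] by metis+
      then show ?thesis by (simp add: a_def)
    qed
    from embeddings_dense[of "a i" e, OF this e(1)] show ?thesis by simp
  qed simp
  then obtain z where z: "\<And>i j. i < d \<Longrightarrow> j < d \<Longrightarrow> cmod (\<sigma> j (z i) - a i j) < e" by metis
  have sum_a: "(\<Sum>i<d. a i j) = 1" if "j < d" for j
  proof -
    have eq: "(j = conj_index i) = (i = conj_index j)" if "i < d" for i
      using conj_index_conj_index[OF \<open>j < d\<close>] conj_index_conj_index[OF that] by metis
    have "(\<Sum>i<d. a i j) = (\<Sum>i<d. ((if i = j then 1 else 0) + (if i = conj_index j then 1 else 0)) / 2)"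
    proof (rule sum.cong[OF refl])
      fix i assume "i \<in> {..<d}"
      then have "(j = conj_index i) = (i = conj_index j)" "(j = i) = (i = j)" using eq by auto
      then show "a i j = ((if i = j then 1 else 0) + (if i = conj_index j then 1 else 0)) / 2"
        unfolding a_def of_bool_def by (simp only:)
    qed
    also have "\<dots> = 1" using that conj_index(1)[OF that] by (simp add: sum_divide_distrib[symmetric] sum.distrib)
    finally show ?thesis .
  qed
  have "v (1 - (\<Sum>i<d. z i)) \<le> C * (d * e)"
  proof (rule C(2))
    fix j assume j: "j < d"
    have "\<sigma> j (1 - (\<Sum>i<d. z i)) = (\<Sum>i<d. a i j - \<sigma> j (z i))"
      using j by (simp add: \<sigma>_simps sum_subtractf sum_a)
    also have "cmod \<dots> \<le> (\<Sum>i<d. cmod (a i j - \<sigma> j (z i)))" by (rule norm_sum)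
    also have "\<dots> \<le> (\<Sum>i<d. e)" using z[OF _ j] by (intro sum_mono) (auto simp: norm_minus_commute less_imp_le)
    finally show "cmod (\<sigma> j (1 - (\<Sum>i<d. z i))) \<le> d * e" by simp
  qed
  then have "v (1 - (\<Sum>i<d. z i)) \<le> 1 / 2" using e(3) by simp
  moreover have "1 \<le> v (1 - (\<Sum>i<d. z i)) + (\<Sum>i<d. v (z i))"
    using absolute_valueD(4)[OF av, of "1 - (\<Sum>i<d. z i)" "\<Sum>i<d. z i"] absolute_value_sum[OF av, of z "{..<d}"]
    by (simp add: absolute_value_one[OF av])
  ultimately have sz: "(\<Sum>i<d. v (z i)) \<ge> 1 / 2" by simp
  have "\<exists>i<d. v (z i) \<ge> 1 / (2 * d)"
  proof (rule ccontr)
    assume "\<not> ?thesis"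
    then have "(\<Sum>i<d. v (z i)) < (\<Sum>i<d. 1 / (2 * d))" using degree_pos by (intro sum_strict_mono) auto
    then show False using sz d by simp
  qed
  then obtain i where i: "i < d" "v (z i) \<ge> 1 / (2 * d)" by blast
  have "v (y i * z i) \<le> C * max (2 * cmod (\<sigma> i (y i))) (e * M)"
  proof (rule C(2))
    fix j assume j: "j < d"
    show "cmod (\<sigma> j (y i * z i)) \<le> max (2 * cmod (\<sigma> i (y i))) (e * M)"
    proof (cases "j = i \<or> j = conj_index i")
      case True
      then have "cmod (\<sigma> j (y i)) = cmod (\<sigma> i (y i))" using conj_index(2)[OF i(1)] by auto
      moreover have "cmod (\<sigma> j (z i)) \<le> 2"
      proof -
        have "cmod (\<sigma> j (z i)) \<le> cmod (\<sigma> j (z i) - a i j) + cmod (a i j)" by (metis diff_add_cancel norm_triangle_ineq)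
        moreover have "cmod (a i j) \<le> 1" by (simp add: a_def)
        ultimately show ?thesis using z[OF i(1) j] e(2) by linarith
      qed
      ultimately have "cmod (\<sigma> j (y i * z i)) \<le> cmod (\<sigma> i (y i)) * 2"
        using j by (simp add: \<sigma>_simps norm_mult mult_left_mono)
      then show ?thesis by (simp add: mult.commute)
    next
      case False
      then have "a i j = 0" by (simp add: a_def)
      then have "cmod (\<sigma> j (z i)) \<le> e" using z[OF i(1) j] by simp
      then have "cmod (\<sigma> j (y i * z i)) \<le> M * e"
        using j M[OF i(1) j] \<open>M > 0\<close> by (simp add: \<sigma>_simps norm_mult mult_mono)
      then show ?thesis by (simp add: mult.commute)
    qed
  qed
  moreover have "v (y i) * (1 / (2 * d)) \<le> v (y i * z i)"
    using mult_left_mono[OF i(2) less_imp_le[OF y(2)[OF i(1)]]] by (simp only: absolute_valueD(3)[OF av])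
  ultimately have "v (y i) * (1 / (2 * d)) \<le> C * max (2 * cmod (\<sigma> i (y i))) (e * M)" by linarith
  then have "v (y i) \<le> 2 * d * (C * max (2 * cmod (\<sigma> i (y i))) (e * M))" using d by (simp add: field_simps)
  also have "\<dots> = max (4 * C * d * cmod (\<sigma> i (y i))) (2 * d * C * (e * M))"
    using C d by (simp add: max_mult_distrib_left mult_ac)
  also have "\<dots> < v (y i)" using y(1)[OF i(1)] order_less_le_trans[OF e(4) V[OF i(1)]]
    by (simp only: max_less_iff_conj simp_thms)
  finally show False by simp
qed

text \<open>The one-sided estimate applied to \<open>inverse x\<close> gives the reverse inequality
  for \<open>x\<close>.\<close>

lemma arch_places_eq: "(arch_places :: ('a \<Rightarrow> real) set) = (\<lambda>i x. cmod (\<sigma> i x)) ` {..<d}"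
proof (intro equalityI subsetI)
  fix v :: "'a \<Rightarrow> real" assume v: "v \<in> arch_places"
  then have av: "absolute_value v" unfolding arch_places_def by blast
  obtain i where i: "i < d" "\<And>x. v x \<le> cmod (\<sigma> i x)" using arch_place_dominated[OF v] by blast
  have "v x = cmod (\<sigma> i x)" for x
  proof (cases "x = 0")
    case True
    then show ?thesis using absolute_valueD(2)[OF av, of 0] i(1) by (simp add: \<sigma>_simps)
  next
    case False
    have \<sigma>x: "cmod (\<sigma> i x) > 0" using False i(1) by (simp add: \<sigma>_simps)
    have vx: "v x > 0" using absolute_valueD(1,2)[OF av, of x] False by simp
    have "v x * v (inverse x) = 1" using False absolute_valueD(3)[OF av, of x "inverse x"] by (simp add: absolute_value_one[OF av])
    then have "1 / v x = v (inverse x)" using vx by (simp add: field_simps)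
    also have "\<dots> \<le> cmod (\<sigma> i (inverse x))" by (rule i(2))
    also have "\<dots> = inverse (cmod (\<sigma> i x))" by (simp only: \<sigma>_simps(12)[OF i(1)] norm_inverse)
    also have "\<dots> = 1 / cmod (\<sigma> i x)" by (rule inverse_eq_divide)
    finally have "cmod (\<sigma> i x) \<le> v x" using \<sigma>x vx by (simp add: field_simps)
    with i(2)[of x] show ?thesis by simp
  qed
  then show "v \<in> (\<lambda>i x. cmod (\<sigma> i x)) ` {..<d}" using i(1) by (intro image_eqI[of _ _ i]) (auto simp: fun_eq_iff)
next
  fix v assume "v \<in> (\<lambda>i x. cmod (\<sigma> i x)) ` {..<d}"
  then show "v \<in> arch_places" using norm_hom_absolute_value[OF hom_\<sigma>] by auto
qed

end

section \<open>The height of an algebraic integer\<close>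

lemma nonarch_place_of_int:
  assumes "v \<in> nonarch_places"
  shows "v (of_int k) \<le> 1"
proof -
  obtain p where p: "prime p" "\<And>q. v (of_rat q) = padic_abs p q"
    using assms unfolding nonarch_places_def by blast
  have "v (of_int k) = padic_abs p (of_int k)" using p(2)[of "of_int k"] by simp
  also have "\<dots> \<le> 1"
  proof (cases "k = 0")
    case False
    have "padic_abs p (of_int k) = real p powi (- int (multiplicity (int p) k))"
      using False by (simp add: padic_abs_def)
    also have "\<dots> = inverse (real p ^ multiplicity (int p) k)" by (simp add: power_int_minus)
    also have "\<dots> \<le> 1" using prime_gt_0_nat[OF p(1)] by (intro inverse_le_1_iff[THEN iffD2] disjI2 one_le_power) simp
    finally show ?thesis .
  qed (simp add: padic_abs_def)
  finally show ?thesis .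
qed

text \<open>All powers of \<open>x\<close> lie in one finitely generated module over the integers.
  As \<open>v\<close> is at most 1 on integers, the ordinary triangle inequality bounds it on this
  module, whereas \<open>v x > 1\<close> would make the powers unbounded.\<close>

lemma nonarch_place_algebraic_int:
  fixes x :: "'a :: field_char_0"
  assumes v: "v \<in> nonarch_places" and x: "algebraic_int x"
  shows "v x \<le> 1"
proof (rule ccontr)
  assume "\<not> v x \<le> 1"
  then have gt: "v x > 1" by simp
  have av: "absolute_value v" using v unfolding nonarch_places_def by blast
  obtain m a where m: "m > 0" "x ^ m = (\<Sum>i<m. of_int (a i) * x ^ i)"
    using algebraic_int_power_reduce[OF x] by blast
  define B where "B = (\<lambda>i. x ^ i) ` {..<m}"
  have B: "finite B" by (simp add: B_def)
  have memB: "x ^ i \<in> int_span B" if "i < m" for i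
    using that by (intro int_span_base[OF B]) (simp add: B_def)
  have xB: "x * b \<in> int_span B" if "b \<in> B" for b
  proof -
    obtain i where i: "i < m" "b = x ^ i" using \<open>b \<in> B\<close> by (auto simp: B_def)
    show ?thesis
    proof (cases "Suc i < m")
      case True
      then show ?thesis using memB[OF True] i by simp
    next
      case False
      then have "Suc i = m" using i by simp
      then have "x * b = (\<Sum>i<m. of_int (a i) * x ^ i)" using i m(2) by auto
      then show ?thesis using memB by (auto intro!: int_span_sum int_span_scale)
    qed
  qed
  have pow: "x ^ k \<in> int_span B" for k
  proof (induction k)
    case 0
    then show ?case using memB[OF m(1)] by simp
  next
    case (Suc k)
    then show ?case using int_span_stable[OF B xB] by simp
  qed
  have bound: "v u \<le> (\<Sum>b\<in>B. v b)" if "u \<in> int_span B" for u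
  proof -
    obtain c :: "'a \<Rightarrow> int" where "u = (\<Sum>b\<in>B. of_int (c b) * b)" using \<open>u \<in> int_span B\<close> unfolding int_span_def by auto
    then have "v u \<le> (\<Sum>b\<in>B. v (of_int (c b) * b))" using absolute_value_sum[OF av] by simp
    also have "\<dots> \<le> (\<Sum>b\<in>B. v b)"
      using nonarch_place_of_int[OF v] absolute_valueD(1)[OF av]
      by (intro sum_mono) (simp add: absolute_valueD(3)[OF av] mult_left_le_one_le)
    finally show ?thesis .
  qed
  obtain k where "(\<Sum>b\<in>B. v b) < v x ^ k" using real_arch_pow[OF gt] by blast
  then show False using bound[OF pow[of k]] by (simp add: absolute_value_power[OF av])
qed

lemma max_1_powr:
  fixes t :: real
  assumes "t \<ge> 0" "a > 0"
  shows "max 1 (t powr a) = max 1 t powr a"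
proof (cases "t \<le> 1")
  case True
  then have "t powr a \<le> 1" using assms powr_mono2[of a t 1] by simp
  with True show ?thesis by simp
next
  case False
  then have "t powr a \<ge> 1" using assms ge_one_powr_ge_zero[of t a] by simp
  with False show ?thesis by simp
qed

lemma dense_sequence:
  fixes s :: "'a \<Rightarrow> 'b :: metric_space"
  assumes "\<And>e. e > 0 \<Longrightarrow> \<exists>x. dist (s x) z < e"
  shows "\<exists>f. (\<lambda>n. s (f n)) \<longlonglongrightarrow> z"
proof -
  have "\<forall>n. \<exists>x. dist (s x) z < 1 / Suc n" using assms by simp
  then obtain f where f: "\<And>n. dist (s (f n)) z < 1 / Suc n" by metis
  have "(\<lambda>n. dist (s (f n)) z) \<longlonglongrightarrow> 0"
  proof (rule Lim_null_comparison[OF _ LIMSEQ_inverse_real_of_nat])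
    have "norm (dist (s (f n)) z) \<le> inverse (real (Suc n))" for n
      using f[of n] by (simp add: inverse_eq_divide)
    then show "\<forall>\<^sub>F n in sequentially. norm (dist (s (f n)) z) \<le> inverse (real (Suc n))" by simp
  qed
  then have "(\<lambda>n. s (f n)) \<longlonglongrightarrow> z" by (rule tendsto_dist_iff[THEN iffD2])
  then show ?thesis by (rule exI[of _ f])
qed

context number_field_embeddings
begin

text \<open>The moduli at \<theta> and at \<theta> + 1 are the distances of
  \<open>\<sigma> i \<theta>\<close> from 0 and from -1. They determine the point up to reflection
  in the real axis, and the image of \<theta> determines the embedding.\<close>

lemma place_eq_iff:
  assumes "i < d" "j < d"
  shows "(\<lambda>x. cmod (\<sigma> i x)) = (\<lambda>x. cmod (\<sigma> j x)) \<longleftrightarrow> j = i \<or> j = conj_index i"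
proof
  assume "(\<lambda>x. cmod (\<sigma> i x)) = (\<lambda>x. cmod (\<sigma> j x))"
  then have eq: "cmod (\<sigma> i x) = cmod (\<sigma> j x)" for x by (rule fun_cong)
  let ?a = "\<sigma> i \<theta>" and ?b = "\<sigma> j \<theta>"
  have 1: "(Re ?a)\<^sup>2 + (Im ?a)\<^sup>2 = (Re ?b)\<^sup>2 + (Im ?b)\<^sup>2"
    using eq[of \<theta>] by (metis cmod_power2)
  have "cmod (?a + 1) = cmod (?b + 1)" using eq[of "\<theta> + 1"] assms by (simp add: \<sigma>_simps)
  then have "(Re ?a + 1)\<^sup>2 + (Im ?a)\<^sup>2 = (Re ?b + 1)\<^sup>2 + (Im ?b)\<^sup>2"
    using cmod_power2[of "?a + 1"] cmod_power2[of "?b + 1"] by simp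
  with 1 have "Re ?a = Re ?b" by (simp add: power2_eq_square algebra_simps)
  with 1 have "Im ?a = Im ?b \<or> Im ?a = - Im ?b" by (simp add: power2_eq_iff)
  then have "?b = ?a \<or> ?b = \<sigma> (conj_index i) \<theta>"
    using \<open>Re ?a = Re ?b\<close> conj_index(2)[OF assms(1)] by (auto simp: complex_eq_iff)
  then show "j = i \<or> j = conj_index i"
    using \<sigma>_inj[OF assms(2,1)] \<sigma>_inj[OF assms(2) conj_index(1)[OF assms(1)]] by blast
qed (use conj_index(2)[OF assms(1)] in auto)

lemma real_hom_Re:
  assumes "i < d" "conj_index i = i"
  shows "field_char_0_hom (\<lambda>x. Re (\<sigma> i x))" "cmod (\<sigma> i x) = \<bar>Re (\<sigma> i x)\<bar>" "\<sigma> i x = of_real (Re (\<sigma> i x))"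
proof -
  have r: "\<sigma> i x \<in> \<real>" for x using conj_index_fixed[OF assms(1)] assms(2) by simp
  then have im: "Im (\<sigma> i x) = 0" for x by (simp add: complex_is_Real_iff)
  show "field_char_0_hom (\<lambda>x. Re (\<sigma> i x))"
    by unfold_locales (use assms im in \<open>simp_all add: \<sigma>_simps\<close>)
  show "cmod (\<sigma> i x) = \<bar>Re (\<sigma> i x)\<bar>" using im by (simp add: cmod_eq_Re)
  show "\<sigma> i x = of_real (Re (\<sigma> i x))" using im by (simp add: complex_eq_iff)
qed

lemma real_place_iff:
  assumes i: "i < d"
  shows "real_place (\<lambda>x. cmod (\<sigma> i x)) \<longleftrightarrow> conj_index i = i"
proof
  assume "conj_index i = i"
  note r = real_hom_Re[OF i this]
  show "real_place (\<lambda>x. cmod (\<sigma> i x))"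
    unfolding real_place_def ring_hom_type_algebra_eq
    by (rule bexI[of _ "\<lambda>x. Re (\<sigma> i x)"]) (simp_all add: r(1,2))
next
  assume "real_place (\<lambda>x. cmod (\<sigma> i x))"
  then obtain \<tau> where \<tau>: "field_char_0_hom \<tau>" "(\<lambda>x. cmod (\<sigma> i x)) = (\<lambda>x. \<bar>\<tau> x\<bar>)"
    unfolding real_place_def ring_hom_type_algebra_eq by auto
  interpret t: field_char_0_hom \<tau> by (rule \<tau>(1))
  have "field_char_0_hom (\<lambda>x. complex_of_real (\<tau> x))"
    by unfold_locales (simp_all add: t.hom_add t.hom_mult)
  then obtain j where j: "j < d" "\<sigma> j = (\<lambda>x. complex_of_real (\<tau> x))" using \<sigma>_surj by blast
  then have cj: "conj_index j = j" using conj_index_fixed by simp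
  have "(\<lambda>x. cmod (\<sigma> i x)) = (\<lambda>x. cmod (\<sigma> j x))" unfolding \<tau>(2) j(2) by simp
  then have "j = i \<or> j = conj_index i" using place_eq_iff[OF i j(1)] by simp
  then show "conj_index i = i" using cj conj_index_conj_index[OF i] by auto
qed

text \<open>The image of the field is dense in the reals or in the complex numbers: in the real case
  approximate the same real number at all embeddings, otherwise prescribe \<open>z\<close> at
  \<open>i\<close>, its conjugate at the conjugate index and 0 elsewhere.\<close>

lemma local_degree_place:
  assumes i: "i < d"
  shows "local_degree (\<lambda>x. cmod (\<sigma> i x)) = (if conj_index i = i then 1 else 2)"
proof (cases "conj_index i = i")
  case True
  note r = real_hom_Re[OF i True]
  have "\<exists>f. (\<lambda>n. Re (\<sigma> i (f n))) \<longlonglongrightarrow> z" for z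
  proof (rule dense_sequence)
    fix e :: real assume "e > 0"
    then obtain x where "\<forall>j<d. cmod (\<sigma> j x - of_real z) < e"
      using embeddings_dense[of "\<lambda>_. of_real z" e] by auto
    then have "cmod (\<sigma> i x - of_real z) < e" using i by simp
    moreover have "\<sigma> i x - of_real z = of_real (Re (\<sigma> i x)) - of_real z" by (subst r(3)) (rule refl)
    ultimately have "cmod (of_real (Re (\<sigma> i x) - z)) < e" by (simp only: of_real_diff)
    then have "dist (Re (\<sigma> i x)) z < e" by (simp only: dist_real_def norm_of_real)
    then show "\<exists>x. dist (Re (\<sigma> i x)) z < e" by (rule exI)
  qed
  moreover have "(\<lambda>x. cmod (\<sigma> i x)) = (\<lambda>x. norm (Re (\<sigma> i x)))" using r(2) by (simp only: real_norm_def)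
  ultimately have "local_degree (\<lambda>x. cmod (\<sigma> i x)) = 1"
    by (intro local_degree_eq_dimension[OF r(1)] dimension_real_complex(1))
  then show ?thesis using True by simp
next
  case False
  have "\<exists>f. (\<lambda>n. \<sigma> i (f n)) \<longlonglongrightarrow> z" for z
  proof (rule dense_sequence)
    fix e :: real assume "e > 0"
    define a where "a j = (if j = i then z else if j = conj_index i then cnj z else 0)" for j
    have "a (conj_index j) = cnj (a j)" if j: "j < d" for j
    proof -
      have "conj_index j = i \<longleftrightarrow> j = conj_index i" "conj_index j = conj_index i \<longleftrightarrow> j = i"
        using conj_index_conj_index[OF i] conj_index_conj_index[OF j] by metis+
      then show ?thesis using False by (simp add: a_def)
    qed
    from embeddings_dense[of a, OF this \<open>e > 0\<close>] obtain x where "cmod (\<sigma> i x - a i) < e" using i by blast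
    then have "dist (\<sigma> i x) z < e" by (simp add: a_def dist_norm)
    then show "\<exists>x. dist (\<sigma> i x) z < e" by (rule exI)
  qed
  then have "local_degree (\<lambda>x. cmod (\<sigma> i x)) = 2"
    by (intro local_degree_eq_dimension[OF hom_\<sigma>[OF i]] dimension_real_complex(2)) simp_all
  then show ?thesis using False by simp
qed

lemma place_fiber:
  assumes "i < d"
  shows "{j \<in> {..<d}. (\<lambda>x. cmod (\<sigma> j x)) = (\<lambda>x. cmod (\<sigma> i x))} = {i, conj_index i}"
  using place_eq_iff[OF assms] assms conj_index(1)[OF assms] by (auto simp: eq_commute[of _ "\<lambda>x. cmod (\<sigma> i x)"])

text \<open>Each complex place is induced by exactly two embeddings, \<open>i\<close> and
  \<open>conj_index i\<close>.\<close>

lemma card_nonreal_indices: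
  "card {i. i < d \<and> conj_index i \<noteq> i} = 2 * num_complex_places TYPE('a)"
proof -
  let ?N = "{i. i < d \<and> conj_index i \<noteq> i}" and ?p = "\<lambda>i x. cmod (\<sigma> i x)"
  have im: "{v :: 'a \<Rightarrow> real. v \<in> arch_places \<and> \<not> real_place v} = ?p ` ?N"
    unfolding arch_places_eq using real_place_iff by auto
  have fib: "card {i \<in> ?N. ?p i = v} = 2" if v: "v \<in> ?p ` ?N" for v
  proof -
    obtain i where i: "i < d" "conj_index i \<noteq> i" "v = ?p i" using v by auto
    have "{j \<in> ?N. ?p j = v} = {j \<in> {..<d}. ?p j = ?p i} \<inter> {j. conj_index j \<noteq> j}"
      unfolding i(3) by (rule Set.set_eqI) (simp only: mem_Collect_eq Int_iff lessThan_iff conj_ac)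
    also have "\<dots> = {i, conj_index i}"
      unfolding place_fiber[OF i(1)] using i(2) conj_index_conj_index[OF i(1)] by auto
    finally have "{j \<in> ?N. ?p j = v} = {i, conj_index i}" .
    then show ?thesis using i(2) by simp
  qed
  have "card ?N = (\<Sum>v\<in>?p ` ?N. card {i \<in> ?N. ?p i = v})"
    using sum.image_gen[of ?N "\<lambda>_. 1::nat" ?p] by simp
  also have "\<dots> = (\<Sum>v\<in>?p ` ?N. 2)" by (rule sum.cong[OF refl fib])
  also have "\<dots> = 2 * card (?p ` ?N)" by simp
  finally show ?thesis unfolding num_complex_places_def im .
qed

text \<open>Finite places contribute 1. At an archimedean place the local degree is the number of
  embeddings inducing it, so the exponent \<open>local_degree / d\<close> spreads out as
  \<open>1 / d\<close> for every embedding.\<close>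

lemma weil_height_eq:
  assumes x: "algebraic_int (x :: 'a)"
  shows "weil_height x = (\<Prod>i<d. max 1 (cmod (\<sigma> i x))) powr (1 / d)"
proof -
  let ?p = "\<lambda>i x. cmod (\<sigma> i x)"
  let ?h = "\<lambda>v. max 1 (normalized_abs v x)"
  have d: "real d > 0" using degree_pos by simp
  have fin: "finite (arch_places :: ('a \<Rightarrow> real) set)" unfolding arch_places_eq by simp
  have non: "?h v = 1" if v: "v \<in> nonarch_places" for v
  proof -
    have "v x \<ge> 0" using v absolute_valueD(1) unfolding nonarch_places_def by blast
    then have "normalized_abs v x \<le> 1"
      unfolding normalized_abs_def using nonarch_place_algebraic_int[OF v x] by (intro powr_le1) auto
    then show ?thesis by simp
  qed
  have "{v \<in> places. ?h v \<noteq> 1} = {v \<in> arch_places. ?h v \<noteq> 1}"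
    unfolding places_def using non by auto
  then have "weil_height x = (\<Prod>v\<in>{v \<in> arch_places. ?h v \<noteq> 1}. ?h v)" unfolding weil_height_def by simp
  also have "\<dots> = (\<Prod>v\<in>arch_places. ?h v)" by (rule prod.mono_neutral_left[OF fin]) auto
  also have "\<dots> = (\<Prod>v\<in>?p ` {..<d}. \<Prod>i\<in>{i \<in> {..<d}. ?p i = v}. max 1 (?p i x) powr (1 / d))"
    unfolding arch_places_eq
  proof (rule prod.cong[OF refl])
    fix v assume "v \<in> ?p ` {..<d}"
    then obtain i where i: "i < d" "v = ?p i" by auto
    let ?k = "local_degree v"
    have k: "?k = card {i, conj_index i}" "?k > 0"
      using local_degree_place[OF i(1)] i(2) by auto
    have "?h v = max 1 (v x) powr (real ?k / d)"
      unfolding normalized_abs_def field_degree_eq using d k(2) i(2) by (intro max_1_powr) auto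
    also have "\<dots> = (max 1 (v x) powr (1 / d)) ^ ?k"
      by (simp add: powr_powr flip: powr_realpow)
    also have "\<dots> = (\<Prod>j\<in>{j \<in> {..<d}. ?p j = v}. max 1 (v x) powr (1 / d))"
      unfolding i(2) place_fiber[OF i(1)] using k(1) i(2) by simp
    also have "\<dots> = (\<Prod>j\<in>{j \<in> {..<d}. ?p j = v}. max 1 (?p j x) powr (1 / d))"
      by (rule prod.cong) auto
    finally show "?h v = (\<Prod>j\<in>{j \<in> {..<d}. ?p j = v}. max 1 (?p j x) powr (1 / d))" .
  qed
  also have "\<dots> = (\<Prod>i<d. max 1 (?p i x) powr (1 / d))"
    by (rule prod.image_gen[symmetric]) simp
  also have "\<dots> = (\<Prod>i<d. max 1 (cmod (\<sigma> i x))) powr (1 / d)"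
    by (rule prod_powr_distrib[symmetric])
  finally show ?thesis .
qed

end

section \<open>The convex body argument\<close>

lemma sum_two_indices:
  fixes u :: "nat \<Rightarrow> 'b :: comm_ring_1"
  assumes "i < n" "j < n"
  shows "(\<Sum>k<n. (a * of_bool (k = i) + b * of_bool (k = j)) * u k) = a * u i + b * u j"
proof -
  have "(\<Sum>k<n. (a * of_bool (k = i) + b * of_bool (k = j)) * u k)
     = (\<Sum>k<n. (if k = i then a * u k else 0) + (if k = j then b * u k else 0))"
    by (intro sum.cong refl) (simp add: distrib_right)
  then show ?thesis using assms by (simp add: sum.distrib)
qed

context number_field_embeddings
begin

text \<open>
  A pair of conjugate embeddings contributes the rows \<open>Re + Im\<close> and \<open>Re - Im\<close>. The passage to them from
  the two embeddings is unitary, so, unlike with the customary \<open>Re\<close> and \<open>Im\<close>, the determinant keeps its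
  modulus and no power of two enters.
\<close>
definition real_embedding_mat :: "(nat \<Rightarrow> 'a) \<Rightarrow> real mat" where
  "real_embedding_mat b = Matrix.mat d d (\<lambda>(i, j). Re (\<sigma> i (b j)) - Im (\<sigma> i (b j)))"

lemma abs_det_real_embedding_mat: "\<bar>det (real_embedding_mat b)\<bar> = cmod (det (embedding_mat b))"
proof -
  \<comment> \<open>Recovers \<open>z\<close> as \<open>(1 - \<i>) / 2 * (Re z - Im z) + (1 + \<i>)
    / 2 * (Re z + Im z)\<close> from the rows \<open>i\<close> and \<open>conj_index i\<close>. At a
    real embedding the two coefficients meet in one column and add up to 1.\<close>
  define C where "C = Matrix.mat d d (\<lambda>(i, k). (1 - \<i>) / 2 * of_bool (k = i) + (1 + \<i>) / 2 * of_bool (k = conj_index i))"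
  let ?M = "map_mat complex_of_real (real_embedding_mat b)"
  let ?C' = "map_mat cnj C"
  have C: "C \<in> carrier_mat d d" and M: "?M \<in> carrier_mat d d" and C': "?C' \<in> carrier_mat d d"
    by (simp_all add: C_def real_embedding_mat_def)
  have "embedding_mat b = C * ?M"
  proof (rule eq_matI)
    fix i j assume "i < dim_row (C * ?M)" "j < dim_col (C * ?M)"
    then have ij: "i < d" "j < d" using C M by auto
    let ?z = "\<sigma> i (b j)"
    have "(C * ?M) $$ (i, j) = (\<Sum>k<d. ((1 - \<i>) / 2 * of_bool (k = i) + (1 + \<i>) / 2 * of_bool (k = conj_index i)) * ?M $$ (k, j))"
      using ij C M by (auto simp: C_def scalar_prod_def lessThan_atLeast0 intro!: sum.cong)
    also have "\<dots> = (1 - \<i>) / 2 * ?M $$ (i, j) + (1 + \<i>) / 2 * ?M $$ (conj_index i, j)"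
      by (rule sum_two_indices[OF ij(1) conj_index(1)[OF ij(1)]])
    also have "?M $$ (i, j) = of_real (Re ?z - Im ?z)"
      using ij by (simp add: real_embedding_mat_def)
    also have "?M $$ (conj_index i, j) = of_real (Re ?z + Im ?z)"
      using ij conj_index[OF ij(1)] by (simp add: real_embedding_mat_def)
    also have "(1 - \<i>) / 2 * of_real (Re ?z - Im ?z) + (1 + \<i>) / 2 * of_real (Re ?z + Im ?z) = ?z"
      by (simp add: complex_eq_iff field_simps)
    finally show "embedding_mat b $$ (i, j) = (C * ?M) $$ (i, j)"
      using ij by (simp add: embedding_mat_def)
  qed (simp_all add: C_def real_embedding_mat_def embedding_mat_def)
  then have "det (embedding_mat b) = det C * det ?M" using det_mult[OF C M] by simp
  also have "det ?M = of_real (det (real_embedding_mat b))" by (rule of_real_hom.hom_det)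
  finally have det: "cmod (det (embedding_mat b)) = cmod (det C) * \<bar>det (real_embedding_mat b)\<bar>"
    by (simp add: norm_mult)
  \<comment> \<open>\<open>C\<close> is symmetric because \<open>conj_index\<close> is an
    involution, so its entrywise conjugate is its adjoint and the identity says that
    \<open>C\<close> is unitary.\<close>
  have "C * ?C' = 1\<^sub>m d"
  proof (rule eq_matI)
    fix i l assume "i < dim_row (1\<^sub>m d :: complex mat)" "l < dim_col (1\<^sub>m d :: complex mat)"
    then have il: "i < d" "l < d" by auto
    have ci: "conj_index i < d" by (rule conj_index(1)[OF il(1)])
    have "(C * ?C') $$ (i, l) = (\<Sum>k<d. ((1 - \<i>) / 2 * of_bool (k = i) + (1 + \<i>) / 2 * of_bool (k = conj_index i)) * ?C' $$ (k, l))"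
      using il C C' by (auto simp: C_def scalar_prod_def lessThan_atLeast0 intro!: sum.cong)
    also have "\<dots> = (1 - \<i>) / 2 * ?C' $$ (i, l) + (1 + \<i>) / 2 * ?C' $$ (conj_index i, l)"
      by (rule sum_two_indices[OF il(1) ci])
    also have "?C' $$ (i, l) = (1 + \<i>) / 2 * of_bool (l = i) + (1 - \<i>) / 2 * of_bool (l = conj_index i)"
      using il by (simp add: C_def)
    also have "?C' $$ (conj_index i, l) = (1 + \<i>) / 2 * of_bool (l = conj_index i) + (1 - \<i>) / 2 * of_bool (l = i)"
      using il ci conj_index_conj_index[OF il(1)] by (simp add: C_def)
    also have "(1 - \<i>) / 2 * ((1 + \<i>) / 2 * of_bool (l = i) + (1 - \<i>) / 2 * of_bool (l = conj_index i))
        + (1 + \<i>) / 2 * ((1 + \<i>) / 2 * of_bool (l = conj_index i) + (1 - \<i>) / 2 * of_bool (l = i)) = of_bool (l = i)"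
      by (simp add: complex_eq_iff field_simps)
    finally show "(C * ?C') $$ (i, l) = 1\<^sub>m d $$ (i, l)" using il by simp
  qed (simp_all add: C_def)
  then have "det C * det ?C' = 1" using det_mult[OF C C'] by simp
  moreover have "det ?C' = cnj (det C)"
  proof -
    interpret cnj: comm_ring_hom cnj by unfold_locales simp_all
    show ?thesis by (rule cnj.hom_det)
  qed
  ultimately have "of_real ((cmod (det C))\<^sup>2) = (1 :: complex)" by (simp only: complex_norm_square)
  then have "(cmod (det C))\<^sup>2 = 1" by (simp only: of_real_eq_1_iff)
  then have "cmod (det C) = 1" by (simp add: power2_eq_1_iff) (metis norm_ge_zero neg_0_le_iff_le not_one_le_zero)
  with det show ?thesis by simp
qed

text \<open>Minkowski's theorem, obtained from Blichfeldt's for the polydisc of half the radii: by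
  the triangle inequality the difference of two of its points lies in the full one. Pulling the body
  back to coordinates with respect to \<omega> turns the lattice into the integer vectors and
  divides the volume by the determinant.\<close>

lemma lattice_point_in_polydisc:
  assumes \<omega>: "rat_spanning \<omega>"
    and B: "\<And>i. i < d \<Longrightarrow> B i > 0" "\<And>i. i < d \<Longrightarrow> B (conj_index i) = B i"
    and vol: "cmod (det (embedding_mat \<omega>)) < (\<Prod>i<d. B i / 2 * (if conj_index i = i then 2 else sqrt (2 * pi)))"
  shows "\<exists>c :: nat \<Rightarrow> int. (\<exists>j<d. c j \<noteq> 0) \<and> (\<forall>i<d. cmod (\<sigma> i (\<Sum>j<d. of_int (c j) * \<omega> j)) < B i)"
proof -
  let ?L = "coord_measure {..<d}"
  let ?M = "real_embedding_mat \<omega>"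
  define z where "z i x = (\<Sum>j<d. of_real (x j) * \<sigma> i (\<omega> j))" for i and x :: "nat \<Rightarrow> real"
  define D where "D = {u \<in> space ?L. \<forall>i\<in>{..<d}. (u i)\<^sup>2 + (u (conj_index i))\<^sup>2 < 2 * (B i / 2)\<^sup>2}"
  define S where "S = mat_apply d ?M -` D \<inter> space ?L"
  have r: "conj_index \<in> {..<d} \<rightarrow> {..<d}" "\<And>i. i \<in> {..<d} \<Longrightarrow> conj_index (conj_index i) = i"
    "\<And>i. i \<in> {..<d} \<Longrightarrow> B i / 2 > 0" "\<And>i. i \<in> {..<d} \<Longrightarrow> B (conj_index i) / 2 = B i / 2"
    using conj_index(1) conj_index_conj_index B by auto
  have D: "D \<in> sets ?L"
    "emeasure ?L D = ennreal (\<Prod>i<d. B i / 2 * (if conj_index i = i then 2 else sqrt (2 * pi)))"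
    unfolding D_def
    by (rule emeasure_polydisc[of "{..<d}" conj_index "\<lambda>i. B i / 2", OF finite_lessThan r]; assumption)+
  have M: "?M \<in> carrier_mat d d" by (simp add: real_embedding_mat_def)
  have detM: "\<bar>det ?M\<bar> = cmod (det (embedding_mat \<omega>))" by (rule abs_det_real_embedding_mat)
  have "det ?M \<noteq> 0" using detM det_embedding_mat_nz[OF \<omega>] by auto
  from scales_by_det_nonsingular[OF M this] D(1)
  have eq: "ennreal \<bar>det ?M\<bar> * emeasure ?L S = emeasure ?L D" unfolding scales_by_det_def S_def by blast
  have S: "S \<in> sets ?L" unfolding S_def by (rule measurable_sets[OF measurable_mat_apply D(1)])
  have "emeasure ?L S > 1"
  proof (rule ccontr)
    assume "\<not> ?thesis"
    then have "ennreal \<bar>det ?M\<bar> * emeasure ?L S \<le> ennreal \<bar>det ?M\<bar> * 1" by (intro mult_left_mono) auto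
    then have "ennreal (\<Prod>i<d. B i / 2 * (if conj_index i = i then 2 else sqrt (2 * pi))) \<le> ennreal \<bar>det ?M\<bar>"
      unfolding eq D(2) mult_1_right .
    then have "(\<Prod>i<d. B i / 2 * (if conj_index i = i then 2 else sqrt (2 * pi))) \<le> \<bar>det ?M\<bar>"
      by (simp only: ennreal_le_iff abs_ge_zero)
    with vol detM show False by linarith
  qed
  then obtain x y where xy: "x \<in> S" "y \<in> S" "x \<noteq> y" "\<And>i. i < d \<Longrightarrow> x i - y i \<in> \<int>"
    by (rule blichfeldt[OF S]) blast
  have z_bound: "cmod (z i x) < B i / 2" if x: "x \<in> S" and i: "i < d" for x i
  proof -
    have app: "mat_apply d ?M x k = Re (z k x) - Im (z k x)" if "k < d" for k
      using that by (simp add: mat_apply_def real_embedding_mat_def z_def sum_subtractf[symmetric] algebra_simps)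
    have "z (conj_index i) x = cnj (z i x)"
      unfolding z_def by (simp add: conj_index(2)[OF i])
    then have "mat_apply d ?M x (conj_index i) = Re (z i x) + Im (z i x)"
      using app[OF conj_index(1)[OF i]] by simp
    \<comment> \<open>The left hand side is \<open>2 * |z i x|^2\<close>, which cancels the factor 2
      in the definition of \<open>D\<close>.\<close>
    moreover have "(mat_apply d ?M x i)\<^sup>2 + (mat_apply d ?M x (conj_index i))\<^sup>2 < 2 * (B i / 2)\<^sup>2"
      using x i unfolding S_def D_def by simp
    ultimately have "(Re (z i x))\<^sup>2 + (Im (z i x))\<^sup>2 < (B i / 2)\<^sup>2"
      using app[OF i] by (simp add: power2_eq_square algebra_simps)
    then have "(cmod (z i x))\<^sup>2 < (B i / 2)\<^sup>2" by (simp only: cmod_power2)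
    then show ?thesis by (rule power2_less_imp_less) (use B(1)[OF i] in simp)
  qed
  define c where "c j = \<lfloor>x j - y j\<rfloor>" for j
  have c: "of_int (c j) = x j - y j" if "j < d" for j
    using xy(4)[OF that] by (auto simp: c_def elim!: Ints_cases)
  show ?thesis
  proof (intro exI[of _ c] conjI allI impI)
    have "x \<in> space ?L" "y \<in> space ?L" using xy(1,2) by (auto simp: S_def)
    then obtain j where "j < d" "x j \<noteq> y j" using xy(3) unfolding space_PiM by (metis PiE_ext lessThan_iff)
    then show "\<exists>j<d. c j \<noteq> 0" using c by (metis eq_iff_diff_eq_0 of_int_0)
  next
    fix i assume i: "i < d"
    have "\<sigma> i (\<Sum>j<d. of_int (c j) * \<omega> j) = (\<Sum>j<d. of_real (of_int (c j)) * \<sigma> i (\<omega> j))"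
      using i by (simp add: \<sigma>_simps)
    also have "\<dots> = z i x - z i y"
      using c by (simp add: z_def sum_subtractf[symmetric] left_diff_distrib)
    also have "cmod \<dots> \<le> cmod (z i x) + cmod (z i y)" by (rule norm_triangle_ineq4)
    also have "\<dots> < B i" using z_bound[OF xy(1) i] z_bound[OF xy(2) i] by simp
    finally show "cmod (\<sigma> i (\<Sum>j<d. of_int (c j) * \<omega> j)) < B i" .
  qed
qed

text \<open>The inverse matrix of embeddings turns a bound on all conjugates into one on the integer
  coordinates.\<close>

lemma finite_bounded_algebraic_ints:
  fixes \<omega> :: "nat \<Rightarrow> 'a"
  assumes \<omega>: "integral_basis \<omega>"
  shows "finite {x :: 'a. algebraic_int x \<and> (\<forall>i<d. cmod (\<sigma> i x) \<le> R)}"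
proof -
  let ?E = "embedding_mat \<omega>"
  have E: "?E \<in> carrier_mat d d" by simp
  obtain Q where Q: "Q \<in> carrier_mat d d" "Q * ?E = 1\<^sub>m d"
    using det_non_zero_imp_unit[OF E det_embedding_mat_nz[OF integral_basis_spanning[OF \<omega>]], of undefined]
    by (auto simp: Units_def ring_mat_def)
  define N where "N = \<lceil>\<Sum>j<d. \<Sum>i<d. cmod (Q $$ (j, i)) * R\<rceil>"
  have "{x. algebraic_int x \<and> (\<forall>i<d. cmod (\<sigma> i x) \<le> R)}
      \<subseteq> (\<lambda>c. \<Sum>j<d. of_int (c j) * \<omega> j) ` ({..<d} \<rightarrow>\<^sub>E {- N..N})"
  proof
    fix x assume "x \<in> {x. algebraic_int x \<and> (\<forall>i<d. cmod (\<sigma> i x) \<le> R)}"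
    then have x: "algebraic_int x" "\<And>i. i < d \<Longrightarrow> cmod (\<sigma> i x) \<le> R" by auto
    have R: "R \<ge> 0" using x(2)[OF degree_pos] norm_ge_zero order_trans by blast
    obtain c :: "nat \<Rightarrow> int" where c: "c \<in> {..<d} \<rightarrow>\<^sub>E UNIV" "x = (\<Sum>j<d. of_int (c j) * \<omega> j)"
      using \<omega> x(1) unfolding integral_basis_def field_degree_eq by blast
    let ?v = "Matrix.vec d (\<lambda>j. of_int (c j) :: complex)"
    have Ev: "?E *\<^sub>v ?v = Matrix.vec d (\<lambda>i. \<sigma> i x)"
      by (rule eq_vecI) (auto simp: embedding_mat_def scalar_prod_def lessThan_atLeast0 c(2) \<sigma>_simps mult.commute intro!: sum.cong)
    have Qv: "Q *\<^sub>v Matrix.vec d (\<lambda>i. \<sigma> i x) = ?v"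
      unfolding Ev[symmetric] assoc_mult_mat_vec[OF Q(1) E vec_carrier, symmetric] Q(2) by simp
    have "\<bar>c j\<bar> \<le> N" if j: "j < d" for j
    proof -
      have "of_int (c j) = (\<Sum>i<d. Q $$ (j, i) * \<sigma> i x)"
      proof -
        have "vec_index (Q *\<^sub>v Matrix.vec d (\<lambda>i. \<sigma> i x)) j = (\<Sum>i<d. Q $$ (j, i) * \<sigma> i x)"
          using j Q(1) by (auto simp: scalar_prod_def lessThan_atLeast0 intro!: sum.cong)
        then show ?thesis using j unfolding Qv by simp
      qed
      then have "cmod (of_int (c j)) \<le> (\<Sum>i<d. cmod (Q $$ (j, i) * \<sigma> i x))" by (simp only: norm_sum)
      also have "\<dots> \<le> (\<Sum>i<d. cmod (Q $$ (j, i)) * R)"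
        using x(2) by (intro sum_mono) (auto simp: norm_mult intro: mult_left_mono)
      also have "\<dots> \<le> (\<Sum>j<d. \<Sum>i<d. cmod (Q $$ (j, i)) * R)"
        by (rule member_le_sum) (use j R in \<open>auto intro: sum_nonneg\<close>)
      finally have "real_of_int \<bar>c j\<bar> \<le> (\<Sum>j<d. \<Sum>i<d. cmod (Q $$ (j, i)) * R)" by (simp add: norm_of_int)
      then show ?thesis unfolding N_def by (simp add: le_ceiling_iff)
    qed
    then have "- N \<le> c j \<and> c j \<le> N" if "j < d" for j using that by (fastforce simp: abs_le_iff)
    then have "c \<in> {..<d} \<rightarrow>\<^sub>E {- N..N}" using c(1) by (simp add: PiE_iff)
    then show "x \<in> (\<lambda>c. \<Sum>j<d. of_int (c j) * \<omega> j) ` ({..<d} \<rightarrow>\<^sub>E {- N..N})"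
      using c(2) by (intro image_eqI)
  qed
  moreover have "finite ({..<d} \<rightarrow>\<^sub>E {- N..N})" by (intro finite_PiE finite_lessThan finite_atLeastAtMost_int)
  ultimately show ?thesis using finite_surj by blast
qed

text \<open>
  The closed bound at \<open>w\<close> makes the volume exactly critical. It is relaxed by a factor \<open>t > 1\<close>, and since
  only finitely many algebraic integers are bounded at all embeddings, one of them serves all \<open>t\<close>.
\<close>
lemma small_algebraic_int:
  fixes \<omega> :: "nat \<Rightarrow> 'a"
  assumes \<omega>: "integral_basis \<omega>" and w: "w < d" "conj_index w \<noteq> w"
    and m: "\<And>i. i < d \<Longrightarrow> m i > 0" "\<And>i. i < d \<Longrightarrow> m (conj_index i) = m i"
  obtains \<alpha> where "algebraic_int \<alpha>" "\<alpha> \<noteq> 0"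
    "\<And>i. i < d \<Longrightarrow> i \<noteq> w \<Longrightarrow> i \<noteq> conj_index w \<Longrightarrow> cmod (\<sigma> i \<alpha>) < m i"
    "(cmod (\<sigma> w \<alpha>))\<^sup>2 * (\<Prod>i\<in>{..<d} - {w, conj_index w}. m i)
       \<le> (2 / pi) ^ num_complex_places TYPE('a) * cmod (det (embedding_mat \<omega>))"
proof -
  let ?I = "{..<d} - {w, conj_index w}"
  let ?s = "num_complex_places TYPE('a)"
  define P where "P = (\<Prod>i\<in>?I. m i)"
  have P: "P > 0" unfolding P_def using m(1) by (intro prod_pos) auto
  \<comment> \<open>The radius at \<open>w\<close> and its conjugate for which the volume in
    Minkowski's theorem exactly equals the determinant.\<close>
  define b where "b = sqrt ((2 / pi) ^ ?s * cmod (det (embedding_mat \<omega>)) / P)"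
  have sp: "rat_spanning \<omega>" by (rule integral_basis_spanning[OF \<omega>])
  have det: "cmod (det (embedding_mat \<omega>)) > 0" using det_embedding_mat_nz[OF sp] by simp
  have b: "b > 0" "b\<^sup>2 * P = (2 / pi) ^ ?s * cmod (det (embedding_mat \<omega>))"
    using det P by (simp_all add: b_def)
  have cw: "conj_index w < d" "conj_index (conj_index w) = w"
    using conj_index(1)[OF w(1)] conj_index_conj_index[OF w(1)] by auto
  define A where "A t = {\<alpha>. algebraic_int \<alpha> \<and> \<alpha> \<noteq> 0 \<and> (\<forall>i\<in>?I. cmod (\<sigma> i \<alpha>) < m i) \<and> cmod (\<sigma> w \<alpha>) < t * b}" for t
  have A_ne: "A t \<noteq> {}" if t: "t > 1" for t
  proof -
    define B where "B i = (if i = w \<or> i = conj_index w then t * b else m i)" for i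
    have B1: "B i > 0" if "i < d" for i using m(1)[OF that] b(1) t by (simp add: B_def)
    have B2: "B (conj_index i) = B i" if "i < d" for i
    proof -
      have "conj_index i = w \<longleftrightarrow> i = conj_index w" "conj_index i = conj_index w \<longleftrightarrow> i = w"
        using conj_index_conj_index[OF w(1)] conj_index_conj_index[OF that] by metis+
      then show ?thesis using m(2)[OF that] by (simp add: B_def disj_commute)
    qed
    \<comment> \<open>Halving the radius leaves the factor 1 at a real index and
      \<open>sqrt (pi / 2)\<close> at a non-real one. There are twice as many non-real indices as
      complex places, so \<open>(pi / 2) ^ s\<close> results, the origin of \<open>2 / pi\<close> in
      \<open>c_const\<close>.\<close>
    define g where "g i = (if conj_index i = i then 1 else sqrt (pi / 2))" for i
    have g: "B i / 2 * (if conj_index i = i then 2 else sqrt (2 * pi)) = B i * g i" for i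
    proof -
      have "sqrt (2 * pi) = sqrt (4 * (pi / 2))" by simp
      also have "\<dots> = sqrt 4 * sqrt (pi / 2)" by (rule real_sqrt_mult)
      also have "sqrt 4 = (2 :: real)" using real_sqrt_abs[of 2] by simp
      finally show ?thesis by (simp add: g_def)
    qed
    have "(\<Prod>i<d. g i) = (\<Prod>i\<in>{i. i < d \<and> conj_index i \<noteq> i}. sqrt (pi / 2))"
      unfolding g_def by (rule prod.mono_neutral_cong_right) auto
    also have "\<dots> = (sqrt (pi / 2)) ^ (2 * ?s)" by (simp add: card_nonreal_indices)
    also have "\<dots> = (pi / 2) ^ ?s" by (simp add: power_mult)
    finally have gs: "(\<Prod>i<d. g i) = (pi / 2) ^ ?s" .
    have "(\<Prod>i<d. B i) = (\<Prod>i\<in>{w, conj_index w}. B i) * (\<Prod>i\<in>?I. B i)"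
      using w(1) cw(1) by (subst prod.subset_diff[of "{w, conj_index w}" "{..<d}"]) auto
    also have "(\<Prod>i\<in>{w, conj_index w}. B i) = (t * b)\<^sup>2"
      using w(2) by (simp add: B_def power2_eq_square)
    also have "(\<Prod>i\<in>?I. B i) = P" unfolding P_def by (rule prod.cong) (auto simp: B_def)
    finally have Bs: "(\<Prod>i<d. B i) = t\<^sup>2 * ((2 / pi) ^ ?s * cmod (det (embedding_mat \<omega>)))"
      using b(2) by (simp add: power_mult_distrib)
    have "(2 / pi) ^ ?s * (pi / 2) ^ ?s = 1" by (simp add: power_mult_distrib[symmetric])
    then have "(\<Prod>i<d. B i * g i) = t\<^sup>2 * cmod (det (embedding_mat \<omega>))"
      unfolding prod.distrib gs Bs by (simp add: mult_ac)
    also have "\<dots> > 1 * cmod (det (embedding_mat \<omega>))"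
      using t det by (intro mult_strict_right_mono) (simp_all add: one_less_power)
    finally have vol: "cmod (det (embedding_mat \<omega>)) < (\<Prod>i<d. B i / 2 * (if conj_index i = i then 2 else sqrt (2 * pi)))"
      by (simp only: g mult_1_left)
    have "\<exists>c :: nat \<Rightarrow> int. (\<exists>j<d. c j \<noteq> 0) \<and> (\<forall>i<d. cmod (\<sigma> i (\<Sum>j<d. of_int (c j) * \<omega> j)) < B i)"
      using lattice_point_in_polydisc[OF sp B1 B2 vol] by simp
    then obtain c :: "nat \<Rightarrow> int"
      where c: "\<exists>j<d. c j \<noteq> 0" "\<And>i. i < d \<Longrightarrow> cmod (\<sigma> i (\<Sum>j<d. of_int (c j) * \<omega> j)) < B i"
      by blast
    let ?\<alpha> = "\<Sum>j<d. of_int (c j) * \<omega> j"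
    have "algebraic_int ?\<alpha>"
      using \<omega> unfolding integral_basis_def field_degree_eq
      by (intro algebraic_int_sum algebraic_int_times algebraic_int_of_int) auto
    moreover have "?\<alpha> \<noteq> 0"
    proof
      assume "?\<alpha> = 0"
      then have "(\<Sum>j<d. of_rat (of_int (c j)) * \<omega> j) = 0" by simp
      then have "(of_int (c j) :: rat) = 0" if "j < d" for j
        by (rule rat_spanning_independent[OF sp, of "\<lambda>j. of_int (c j)"]) (rule that)
      with c(1) show False by auto
    qed
    moreover have "cmod (\<sigma> i ?\<alpha>) < m i" if "i \<in> ?I" for i
      using c(2)[of i] that by (auto simp: B_def)
    moreover have "cmod (\<sigma> w ?\<alpha>) < t * b" using c(2)[OF w(1)] by (simp add: B_def)
    ultimately have "?\<alpha> \<in> A t" unfolding A_def by blast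
    then show ?thesis by blast
  qed
  have "finite (A 2)"
  proof (rule finite_subset[OF _ finite_bounded_algebraic_ints[OF \<omega>]])
    show "A 2 \<subseteq> {x. algebraic_int x \<and> (\<forall>i<d. cmod (\<sigma> i x) \<le> max (2 * b) (Max (m ` {..<d})))}"
    proof
      fix \<alpha> assume \<alpha>: "\<alpha> \<in> A 2"
      have "cmod (\<sigma> i \<alpha>) \<le> max (2 * b) (Max (m ` {..<d}))" if i: "i < d" for i
      proof (cases "i \<in> ?I")
        case True
        then have "cmod (\<sigma> i \<alpha>) < m i" using \<alpha> by (simp add: A_def)
        also have "m i \<le> Max (m ` {..<d})" using i by (intro Max_ge) auto
        finally show ?thesis by simp
      next
        case False
        then have "cmod (\<sigma> i \<alpha>) = cmod (\<sigma> w \<alpha>)" using i conj_index(2)[OF w(1)] by auto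
        then show ?thesis using \<alpha> by (simp add: A_def le_max_iff_disj)
      qed
      then show "\<alpha> \<in> {x. algebraic_int x \<and> (\<forall>i<d. cmod (\<sigma> i x) \<le> max (2 * b) (Max (m ` {..<d})))}"
        using \<alpha> by (simp add: A_def)
    qed
  qed
  have "\<exists>\<alpha>\<in>A 2. cmod (\<sigma> w \<alpha>) \<le> b"
  proof (rule ccontr)
    assume "\<not> ?thesis"
    then have gt: "\<And>\<alpha>. \<alpha> \<in> A 2 \<Longrightarrow> b < cmod (\<sigma> w \<alpha>)" by (simp add: not_le)
    define k where "k = Min ((\<lambda>\<alpha>. cmod (\<sigma> w \<alpha>)) ` A 2)"
    have "b < k" unfolding k_def using gt \<open>finite (A 2)\<close> A_ne[of 2] by (subst Min_gr_iff) auto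
    \<comment> \<open>\<open>t \<le> 2\<close> places \<open>A t\<close> inside \<open>A 2\<close>,
      and \<open>t * b \<le> k\<close> forces its elements below the minimum \<open>k\<close> at
      \<open>w\<close>; but \<open>A t\<close> is not empty.\<close>
    define t where "t = min 2 (k / b)"
    have "t > 1" using \<open>b < k\<close> b(1) by (simp add: t_def)
    then obtain \<alpha> where \<alpha>: "\<alpha> \<in> A t" using A_ne by blast
    have "t * b \<le> 2 * b" using b(1) by (simp add: t_def)
    then have "\<alpha> \<in> A 2" using \<alpha> unfolding A_def by auto
    then have "k \<le> cmod (\<sigma> w \<alpha>)" unfolding k_def using \<open>finite (A 2)\<close> by (intro Min_le) auto
    also have "\<dots> < t * b" using \<alpha> by (simp add: A_def)
    also have "t * b \<le> k / b * b" using b(1) by (intro mult_right_mono) (simp_all add: t_def)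
    finally show False using b(1) by simp
  qed
  then obtain \<alpha> where \<alpha>: "\<alpha> \<in> A 2" "cmod (\<sigma> w \<alpha>) \<le> b" by blast
  show thesis
  proof (rule that)
    show "algebraic_int \<alpha>" "\<alpha> \<noteq> 0" using \<alpha>(1) by (auto simp: A_def)
    show "cmod (\<sigma> i \<alpha>) < m i" if "i < d" "i \<noteq> w" "i \<noteq> conj_index w" for i
      using \<alpha>(1) that by (auto simp: A_def)
    have "(cmod (\<sigma> w \<alpha>))\<^sup>2 * P \<le> b\<^sup>2 * P" using \<alpha>(2) P by (intro mult_right_mono power_mono) auto
    then have "(cmod (\<sigma> w \<alpha>))\<^sup>2 * P \<le> (2 / pi) ^ ?s * cmod (det (embedding_mat \<omega>))"
      by (simp only: b(2))
    then show "(cmod (\<sigma> w \<alpha>))\<^sup>2 * (\<Prod>i\<in>?I. m i) \<le> (2 / pi) ^ ?s * cmod (det (embedding_mat \<omega>))"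
      unfolding P_def .
  qed
qed

lemma nonreal_dominant_generator:
  assumes \<beta>: "algebraic_int \<beta>" "\<sigma> w \<beta> \<notin> \<real>" and w: "w < d" "conj_index w \<noteq> w"
    and small: "\<And>i. i < d \<Longrightarrow> i \<noteq> w \<Longrightarrow> i \<noteq> conj_index w \<Longrightarrow> cmod (\<sigma> i \<beta>) < 1"
  shows "UNIV = generate_field ring_of_type_algebra (\<rat> \<union> {\<beta>})"
    and "weil_height \<beta> = (cmod (\<sigma> w \<beta>))\<^sup>2 powr (1 / d)"
proof -
  let ?I = "{..<d} - {w, conj_index w}"
  have cw: "conj_index w < d" "\<And>x. \<sigma> (conj_index w) x = cnj (\<sigma> w x)"
    using conj_index[OF w(1)] by auto
  have split: "(\<Prod>i<d. u i) = u w * u (conj_index w) * (\<Prod>i\<in>?I. u i)" for u :: "nat \<Rightarrow> real"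
    using w cw(1) by (subst prod.subset_diff[of "{w, conj_index w}" "{..<d}"]) (auto simp: eq_commute[of w])
  have "\<beta> \<noteq> 0" using \<beta>(2) \<sigma>_simps(3)[OF w(1)] by auto
  have "1 \<le> (\<Prod>i<d. cmod (\<sigma> i \<beta>))" by (rule norm_ge_1[OF \<beta>(1) \<open>\<beta> \<noteq> 0\<close>])
  also have "\<dots> = (cmod (\<sigma> w \<beta>))\<^sup>2 * (\<Prod>i\<in>?I. cmod (\<sigma> i \<beta>))"
    unfolding split cw(2) by (simp add: power2_eq_square)
  also have "\<dots> \<le> (cmod (\<sigma> w \<beta>))\<^sup>2 * 1"
    using small by (intro mult_left_mono prod_le_1) (auto intro: less_imp_le)
  finally have "(cmod (\<sigma> w \<beta>))\<^sup>2 \<ge> 1\<^sup>2" by simp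
  then have ge1: "cmod (\<sigma> w \<beta>) \<ge> 1" by (rule power2_le_imp_le) simp
  \<comment> \<open>At \<open>conj_index w\<close> the moduli agree and only non-reality separates
    the two values; at all other indices the moduli differ.\<close>
  have "\<sigma> j \<beta> \<noteq> \<sigma> w \<beta>" if j: "j < d" "j \<noteq> w" for j
  proof (cases "j = conj_index w")
    case True
    then show ?thesis using \<beta>(2) cw(2)[of \<beta>] by (auto simp: Reals_cnj_iff)
  next
    case False
    then show ?thesis using small[OF j] ge1 by auto
  qed
  then have "generate_field ring_of_type_algebra (\<rat> \<union> {\<beta>}) = UNIV"
    using w(1) by (intro field_subset_separating_UNIV[OF field_subset_generate_field]) (auto intro: generate_field.incl)
  then show "UNIV = generate_field ring_of_type_algebra (\<rat> \<union> {\<beta>})" ..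
  have "(\<Prod>i\<in>?I. max 1 (cmod (\<sigma> i \<beta>))) = 1"
    by (intro prod.neutral ballI) (simp add: max_absorb1 less_imp_le small)
  then have "(\<Prod>i<d. max 1 (cmod (\<sigma> i \<beta>))) = (cmod (\<sigma> w \<beta>))\<^sup>2"
    unfolding split cw(2) using ge1 by (simp add: max_absorb2 power2_eq_square)
  then show "weil_height \<beta> = (cmod (\<sigma> w \<beta>))\<^sup>2 powr (1 / d)" unfolding weil_height_eq[OF \<beta>(1)] by simp
qed

text \<open>With \<open>M i = max 1 |\<sigma> i \<mu>|\<close>, the bounds \<open>1 / M i\<close>
  cost the product of the \<open>M i\<close> outside \<open>w\<close>. Multiplying by \<mu> costs at
  most \<open>(M w)^2\<close>, which completes this to the product over all embeddings, the
  \<open>d\<close>-th power of the height of \<mu>. Since \<open>(M w)^2 \<ge> 1\<close>, the same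
  estimate covers the case in which \<alpha> itself is taken.\<close>

lemma small_generator:
  fixes \<omega> :: "nat \<Rightarrow> 'a" and \<mu> :: 'a
  assumes \<omega>: "integral_basis \<omega>" and \<mu>: "algebraic_int \<mu>" "\<not> totally_real \<mu>"
  shows "\<exists>\<alpha> :: 'a. algebraic_int \<alpha> \<and> UNIV = generate_field ring_of_type_algebra (\<rat> \<union> {\<alpha>}) \<and>
     weil_height \<alpha> \<le> weil_height \<mu> *
       ((2 / pi) ^ num_complex_places TYPE('a) * cmod (det (embedding_mat \<omega>))) powr (1 / d)"
proof -
  obtain z where z: "conjugate_over_rat \<mu> z" "z \<notin> \<real>" using \<mu>(2) unfolding totally_real_def by blast
  obtain w where w: "w < d" "\<sigma> w \<mu> = z" using conjugate_eq_embedding[OF z(1)] by blast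
  have cw: "conj_index w \<noteq> w" using conj_index_fixed[OF w(1)] w(2) z(2) by auto
  let ?I = "{..<d} - {w, conj_index w}"
  let ?K = "(2 / pi) ^ num_complex_places TYPE('a) * cmod (det (embedding_mat \<omega>))"
  define M where "M i = max 1 (cmod (\<sigma> i \<mu>))" for i
  have M: "M i \<ge> 1" "cmod (\<sigma> i \<mu>) \<le> M i" for i by (simp_all add: M_def)
  have M0: "M i > 0" for i using M(1)[of i] by linarith
  have Mc: "M (conj_index i) = M i" if "i < d" for i by (simp add: M_def conj_index(2)[OF that])
  obtain \<alpha> where \<alpha>: "algebraic_int \<alpha>" "\<alpha> \<noteq> 0"
    "\<And>i. i < d \<Longrightarrow> i \<noteq> w \<Longrightarrow> i \<noteq> conj_index w \<Longrightarrow> cmod (\<sigma> i \<alpha>) < 1 / M i"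
    "(cmod (\<sigma> w \<alpha>))\<^sup>2 * (\<Prod>i\<in>?I. 1 / M i) \<le> ?K"
    by (rule small_algebraic_int[OF \<omega> w(1) cw, of "\<lambda>i. 1 / M i"]) (use M0 Mc in auto)
  have P: "(\<Prod>i\<in>?I. M i) > 0" using M0 by (intro prod_pos) auto
  have "(\<Prod>i\<in>?I. 1 / M i) = 1 / (\<Prod>i\<in>?I. M i)" by (simp add: prod_dividef)
  then have "(cmod (\<sigma> w \<alpha>))\<^sup>2 / (\<Prod>i\<in>?I. M i) \<le> ?K" using \<alpha>(4) by simp
  then have \<alpha>K: "(cmod (\<sigma> w \<alpha>))\<^sup>2 \<le> ?K * (\<Prod>i\<in>?I. M i)" using P by (simp only: pos_divide_le_eq)
  have all: "(\<Prod>i<d. M i) = (M w)\<^sup>2 * (\<Prod>i\<in>?I. M i)"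
    using w(1) cw conj_index(1)[OF w(1)] Mc[OF w(1)]
    by (subst prod.subset_diff[of "{w, conj_index w}" "{..<d}"]) (auto simp: power2_eq_square eq_commute[of w])
  have bound: "weil_height \<beta> \<le> weil_height \<mu> * ?K powr (1 / d)"
    if "weil_height \<beta> = (cmod (\<sigma> w \<beta>))\<^sup>2 powr (1 / d)" "(cmod (\<sigma> w \<beta>))\<^sup>2 \<le> (cmod (\<sigma> w \<alpha>))\<^sup>2 * (M w)\<^sup>2" for \<beta>
  proof -
    have "(cmod (\<sigma> w \<beta>))\<^sup>2 \<le> (cmod (\<sigma> w \<alpha>))\<^sup>2 * (M w)\<^sup>2" by (rule that(2))
    also have "\<dots> \<le> ?K * (\<Prod>i\<in>?I. M i) * (M w)\<^sup>2" using \<alpha>K by (intro mult_right_mono) auto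
    also have "\<dots> = (\<Prod>i<d. M i) * ?K" unfolding all by (simp add: mult_ac)
    finally have "weil_height \<beta> \<le> ((\<Prod>i<d. M i) * ?K) powr (1 / d)"
      unfolding that(1) by (intro powr_mono2) auto
    also have "\<dots> = (\<Prod>i<d. M i) powr (1 / d) * ?K powr (1 / d)"
      using M0 by (intro powr_mult)
    finally show ?thesis unfolding weil_height_eq[OF \<mu>(1)] M_def .
  qed
  show ?thesis
  proof (cases "\<sigma> w \<alpha> \<in> \<real>")
    case False
    have small: "cmod (\<sigma> i \<alpha>) < 1" if "i < d" "i \<noteq> w" "i \<noteq> conj_index w" for i
    proof -
      have "1 / M i \<le> 1" using M(1)[of i] by simp
      with \<alpha>(3)[OF that] show ?thesis by (rule less_le_trans)
    qed
    have gen: "UNIV = generate_field ring_of_type_algebra (\<rat> \<union> {\<alpha>})"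
      "weil_height \<alpha> = (cmod (\<sigma> w \<alpha>))\<^sup>2 powr (1 / d)"
      by (rule nonreal_dominant_generator[OF \<alpha>(1) False w(1) cw small]; assumption)+
    have "1 \<le> (M w)\<^sup>2" using M(1)[of w] by (simp add: one_le_power)
    then have "(cmod (\<sigma> w \<alpha>))\<^sup>2 \<le> (cmod (\<sigma> w \<alpha>))\<^sup>2 * (M w)\<^sup>2"
      using mult_left_mono[of 1 "(M w)\<^sup>2" "(cmod (\<sigma> w \<alpha>))\<^sup>2"] by simp
    then have "weil_height \<alpha> \<le> weil_height \<mu> * ?K powr (1 / d)" by (rule bound[OF gen(2)])
    with \<alpha>(1) gen(1) show ?thesis by blast
  next
    case True
    have s: "\<sigma> w (\<alpha> * \<mu>) = \<sigma> w \<alpha> * \<sigma> w \<mu>" by (rule \<sigma>_simps(2)[OF w(1)])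
    have nz: "\<sigma> w \<alpha> \<noteq> 0" using \<alpha>(2) \<sigma>_simps(10)[OF w(1)] by simp
    have nonreal: "\<sigma> w (\<alpha> * \<mu>) \<notin> \<real>"
    proof
      assume "\<sigma> w (\<alpha> * \<mu>) \<in> \<real>"
      then have "\<sigma> w (\<alpha> * \<mu>) / \<sigma> w \<alpha> \<in> \<real>" using True by (rule Reals_divide)
      then show False using nz z(2) w(2) by (simp add: s)
    qed
    have int: "algebraic_int (\<alpha> * \<mu>)" by (rule algebraic_int_times[OF \<alpha>(1) \<mu>(1)])
    have small: "cmod (\<sigma> i (\<alpha> * \<mu>)) < 1" if i: "i < d" "i \<noteq> w" "i \<noteq> conj_index w" for i
    proof -
      have "cmod (\<sigma> i (\<alpha> * \<mu>)) = cmod (\<sigma> i \<alpha>) * cmod (\<sigma> i \<mu>)" using i by (simp add: \<sigma>_simps norm_mult)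
      also have "\<dots> \<le> cmod (\<sigma> i \<alpha>) * M i" using M(2) by (intro mult_left_mono) auto
      also have "\<dots> < 1 / M i * M i" using \<alpha>(3)[OF i] M0 by (rule mult_strict_right_mono)
      also have "\<dots> = 1" using M0[of i] by simp
      finally show ?thesis .
    qed
    have gen: "UNIV = generate_field ring_of_type_algebra (\<rat> \<union> {\<alpha> * \<mu>})"
      "weil_height (\<alpha> * \<mu>) = (cmod (\<sigma> w (\<alpha> * \<mu>)))\<^sup>2 powr (1 / d)"
      by (rule nonreal_dominant_generator[OF int nonreal w(1) cw small]; assumption)+
    have "(cmod (\<sigma> w (\<alpha> * \<mu>)))\<^sup>2 \<le> (cmod (\<sigma> w \<alpha>))\<^sup>2 * (M w)\<^sup>2"
      unfolding s norm_mult power_mult_distrib using M(2) by (intro mult_left_mono power_mono) auto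
    then have "weil_height (\<alpha> * \<mu>) \<le> weil_height \<mu> * ?K powr (1 / d)" by (rule bound[OF gen(2)])
    with int gen(1) show ?thesis by blast
  qed
qed

end

theorem theorem1p2:
  fixes \<mu> :: "'a::field_char_0"
  assumes "number_field TYPE('a)"
    and "algebraic_int \<mu>"
    and "\<not> totally_real \<mu>"
  shows "\<exists>\<alpha> :: 'a. algebraic_int \<alpha> \<and>
           (UNIV :: 'a set) = generate_field ring_of_type_algebra (\<rat> \<union> {\<alpha>}) \<and>
           weil_height \<alpha> \<le> weil_height \<mu> * c_const TYPE('a)"
proof -
  obtain \<theta> :: 'a and f where "primitive_element \<theta> f"
    by (rule number_field_primitive[OF assms(1)])
  then interpret primitive_element \<theta> f .
  obtain \<omega> :: "nat \<Rightarrow> 'a" and \<sigma> where \<omega>\<sigma>: "integral_basis \<omega>" "enumerates_embeddings \<sigma>"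
    "discriminant TYPE('a) = (det (Matrix.mat (degree f) (degree f) (\<lambda>(i, j). \<sigma> i (\<omega> j))))\<^sup>2"
    by (rule discriminant_witness)
  interpret number_field_embeddings \<theta> f \<sigma> by unfold_locales (rule \<omega>\<sigma>(2))
  let ?D = "cmod (det (embedding_mat \<omega>))"
  let ?s = "num_complex_places TYPE('a)"
  have D: "?D > 0" using det_embedding_mat_nz[OF integral_basis_spanning[OF \<omega>\<sigma>(1)]] by simp
  have disc: "cmod (discriminant TYPE('a)) = ?D\<^sup>2"
    unfolding \<omega>\<sigma>(3) embedding_mat_def by (rule norm_power)
  \<comment> \<open>The modulus of the discriminant is \<open>?D\<close> squared, which absorbs the
    2 in the exponent \<open>1 / (2 * d)\<close> of \<open>c_const\<close>.\<close>
  have "?D powr 2 = ?D\<^sup>2" by (rule powr_numeral) (use D in simp)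
  then have "?D\<^sup>2 powr (1 / (2 * real d)) = (?D powr 2) powr (1 / (2 * real d))" by (simp only:)
  also have "\<dots> = ?D powr (1 / d)" unfolding powr_powr by simp
  finally have root: "?D\<^sup>2 powr (1 / (2 * real d)) = ?D powr (1 / d)" .
  have "c_const TYPE('a) = (2 / pi) powr (?s / d) * ?D powr (1 / d)"
    unfolding c_const_def disc field_degree_eq root by (rule refl)
  also have "(2 / pi) powr (?s / d) = ((2 / pi) ^ ?s) powr (1 / d)"
    by (simp add: powr_powr flip: powr_realpow)
  also have "((2 / pi) ^ ?s) powr (1 / d) * ?D powr (1 / d) = ((2 / pi) ^ ?s * ?D) powr (1 / d)"
    by (rule powr_mult[symmetric])
  finally show ?thesis using small_generator[OF \<omega>\<sigma>(1) assms(2,3)] by simp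
qed

end
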